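(* Let $n\ge1$ and $N\ge n+1$ be integers, let $r\ge1$ be real, let $e_1,\dots,e_N$ be the standard orthonormal basis of $\mathbb{R}^N$, and let $C=\operatorname{conv}\{e_1,\dots,e_N\}$. Let $(K_t)_{t\in[-1,1]}$ be an RS-movement in $\mathbb{R}^n$, where each $K_t$ is a convex body. Then $$t\longmapsto W^{s\circ}_{r}(K_t;N;C)$$ is a convex function of $t$.
   Context: A convex body is a compact convex set with non-empty interior. $|\cdot|$ denotes Lebesgue measure on $\mathbb{R}^n$ and $\operatorname{conv}$ denotes convex hull. For a set $L\subset\mathbb{R}^n$, the polar is $L^{\circ}=\{\omega\in\mathbb{R}^n:\langle\omega,x\rangle\le 1\ \forall x\in L\}$. For a convex body $L\subset\mathbb{R}^n$, $L^{s\circ}=(L-s)^{\circ}$, where $s$ is the Santaló point of $L$, i.e. the unique point in the interior of $L$ such that $|(L-s)^{\circ}|=\min_{x\in\operatorname{int}L}|(L-x)^{\circ}|$. For $x_1,\dots,x_N\in\mathbb{R}^n$ and $C\subset\mathbb{R}^N$, $[x_1\cdots x_N]C=\{\sum_{i=1}^N c_ix_i : (c_1,\dots,c_N)\in C\}\subset\mathbb{R}^n$; for $C=\operatorname{conv}\{e_1,\dots,e_N\}$ this is $\operatorname{conv}\{x_1,\dots,x_N\}$. For a convex body $K\subset\mathbb{R}^n$, $r\ge1$ and $N\ge n+1$, $$W^{s\circ}_r(K;N;C)=\frac{1}{|K|^{N+r}}\int_{K^N}\bigl|([x_1\cdots x_N]C)^{s\circ}\bigr|^{-r}\,dx_1\cdots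 dx_N,$$ where the integrand is defined for almost every $(x_1,\dots,x_N)$ (those for which $\operatorname{conv}\{x_1,\dots,x_N\}$ has non-empty interior). Equivalently, $W^{s\circ}_r(K;N;C)=|K|^{-r}\,\mathbb{E}\,|([X_1\cdots X_N]C)^{s\circ}|^{-r}$ with $X_1,\dots,X_N$ independent random vectors uniformly distributed in $K$. Shadow system: a shadow system along a direction $\theta\in\mathbb{S}^{n-1}$ (the unit sphere of $\mathbb{R}^n$) is a family of convex sets $K_t=\operatorname{conv}\{x+t\alpha(x)\theta : x\in A\}\subset\mathbb{R}^n$, where $A\subset\mathbb{R}^n$ is an arbitrary bounded set, $\alpha$ is a bounded function on $A$, and $t$ belongs to an interval of the real axis. RS-movement: let $K\subset\mathbb{R}^n$ and let $P$ be the orthogonal projection onto $\theta^{\perp}$. A shadow system is called an RS-movement of $K$ if $$K_t=\operatorname{conv}\{x+t\beta(Px)\theta : x\in K\},$$ where $t\in[a,b]$, $0\in[a,b]$, and $\beta$ is a real-valued function on $PK$ (so the speed function is constant on each chord of $K$ parallel to $\theta$).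
   Formalization: An RS-movement is also required to have, for every t, the translated chords {x+tβ(Px)θ : x∈K} already convex, so the hull adds no points; without this the claim fails (n=2, N=3, r=1, a square whose middle chord alone is moved). *)

theory Defs
  imports "HOL-Analysis.Analysis"
begin

definition convex_body :: "(real^'n) set \<Rightarrow> bool" where
  "convex_body L \<longleftrightarrow> compact L \<and> convex L \<and> interior L \<noteq> {}"

definition polar :: "(real^'n) set \<Rightarrow> (real^'n) set" where
  "polar L = {w. \<forall>x\<in>L. w \<bullet> x \<le> 1}"

definition santalo_point :: "(real^'n) set \<Rightarrow> real^'n" where
  "santalo_point L =
     (THE s. is_arg_min (\<lambda>x. measure lborel (polar ((\<lambda>y. y - x) ` L))) (\<lambda>x. x \<in> interior L) s)"

definition santalo_polar :: "(real^'n) set \<Rightarrow> (real^'n) set" where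
  "santalo_polar L = polar ((\<lambda>y. y - santalo_point L) ` L)"

definition lin_image :: "('m \<Rightarrow> real^'n) \<Rightarrow> (real^'m) set \<Rightarrow> (real^'n) set" where
  "lin_image X C = (\<lambda>c. \<Sum>i\<in>UNIV. (c $ i) *\<^sub>R X i) ` C"

definition simplex_C :: "(real^'m) set" where
  "simplex_C = convex hull (range (\<lambda>i. axis i 1))"

text \<open>The points are indexed by a finite type \<open>'m\<close>, so \<open>N = CARD('m)\<close>, and
  \<open>dx\<^sub>1 \<dots> dx\<^sub>N\<close> is the product of \<open>N\<close> copies of Lebesgue measure. The tuples whose convex hull
  has empty interior, where the integrand is undefined, form a null set (for \<open>N \<ge> n + 1\<close>) and are
  removed from the domain of integration.\<close>

definition W_santalo :: "real \<Rightarrow> (real^'n) set \<Rightarrow> (real^'m) set \<Rightarrow> real" where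
  "W_santalo r K C =
     1 / measure lborel K powr (real CARD('m) + r) *
     (LINT X : {X :: 'm \<Rightarrow> real^'n. (\<forall>i. X i \<in> K) \<and> interior (convex hull (range X)) \<noteq> {}}
        | Pi\<^sub>M UNIV (\<lambda>_. lborel).
        measure lborel (santalo_polar (lin_image X C)) powr (- r))"

definition shadow_system ::
    "(real^'n) set \<Rightarrow> (real^'n \<Rightarrow> real) \<Rightarrow> real^'n \<Rightarrow> real set \<Rightarrow> (real \<Rightarrow> (real^'n) set) \<Rightarrow> bool" where
  "shadow_system A \<alpha> \<theta> T Kt \<longleftrightarrow>
     norm \<theta> = 1 \<and> bounded A \<and> bounded (\<alpha> ` A) \<and> is_interval T \<and>
     (\<forall>t\<in>T. Kt t = convex hull ((\<lambda>x. x + (t * \<alpha> x) *\<^sub>R \<theta>) ` A))"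

definition proj_perp :: "real^'n \<Rightarrow> real^'n \<Rightarrow> real^'n" where
  "proj_perp \<theta> x = x - (x \<bullet> \<theta>) *\<^sub>R \<theta>"  \<comment> \<open>orthogonal projection onto the complement of a unit vector\<close>

text \<open>An RS-movement translates the chords of \<open>K\<close> parallel to \<open>\<theta>\<close>, and \<open>K\<^sub>t\<close> is the body made up
  of the translated chords: the last conjunct says that these chords already form a convex set, so
  that the convex hull adds no points (at \<open>t = 0\<close>: \<open>K\<close> is convex). It is what makes the volume of
  \<open>K\<^sub>t\<close> constant in \<open>t\<close>. Without it an irregular speed would be admitted: if \<open>K\<close> is a square
  with a side parallel to \<open>\<theta>\<close> and \<open>\<beta>\<close> is a large multiple of the indicator function of the
  midpoint of its projection, the hull approaches the shape of a triangle as \<open>t\<close> grows, and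
  \<open>W_santalo\<close> is not convex in \<open>t\<close>.\<close>

definition rs_movement ::
    "(real^'n) set \<Rightarrow> (real^'n \<Rightarrow> real) \<Rightarrow> real^'n \<Rightarrow> real \<Rightarrow> real \<Rightarrow> (real \<Rightarrow> (real^'n) set) \<Rightarrow> bool" where
  "rs_movement K \<beta> \<theta> a b Kt \<longleftrightarrow>
     a \<le> 0 \<and> 0 \<le> b \<and>
     shadow_system K (\<lambda>x. \<beta> (proj_perp \<theta> x)) \<theta> {a..b} Kt \<and>
     (\<forall>t\<in>{a..b}. convex ((\<lambda>x. x + (t * \<beta> (proj_perp \<theta> x)) *\<^sub>R \<theta>) ` K))"

end

theory Submission
  imports Defs "HOL-Probability.Distributions"
begin

text \<open>The body \<open>K\<^sub>t\<close> is the image of \<open>K\<close> under a shear \<open>F\<^sub>t\<close> that preserves Lebesgue measure, so all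
  integrals can be taken over the same set \<open>K\<^sup>N\<close>, and it suffices to show that for almost every tuple
  \<open>X\<close> the reciprocal of the volume of the Santalo polar of \<open>conv (F\<^sub>t X)\<close> is convex in \<open>t\<close>.

  Let \<open>h\<^sub>t\<close> be the support function of \<open>conv (F\<^sub>t X)\<close>. The volume of the polar with respect to an interior
  point \<open>s\<close> is \<open>1/n!\<close> times the integral of \<open>exp (\<langle>w, s\<rangle> - h\<^sub>t w)\<close>. On the half-space \<open>\<langle>w, \<theta>\<rangle> > 0\<close> the
  restriction of \<open>h\<^sub>t\<close> to the hyperplane \<open>\<langle>w, \<theta>\<rangle> = 1\<close> is convex jointly in \<open>w\<close> and \<open>t\<close>, and the
  integral over the half-space is a multiple of the integral of \<open>h powr (-n)\<close> over that hyperplane of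
  dimension \<open>n - 1\<close>; by the Borell--Brascamp--Lieb inequality its reciprocal is convex in \<open>t\<close>. The same
  holds for the opposite half-space. To add the two halves, the Santalo point \<open>s\<close> at the intermediate
  time is moved in the direction \<open>\<theta>\<close> to points \<open>s0\<close>, \<open>s1\<close> at the end times, linearly in time and such
  that the two halves have the same ratio at both ends; the shift is found by the intermediate value
  theorem, since a half blows up when its point reaches the boundary.\<close>

subsection \<open>One-dimensional Brunn--Minkowski and Borell--Brascamp--Lieb inequalities\<close>

text \<open>The speed enters the support function through
  \<open>t * \<gamma> i * (w \<bullet> \<theta>)\<close>, which is bilinear in \<open>t\<close> and
  \<open>w\<close>. Joint convexity can fail between vectors of different height
  \<open>w \<bullet> \<theta>\<close> and holds between vectors of equal height; this forces the
  passage to a slice, and homogeneity then recovers each half-space separately. The exponents fit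
  exactly: an integrand of power \<open>-n\<close> loses one unit for each of the
  \<open>n - 1\<close> slice coordinates, so that one unit is left, which is convexity of the
  reciprocal. The obstacle is the sum of the halves. Each half is bounded below by the weighted
  harmonic mean of its end values, and harmonic means are superadditive: the mean of the sums can
  exceed the sum of the means. Equality holds when the pairs of halves at the two ends are
  proportional, hence the balancing shift. Minimality is spent at the end times, where any interior
  points \<open>s0\<close>, \<open>s1\<close> bound the minima from above; only \<open>s\<close> has
  to be a true minimizer.\<close>

lemma emeasure_lborel_inner_compact:
  fixes A :: "'a::euclidean_space set"
  assumes A[measurable]: "A \<in> sets borel" "A \<noteq> {}"
  shows "emeasure lborel A = (SUP K\<in>{K. compact K \<and> K \<subseteq> A \<and> K \<noteq> {}}. emeasure lborel K)"
    (is "_ = Sup (_ ` ?S)")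
proof (rule antisym)
  show "emeasure lborel A \<le> (SUP K\<in>?S. emeasure lborel K)"
  proof (rule ccontr)
    assume "\<not> ?thesis"
    then have lt: "(SUP K\<in>?S. emeasure lborel K) < emeasure lborel A" by simp
    have "(SUP k. emeasure lborel (A \<inter> cball 0 (real k))) = emeasure lborel (\<Union>k. A \<inter> cball 0 (real k))"
      by (intro SUP_emeasure_incseq) (auto simp: incseq_def)
    also have "(\<Union>k. A \<inter> cball 0 (real k)) = A"
      using real_arch_simple by auto
    finally have "(SUP K\<in>?S. emeasure lborel K) < (SUP k. emeasure lborel (A \<inter> cball 0 (real k)))"
      using lt by simp
    then obtain k where k: "(SUP K\<in>?S. emeasure lborel K) < emeasure lborel (A \<inter> cball 0 (real k))"
      unfolding less_SUP_iff by blast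
    \<comment> \<open>Inner regularity is applied to a finite measure, so Lebesgue measure is cut
      down to a ball that already carries more than the alleged supremum.\<close>
    define M where "M = density lborel (indicator (cball 0 (real k)) :: 'a \<Rightarrow> ennreal)"
    have M: "emeasure M B = emeasure lborel (B \<inter> cball 0 (real k))" if "B \<in> sets borel" for B
      using that by (simp add: M_def emeasure_restricted Int_commute)
    have "emeasure M A = (SUP K \<in> {K. K \<subseteq> A \<and> compact K}. emeasure M K)"
    proof (rule inner_regular)
      show "emeasure M (space M) \<noteq> \<infinity>"
        using M[of UNIV] emeasure_lborel_cball_finite[of "0::'a" "real k"] by (simp add: M_def)
    qed (simp_all add: M_def)
    then have "(SUP K\<in>?S. emeasure lborel K) < (SUP K \<in> {K. K \<subseteq> A \<and> compact K}. emeasure M K)"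
      using k M[of A] A(1) by simp
    then obtain K where K: "K \<subseteq> A" "compact K"
      "(SUP K\<in>?S. emeasure lborel K) < emeasure M K"
      unfolding less_SUP_iff by blast
    have "emeasure M K \<le> emeasure lborel K"
      using K(2) by (subst M) (auto intro!: emeasure_mono simp: borel_compact)
    with K(3) have "(SUP K\<in>?S. emeasure lborel K) < emeasure lborel K" by (rule order.strict_trans2)
    moreover from this have "K \<noteq> {}" by auto
    then have "emeasure lborel K \<le> (SUP K\<in>?S. emeasure lborel K)"
      using K(1,2) by (intro SUP_upper) auto
    ultimately show False by simp
  qed
  show "(SUP K\<in>?S. emeasure lborel K) \<le> emeasure lborel A"
    by (auto intro!: SUP_least emeasure_mono)
qed

lemma emeasure_lborel_translate:
  fixes c :: "'a::euclidean_space"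
  assumes "A \<in> sets borel"
  shows "emeasure lborel ((+) c ` A) = emeasure lborel A"
proof -
  have eq: "(+) c ` A = (+) (- c) -` A" by force
  have "emeasure (distr lborel borel ((+) (- c))) A = emeasure lborel ((+) (- c) -` A)"
    using assms by (subst emeasure_distr) auto
  then show ?thesis by (simp add: eq lborel_distr_plus)
qed

text \<open>With \<open>a\<close> the maximum of \<open>A\<close> and \<open>b\<close> the minimum
  of \<open>B\<close>, the translates \<open>b + A\<close> and \<open>a + B\<close> both lie in
  \<open>C\<close> and meet at most in the point \<open>a + b\<close>, so their measures add up
  inside \<open>C\<close>.\<close>

lemma compact_translate_sum_le:
  fixes A B C :: "real set"
  assumes "compact A" "A \<noteq> {}" "compact B" "B \<noteq> {}" and C: "C \<in> sets borel"
    and sub: "\<And>x y. x \<in> A \<Longrightarrow> y \<in> B \<Longrightarrow> x + y \<in> C"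
  shows "emeasure lborel A + emeasure lborel B \<le> emeasure lborel C"
proof -
  obtain a where a: "a \<in> A" "\<And>x. x \<in> A \<Longrightarrow> x \<le> a"
    using compact_attains_sup[OF assms(1,2)] by auto
  obtain b where b: "b \<in> B" "\<And>x. x \<in> B \<Longrightarrow> b \<le> x"
    using compact_attains_inf[OF assms(3,4)] by auto
  let ?A = "(+) b ` A" and ?B = "(+) a ` B"
  have [measurable]: "A \<in> sets borel" "B \<in> sets borel" using assms by (auto simp: borel_compact)
  have cA: "?A \<in> sets borel" "?B \<in> sets borel"
    using assms by (auto intro!: borel_compact compact_translation)
  have "?A \<inter> ?B \<subseteq> {a + b}"
  proof
    fix z assume z: "z \<in> ?A \<inter> ?B"
    then obtain x where "z = b + x" "x \<in> A" by auto
    moreover from z obtain y where "z = a + y" "y \<in> B" by auto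
    ultimately show "z \<in> {a + b}" using a(2)[of x] b(2)[of y] by auto
  qed
  then have null: "?A \<inter> ?B \<in> null_sets lborel"
    using cA by (meson finite.intros finite_imp_null_set_lborel finite_subset)
  have sub': "y + x \<in> C" if "x \<in> A" "y \<in> B" for x y
    using sub[OF that] by (simp add: add.commute)
  have "emeasure lborel A + emeasure lborel B = emeasure lborel ?A + emeasure lborel ?B"
    by (simp add: emeasure_lborel_translate)
  also have "\<dots> = emeasure lborel (?A - (?A \<inter> ?B)) + emeasure lborel ?B"
    using cA by (subst emeasure_Diff_null_set[OF null]) auto
  also have "\<dots> = emeasure lborel ((?A - (?A \<inter> ?B)) \<union> ?B)"
    using cA by (intro plus_emeasure) auto
  also have "\<dots> \<le> emeasure lborel C"
    using C a(1) b(1) by (intro emeasure_mono) (auto intro: sub sub')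
  finally show ?thesis .
qed

text \<open>The sum set of two Borel sets need not be Borel, so a measurable \<open>C\<close>
  containing it takes its place. Both sets are exhausted by compact subsets, one after the
  other.\<close>

lemma brunn_minkowski_real:
  fixes A B C :: "real set"
  assumes A: "A \<in> sets borel" "A \<noteq> {}" and B: "B \<in> sets borel" "B \<noteq> {}" and C: "C \<in> sets borel"
    and sub: "\<And>x y. x \<in> A \<Longrightarrow> y \<in> B \<Longrightarrow> x + y \<in> C"
  shows "emeasure lborel A + emeasure lborel B \<le> emeasure lborel C"
proof -
  have ne: "{K. compact K \<and> K \<subseteq> X \<and> K \<noteq> {}} \<noteq> {}" if "X \<noteq> {}" for X :: "real set"
    using that by (auto intro!: exI[of _ "{SOME x. x \<in> X}"] simp: some_in_eq)
  have 1: "emeasure lborel A + emeasure lborel K \<le> emeasure lborel C"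
    if "compact K" "K \<subseteq> B" "K \<noteq> {}" for K
    unfolding emeasure_lborel_inner_compact[OF A]
    apply (subst ennreal_SUP_add_left[symmetric, OF ne[OF A(2)]])
    using that sub by (intro SUP_least compact_translate_sum_le C) auto
  show ?thesis
    unfolding emeasure_lborel_inner_compact[OF B]
    apply (subst ennreal_SUP_add_right[OF ne[OF B(2)]])
    by (intro SUP_least 1) auto
qed

lemma brunn_minkowski_real_convex:
  fixes A B C :: "real set"
  assumes A[measurable]: "A \<in> sets borel" "A \<noteq> {}" and B[measurable]: "B \<in> sets borel" "B \<noteq> {}"
    and C: "C \<in> sets borel" and u: "0 < u" "u < 1"
    and sub: "\<And>x y. x \<in> A \<Longrightarrow> y \<in> B \<Longrightarrow> (1 - u) * x + u * y \<in> C"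
  shows "ennreal (1 - u) * emeasure lborel A + ennreal u * emeasure lborel B \<le> emeasure lborel C"
proof -
  have scale: "(\<lambda>x. x / c) -` X \<in> sets borel"
    "emeasure lborel ((\<lambda>x. x / c) -` X) = ennreal c * emeasure lborel X"
    if X[measurable]: "X \<in> sets borel" and c: "c > 0" for X :: "real set" and c
  proof -
    have "(\<lambda>x. x / c) \<in> borel_measurable borel" by measurable
    from measurable_sets[OF this X] show m[measurable]: "(\<lambda>x. x / c) -` X \<in> sets borel" by simp
    have "emeasure lborel ((\<lambda>x. x / c) -` X) = (\<integral>\<^sup>+x. indicator ((\<lambda>x. x / c) -` X) x \<partial>lborel)" by simp
    also have "\<dots> = ennreal \<bar>c\<bar> * (\<integral>\<^sup>+x. indicator ((\<lambda>x. x / c) -` X) (0 + c * x) \<partial>lborel)"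
      by (rule nn_integral_real_affine) (measurable, use c in simp)
    also have "(\<lambda>x. indicator ((\<lambda>x. x / c) -` X) (0 + c * x) :: ennreal) = indicator X"
      using c by (auto simp: fun_eq_iff split: split_indicator)
    finally show "emeasure lborel ((\<lambda>x. x / c) -` X) = ennreal c * emeasure lborel X"
      using c by simp
  qed
  have ne: "(\<lambda>x. x / c) -` X \<noteq> {}" if X: "X \<noteq> {}" "c > 0" for X :: "real set" and c
  proof -
    obtain x where "x \<in> X" using X(1) by blast
    then have "c * x \<in> (\<lambda>x. x / c) -` X" using X(2) by simp
    then show ?thesis by blast
  qed
  have "emeasure lborel ((\<lambda>x. x / (1 - u)) -` A) + emeasure lborel ((\<lambda>x. x / u) -` B) \<le> emeasure lborel C"
  proof (rule brunn_minkowski_real)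
    fix x y assume "x \<in> (\<lambda>x. x / (1 - u)) -` A" "y \<in> (\<lambda>x. x / u) -` B"
    then show "x + y \<in> C" using sub[of "x / (1 - u)" "y / u"] u by auto
  qed (use u A B C ne[OF A(2), of "1 - u"] ne[OF B(2) u(1)] in \<open>auto intro!: scale(1)\<close>)
  with u show ?thesis by (simp add: scale)
qed

text \<open>The layer-cake formula, cut at level 1: Brunn--Minkowski needs nonempty superlevel sets,
  and for functions normalised to supremum 1 exactly the levels below 1 provide them.\<close>

lemma nn_integral_min_1_layer:
  fixes F :: "real \<Rightarrow> ennreal"
  assumes [measurable]: "F \<in> borel_measurable borel"
  shows "(\<integral>\<^sup>+x. min (F x) 1 \<partial>lborel) =
    (\<integral>\<^sup>+s. indicator {0..<1} s * emeasure lborel {x. ennreal s < F x} \<partial>lborel)"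
proof -
  have inner: "min (F x) 1 = (\<integral>\<^sup>+s. indicator {0..<1} s * indicator {x. ennreal s < F x} x \<partial>lborel)" for x
  proof -
    have "(\<integral>\<^sup>+s. indicator {0..<1} s * indicator {x. ennreal s < F x} x \<partial>lborel)
      = (\<integral>\<^sup>+s. indicator {0..<enn2real (min (F x) 1)} s \<partial>lborel)"
    proof (rule nn_integral_cong)
      fix s :: real
      show "indicator {0..<1} s * indicator {x. ennreal s < F x} x
        = (indicator {0..<enn2real (min (F x) 1)} s :: ennreal)"
      proof (cases "F x")
        case (real r)
        then show ?thesis
          by (auto simp: min_def ennreal_less_iff split: split_indicator)
      qed (auto split: split_indicator simp: min_def top_unique)
    qed
    also have "\<dots> = ennreal (enn2real (min (F x) 1))" by simp
    also have "\<dots> = min (F x) 1"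
      by (rule ennreal_enn2real) (auto simp: min_less_iff_disj)
    finally show ?thesis by simp
  qed
  have "(\<integral>\<^sup>+x. min (F x) 1 \<partial>lborel)
    = (\<integral>\<^sup>+x. (\<integral>\<^sup>+s. indicator {0..<1} s * indicator {x. ennreal s < F x} x \<partial>lborel) \<partial>lborel)"
    by (simp add: inner)
  also have "\<dots> = (\<integral>\<^sup>+s. (\<integral>\<^sup>+x. indicator {0..<1} s * indicator {x. ennreal s < F x} x \<partial>lborel) \<partial>lborel)"
    by (rule lborel_pair.Fubini') (simp add: indicator_def)
  also have "\<dots> = (\<integral>\<^sup>+s. indicator {0..<1} s * emeasure lborel {x. ennreal s < F x} \<partial>lborel)"
    by (intro nn_integral_cong) (subst nn_integral_cmult, auto)
  finally show ?thesis .
qed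

text \<open>After \<open>f\<close> and \<open>g\<close> are scaled to supremum 1 by factors
  \<open>a ^ p\<close> and \<open>b ^ p\<close>, hypothesis \<open>H\<close> for these very
  \<open>a\<close>, \<open>b\<close> says that superlevel sets combine into a superlevel set of
  \<open>d ^ p * m\<close>. Brunn--Minkowski on each level, integrated over the levels, bounds the
  weighted sum of the scaled integrals of \<open>f\<close> and \<open>g\<close> by
  \<open>d ^ p\<close> times the integral of \<open>m\<close>.\<close>

lemma bbl_real_bounded:
  fixes f g m :: "real \<Rightarrow> ennreal" and u :: real and p :: nat
  assumes [measurable]: "f \<in> borel_measurable borel" "g \<in> borel_measurable borel" "m \<in> borel_measurable borel"
    and u: "0 < u" "u < 1" and p: "p > 0"
    and bd: "\<And>x. f x \<le> ennreal k" "\<And>x. g x \<le> ennreal k"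
    and H: "\<And>x y a b. 0 < a \<Longrightarrow> 0 < b \<Longrightarrow> min (ennreal (a ^ p) * f x) (ennreal (b ^ p) * g y)
       \<le> ennreal (((1 - u) * a + u * b) ^ p) * m ((1 - u) * x + u * y)"
  shows "min (\<integral>\<^sup>+x. f x \<partial>lborel) (\<integral>\<^sup>+x. g x \<partial>lborel) \<le> (\<integral>\<^sup>+x. m x \<partial>lborel)"
proof -
  have norm: "(\<integral>\<^sup>+x. h x \<partial>lborel) = 0 \<or> (\<exists>a>0. (\<forall>x. ennreal (a ^ p) * h x \<le> 1) \<and>
      (\<forall>s\<in>{0..<1}. \<exists>x. ennreal s < ennreal (a ^ p) * h x))"
    if bd: "\<And>x. h x \<le> ennreal k" for h :: "real \<Rightarrow> ennreal"
  proof (cases "(SUP x. h x) = 0")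
    case True
    then have "h x = 0" for x by (metis SUP_upper UNIV_I le_zero_eq)
    then show ?thesis by simp
  next
    case False
    have "(SUP x. h x) \<le> ennreal k" using bd by (auto intro: SUP_least)
    then obtain A where A: "(SUP x. h x) = ennreal A" "A > 0"
      using False by (cases "SUP x. h x") (auto simp: top_unique order.strict_iff_order)
    \<comment> \<open>The normalising factor is written as a \<open>p\<close>-th power because
      \<open>H\<close> admits only factors of that form; the bound \<open>k\<close> makes the
      supremum \<open>A\<close> finite.\<close>
    define a where "a = root p (1 / A)"
    have a: "a > 0" "a ^ p = 1 / A" using A p by (auto simp: a_def)
    have "ennreal (a ^ p) * h x \<le> 1" for x
    proof -
      have "ennreal (a ^ p) * h x \<le> ennreal (a ^ p) * ennreal A"
        using A(1) by (intro mult_left_mono) (metis SUP_upper UNIV_I, simp)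
      also have "\<dots> = 1" using A a by (simp flip: ennreal_mult')
      finally show ?thesis .
    qed
    moreover have "\<exists>x. ennreal s < ennreal (a ^ p) * h x" if s: "s \<in> {0..<1}" for s
    proof -
      have "ennreal (s * A) < (SUP x. h x)"
        using s A by (simp add: ennreal_less_iff)
      then obtain x where x: "ennreal (s * A) < h x" by (auto simp: less_SUP_iff)
      have "ennreal s = ennreal (a ^ p) * ennreal (s * A)"
        using a A s by (simp flip: ennreal_mult')
      also have "\<dots> < ennreal (a ^ p) * h x"
        using x a A(2) by (intro ennreal_mult_strict_left_mono) auto
      finally show ?thesis by auto
    qed
    ultimately show ?thesis using a(1) by blast
  qed
  show ?thesis
  proof (cases "(\<integral>\<^sup>+x. f x \<partial>lborel) = 0 \<or> (\<integral>\<^sup>+x. g x \<partial>lborel) = 0")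
    case False
    obtain a where a: "a > 0" "\<And>x. ennreal (a ^ p) * f x \<le> 1"
        "\<And>s. s\<in>{0..<1} \<Longrightarrow> \<exists>x. ennreal s < ennreal (a ^ p) * f x"
      using norm[of f] bd(1) False by metis
    obtain b where b: "b > 0" "\<And>x. ennreal (b ^ p) * g x \<le> 1"
        "\<And>s. s\<in>{0..<1} \<Longrightarrow> \<exists>x. ennreal s < ennreal (b ^ p) * g x"
      using norm[of g] bd(2) False by metis
    define d where "d = (1 - u) * a + u * b"
    have d: "d > 0" using a b u by (auto simp: d_def intro!: add_pos_pos)
    let ?F = "\<integral>\<^sup>+x. f x \<partial>lborel" and ?G = "\<integral>\<^sup>+x. g x \<partial>lborel"
    \<comment> \<open>Convexity of the power compares \<open>d ^ p\<close> with the weighted sum of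
      \<open>a ^ p\<close> and \<open>b ^ p\<close>, so that the scaling factors can be cancelled at
      the end.\<close>
    have "convex_on {0..} (\<lambda>x::real. x ^ p)"
      using convex_power_odd[of p] convex_on_subset[OF convex_power_even[of p]] by (cases "even p") auto
    from convex_onD[OF this, of u a b] have "d ^ p \<le> (1 - u) * a ^ p + u * b ^ p"
      using u a b by (simp add: d_def)
    then have "ennreal (d ^ p) * min ?F ?G \<le> ennreal ((1 - u) * a ^ p + u * b ^ p) * min ?F ?G"
      by (intro mult_right_mono ennreal_leI) auto
    also have "\<dots> = ennreal ((1 - u) * a ^ p) * min ?F ?G + ennreal (u * b ^ p) * min ?F ?G"
      using a b u by (simp add: ennreal_plus distrib_right)
    also have "\<dots> \<le> ennreal ((1 - u) * a ^ p) * ?F + ennreal (u * b ^ p) * ?G"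
      by (intro add_mono mult_left_mono) auto
    also have "\<dots> = ennreal (1 - u) * (\<integral>\<^sup>+x. min (ennreal (a ^ p) * f x) 1 \<partial>lborel)
        + ennreal u * (\<integral>\<^sup>+x. min (ennreal (b ^ p) * g x) 1 \<partial>lborel)"
      using a b u by (simp add: min_absorb1 nn_integral_cmult ennreal_mult mult.assoc)
    also have "\<dots> = (\<integral>\<^sup>+s. ennreal (1 - u) * (indicator {0..<1} s * emeasure lborel {x. ennreal s < ennreal (a ^ p) * f x})
        + ennreal u * (indicator {0..<1} s * emeasure lborel {x. ennreal s < ennreal (b ^ p) * g x}) \<partial>lborel)"
      by (simp add: nn_integral_min_1_layer nn_integral_add nn_integral_cmult)
    also have "\<dots> \<le> (\<integral>\<^sup>+s. indicator {0..<1} s * emeasure lborel {x. ennreal s < ennreal (d ^ p) * m x} \<partial>lborel)"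
    proof (rule nn_integral_mono)
      fix s :: real
      show "ennreal (1 - u) * (indicator {0..<1} s * emeasure lborel {x. ennreal s < ennreal (a ^ p) * f x})
        + ennreal u * (indicator {0..<1} s * emeasure lborel {x. ennreal s < ennreal (b ^ p) * g x})
        \<le> indicator {0..<1} s * emeasure lborel {x. ennreal s < ennreal (d ^ p) * m x}"
      proof (cases "s \<in> {0..<1}")
        case True
        have "ennreal (1 - u) * emeasure lborel {x. ennreal s < ennreal (a ^ p) * f x}
          + ennreal u * emeasure lborel {x. ennreal s < ennreal (b ^ p) * g x}
          \<le> emeasure lborel {x. ennreal s < ennreal (d ^ p) * m x}"
        proof (rule brunn_minkowski_real_convex[OF _ _ _ _ _ u])
          fix x y assume "x \<in> {x. ennreal s < ennreal (a ^ p) * f x}" "y \<in> {x. ennreal s < ennreal (b ^ p) * g x}"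
          then have "ennreal s < min (ennreal (a ^ p) * f x) (ennreal (b ^ p) * g y)" by simp
          also have "\<dots> \<le> ennreal (d ^ p) * m ((1 - u) * x + u * y)"
            unfolding d_def by (rule H[OF a(1) b(1)])
          finally show "(1 - u) * x + u * y \<in> {x. ennreal s < ennreal (d ^ p) * m x}" by simp
        qed (use a(3)[OF True] b(3)[OF True] in auto)
        with True show ?thesis by simp
      qed simp
    qed
    also have "\<dots> = (\<integral>\<^sup>+x. min (ennreal (d ^ p) * m x) 1 \<partial>lborel)"
      by (simp add: nn_integral_min_1_layer)
    also have "\<dots> \<le> (\<integral>\<^sup>+x. ennreal (d ^ p) * m x \<partial>lborel)"
      by (intro nn_integral_mono) auto
    also have "\<dots> = ennreal (d ^ p) * (\<integral>\<^sup>+x. m x \<partial>lborel)"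
      by (simp add: nn_integral_cmult)
    finally show ?thesis
      using d by (simp add: ennreal_mult_le_mult_iff)
  qed auto
qed

text \<open>Truncating \<open>f\<close> and \<open>g\<close> at integer levels only lowers the left
  side of \<open>H\<close>, while \<open>m\<close> stays as it is. The bounded case applies to the
  truncations, and monotone convergence removes them.\<close>

lemma bbl_real:
  fixes f g m :: "real \<Rightarrow> ennreal" and u :: real and p :: nat
  assumes [measurable]: "f \<in> borel_measurable borel" "g \<in> borel_measurable borel" "m \<in> borel_measurable borel"
    and u: "0 < u" "u < 1" and p: "p > 0"
    and H: "\<And>x y a b. 0 < a \<Longrightarrow> 0 < b \<Longrightarrow> min (ennreal (a ^ p) * f x) (ennreal (b ^ p) * g y)
       \<le> ennreal (((1 - u) * a + u * b) ^ p) * m ((1 - u) * x + u * y)"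
  shows "min (\<integral>\<^sup>+x. f x \<partial>lborel) (\<integral>\<^sup>+x. g x \<partial>lborel) \<le> (\<integral>\<^sup>+x. m x \<partial>lborel)"
proof (rule ccontr)
  have SUP: "(\<integral>\<^sup>+x. h x \<partial>lborel) = (SUP k. \<integral>\<^sup>+x. min (h x) (of_nat k) \<partial>lborel)"
    if [measurable]: "h \<in> borel_measurable borel" for h :: "real \<Rightarrow> ennreal"
  proof -
    have *: "(SUP k. min (h x) (of_nat k)) = h x" for x
    proof -
      have "(SUP k. min (h x) (of_nat k)) = min (h x) (SUP k. of_nat k)"
        by (simp add: min_def inf_SUP flip: inf_min)
      then show ?thesis by (simp add: ennreal_SUP_of_nat_eq_top)
    qed
    have "(\<integral>\<^sup>+x. (SUP k. min (h x) (of_nat k)) \<partial>lborel) = (SUP k. \<integral>\<^sup>+x. min (h x) (of_nat k) \<partial>lborel)"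
      by (rule nn_integral_monotone_convergence_SUP)
        (auto simp: incseq_def le_fun_def simp del: min.bounded_iff intro!: min.mono)
    then show ?thesis by (simp add: *)
  qed
  assume "\<not> ?thesis"
  then have "(\<integral>\<^sup>+x. m x \<partial>lborel) < (SUP k. \<integral>\<^sup>+x. min (f x) (of_nat k) \<partial>lborel)"
      "(\<integral>\<^sup>+x. m x \<partial>lborel) < (SUP k. \<integral>\<^sup>+x. min (g x) (of_nat k) \<partial>lborel)"
    by (simp_all add: min_le_iff_disj not_le flip: SUP)
  then obtain i j where ij: "(\<integral>\<^sup>+x. m x \<partial>lborel) < (\<integral>\<^sup>+x. min (f x) (of_nat i) \<partial>lborel)"
      "(\<integral>\<^sup>+x. m x \<partial>lborel) < (\<integral>\<^sup>+x. min (g x) (of_nat j) \<partial>lborel)"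
    unfolding less_SUP_iff by blast
  have "min (\<integral>\<^sup>+x. min (f x) (of_nat i) \<partial>lborel) (\<integral>\<^sup>+x. min (g x) (of_nat j) \<partial>lborel) \<le> (\<integral>\<^sup>+x. m x \<partial>lborel)"
  proof (rule bbl_real_bounded[OF _ _ _ u p])
    have le: "min c (of_nat n) \<le> ennreal (real (max i j))" if "n \<le> max i j" for c n
      using that by (auto simp: min_le_iff_disj ennreal_of_nat_eq_real_of_nat intro!: disjI2 ennreal_leI)
    show "min (f x) (of_nat i) \<le> ennreal (real (max i j))" "min (g x) (of_nat j) \<le> ennreal (real (max i j))" for x
      by (auto intro!: le)
    fix x y a b :: real assume ab: "0 < a" "0 < b"
    have "min (ennreal (a ^ p) * min (f x) (of_nat i)) (ennreal (b ^ p) * min (g y) (of_nat j))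
      \<le> min (ennreal (a ^ p) * f x) (ennreal (b ^ p) * g y)"
      by (intro min.mono mult_left_mono) auto
    also note H[OF ab]
    finally show "min (ennreal (a ^ p) * min (f x) (of_nat i)) (ennreal (b ^ p) * min (g y) (of_nat j))
      \<le> ennreal (((1 - u) * a + u * b) ^ p) * m ((1 - u) * x + u * y)" .
  qed measurable
  with ij show False by (auto simp: min_le_iff_disj dest: leD)
qed

text \<open>The Borell--Brascamp--Lieb inequality with exponent \<open>-1/p\<close>, in a form free of roots and of
  divisions: \<open>m(z) \<ge> ((1 - u) f(x) powr (-1/p) + u g(y) powr (-1/p)) powr (-p)\<close> is equivalent to
  the bound below for all \<open>a, b > 0\<close>.\<close>

definition bbl :: "real \<Rightarrow> nat \<Rightarrow> ennreal \<Rightarrow> ennreal \<Rightarrow> ennreal \<Rightarrow> bool" where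
  "bbl u p F G M \<longleftrightarrow> (\<forall>a>0. \<forall>b>0.
     min (ennreal (a ^ p) * F) (ennreal (b ^ p) * G) \<le> ennreal (((1 - u) * a + u * b) ^ p) * M)"

text \<open>The bound by a minimum improves itself: it is applied to the dilated functions
  \<open>f (a * x)\<close>, \<open>g (b * y)\<close> and \<open>m (d * z)\<close>. Each dilation
  uses up one power of its factor in the change of variables, which is the drop from
  \<open>Suc p\<close> to \<open>p\<close>.\<close>

lemma bbl_integral_real:
  fixes f g m :: "real \<Rightarrow> ennreal" and u :: real and p :: nat
  assumes [measurable]: "f \<in> borel_measurable borel" "g \<in> borel_measurable borel" "m \<in> borel_measurable borel"
    and u: "0 < u" "u < 1"
    and H: "\<And>x y. bbl u (Suc p) (f x) (g y) (m ((1 - u) * x + u * y))"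
  shows "bbl u p (\<integral>\<^sup>+x. f x \<partial>lborel) (\<integral>\<^sup>+x. g x \<partial>lborel) (\<integral>\<^sup>+x. m x \<partial>lborel)"
  unfolding bbl_def
proof (intro allI impI)
  fix a b :: real assume ab: "0 < a" "0 < b"
  define d where "d = (1 - u) * a + u * b"
  have d: "d > 0" using ab u by (auto simp: d_def intro!: add_pos_pos)
  have scale: "ennreal (c ^ p) * (\<integral>\<^sup>+x. h x \<partial>lborel) = (\<integral>\<^sup>+x. ennreal (c ^ Suc p) * h (c * x) \<partial>lborel)"
    if c: "c > 0" and [measurable]: "h \<in> borel_measurable borel" for c and h :: "real \<Rightarrow> ennreal"
  proof -
    have "(\<integral>\<^sup>+x. h x \<partial>lborel) = ennreal c * (\<integral>\<^sup>+x. h (0 + c * x) \<partial>lborel)"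
      using c nn_integral_real_affine[of h c 0] by simp
    then show ?thesis
      using c by (simp add: nn_integral_cmult ennreal_mult ac_simps)
  qed
  \<comment> \<open>The weight \<open>v\<close> is determined by
    \<open>d * ((1 - v) * x + v * y) = (1 - u) * (a * x) + u * (b * y)\<close>: mixing with
    \<open>v\<close> in the dilated variables is mixing with \<open>u\<close> in the original
    ones.\<close>
  define v where "v = u * b / d"
  have v: "0 < v" "v < 1"
    using ab u d by (auto simp: v_def field_simps d_def)
  have v': "1 - v = (1 - u) * a / d"
    using d by (simp add: v_def field_simps) (simp add: d_def algebra_simps)
  have "min (\<integral>\<^sup>+x. ennreal (a ^ Suc p) * f (a * x) \<partial>lborel) (\<integral>\<^sup>+x. ennreal (b ^ Suc p) * g (b * x) \<partial>lborel)
    \<le> (\<integral>\<^sup>+x. ennreal (d ^ Suc p) * m (d * x) \<partial>lborel)"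
  proof (rule bbl_real[OF _ _ _ v, of _ _ _ "Suc p"])
    fix x y s t :: real assume st: "0 < s" "0 < t"
    have e1: "d * ((1 - v) * x + v * y) = (1 - u) * (a * x) + u * (b * y)"
      using d unfolding v' by (simp add: v_def field_simps)
    have e2: "d * ((1 - v) * s + v * t) = (1 - u) * (s * a) + u * (t * b)"
      using d unfolding v' by (simp add: v_def field_simps)
    have "min (ennreal ((s * a) ^ Suc p) * f (a * x)) (ennreal ((t * b) ^ Suc p) * g (b * y))
      \<le> ennreal ((d * ((1 - v) * s + v * t)) ^ Suc p) * m (d * ((1 - v) * x + v * y))"
      using H[of "a * x" "b * y"] st ab unfolding bbl_def e1 e2 by (metis mult_pos_pos)
    then show "min (ennreal (s ^ Suc p) * (ennreal (a ^ Suc p) * f (a * x))) (ennreal (t ^ Suc p) * (ennreal (b ^ Suc p) * g (b * y)))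
      \<le> ennreal (((1 - v) * s + v * t) ^ Suc p) * (ennreal (d ^ Suc p) * m (d * ((1 - v) * x + v * y)))"
      using st ab d v by (simp only: power_mult_distrib ennreal_mult zero_le_power less_imp_le mult.assoc mult_nonneg_nonneg
          add_nonneg_nonneg diff_ge_0_iff_ge mult.left_commute[of "ennreal (d ^ Suc p)"])
  qed auto
  then show "min (ennreal (a ^ p) * (\<integral>\<^sup>+x. f x \<partial>lborel)) (ennreal (b ^ p) * (\<integral>\<^sup>+x. g x \<partial>lborel))
    \<le> ennreal (((1 - u) * a + u * b) ^ p) * (\<integral>\<^sup>+x. m x \<partial>lborel)"
    using ab d by (simp only: scale assms(1-3) flip: d_def)
qed

section \<open>The Borell--Brascamp--Lieb inequality in several variables\<close>

interpretation lborelP: product_sigma_finite "\<lambda>_. lborel :: 'a::euclidean_space measure"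
  by standard

text \<open>Induction on the coordinates: integrating out one of them preserves the form of the
  hypothesis and lowers the exponent by one.\<close>

lemma bbl_integral_PiM:
  fixes f g m :: "('i \<Rightarrow> real) \<Rightarrow> ennreal" and u :: real and p :: nat
  assumes "finite I"
    and "f \<in> borel_measurable (Pi\<^sub>M I (\<lambda>_. lborel))" "g \<in> borel_measurable (Pi\<^sub>M I (\<lambda>_. lborel))"
      "m \<in> borel_measurable (Pi\<^sub>M I (\<lambda>_. lborel))"
    and u: "0 < u" "u < 1"
    and "\<And>x y. x \<in> extensional I \<Longrightarrow> y \<in> extensional I \<Longrightarrow> bbl u (p + card I) (f x) (g y) (m (\<lambda>i. (1 - u) * x i + u * y i))"
  shows "bbl u p (\<integral>\<^sup>+x. f x \<partial>Pi\<^sub>M I (\<lambda>_. lborel)) (\<integral>\<^sup>+x. g x \<partial>Pi\<^sub>M I (\<lambda>_. lborel)) (\<integral>\<^sup>+x. m x \<partial>Pi\<^sub>M I (\<lambda>_. lborel))"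
  using assms(1-4,7)
proof (induction I arbitrary: f g m p rule: finite_induct)
  case empty
  \<comment> \<open>Points of the product take the value \<open>undefined\<close> outside the index
    set, and a convex combination of \<open>undefined\<close> with itself is
    \<open>undefined\<close> again; so combinations remain points of the product.\<close>
  have "(\<lambda>i. (1 - u) * undefined + u * undefined) = (\<lambda>_::'i. undefined :: real)"
    by (simp add: fun_eq_iff algebra_simps)
  then show ?case
    using empty(4)[of "\<lambda>_. undefined" "\<lambda>_. undefined"] by (simp add: lborelP.nn_integral_empty)
next
  case (insert i I)
  note [measurable] = insert.prems(1-3)
  show ?case
    unfolding lborelP.product_nn_integral_insert[OF insert.hyps(1,2) insert.prems(1)]
      lborelP.product_nn_integral_insert[OF insert.hyps(1,2) insert.prems(2)]
      lborelP.product_nn_integral_insert[OF insert.hyps(1,2) insert.prems(3)]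
  proof (rule insert.IH)
    fix x y :: "'i \<Rightarrow> real" assume xy: "x \<in> extensional I" "y \<in> extensional I"
    let ?z = "\<lambda>i. (1 - u) * x i + u * y i"
    have z: "?z \<in> extensional I"
      using xy by (auto simp: extensional_def algebra_simps)
    have [measurable]: "(\<lambda>t. w(i := t)) \<in> lborel \<rightarrow>\<^sub>M Pi\<^sub>M (insert i I) (\<lambda>_. lborel)"
      if "w \<in> extensional I" for w :: "'i \<Rightarrow> real"
      using that insert.hyps(2) by (intro measurable_component_update) (auto simp: space_PiM PiE_def)
    note [measurable] = this[OF xy(1)] this[OF xy(2)] this[OF z]
    show "bbl u (p + card I) (\<integral>\<^sup>+ t. f (x(i := t)) \<partial>lborel) (\<integral>\<^sup>+ t. g (y(i := t)) \<partial>lborel)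
        (\<integral>\<^sup>+ t. m (?z(i := t)) \<partial>lborel)"
    proof (rule bbl_integral_real[OF _ _ _ u])
      show "bbl u (Suc (p + card I)) (f (x(i := s))) (g (y(i := t)))
          (m (?z(i := (1 - u) * s + u * t)))" for s t
      proof -
        have "?z(i := (1 - u) * s + u * t) = (\<lambda>j. (1 - u) * (x(i := s)) j + u * (y(i := t)) j)"
          by auto
        then show ?thesis
          using insert.prems(4)[of "x(i := s)" "y(i := t)"] insert.hyps xy
          by (simp add: extensional_def del: fun_upd_apply) (simp add: fun_upd_def)
      qed
    qed measurable
  qed measurable
qed

subsection \<open>Integrals over half-spaces\<close>

lemma nn_integral_gamma_scaled:
  fixes H :: real
  assumes H: "H > 0"
  shows "(\<integral>\<^sup>+v. indicator {0<..} v * ennreal (v ^ k * exp (- (v * H))) \<partial>lborel) = ennreal (fact k / H ^ Suc k)"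
proof -
  have "ennreal (fact k) = (\<integral>\<^sup>+x. ennreal (x^k * exp (-x)) * indicator {0 ..} x \<partial>lborel)"
    by (simp add: nn_intergal_power_times_exp_Ici)
  also have "\<dots> = (\<integral>\<^sup>+x. ennreal (x^k * exp (-x)) * indicator {0 <..} x \<partial>lborel)"
  proof (rule nn_integral_cong_AE)
    have "AE x in lborel. x \<noteq> (0::real)" by (rule AE_lborel_singleton)
    then show "AE x in lborel. ennreal (x^k * exp (-x)) * indicator {0 ..} x = ennreal (x^k * exp (-x)) * indicator {0 <..} x"
      by eventually_elim (auto split: split_indicator)
  qed
  also have "\<dots> = ennreal H * (\<integral>\<^sup>+x. ennreal ((0 + H * x)^k * exp (-(0 + H * x))) * indicator {0 <..} (0 + H * x) \<partial>lborel)"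
    using H nn_integral_real_affine[of "\<lambda>x. ennreal (x^k * exp (-x)) * indicator {0 <..} x" H 0] by simp
  also have "\<dots> = ennreal H * (\<integral>\<^sup>+x. ennreal (H ^ k) * (indicator {0<..} x * ennreal (x ^ k * exp (- (x * H)))) \<partial>lborel)"
  proof (rule arg_cong2[of _ _ _ _ "(*)", OF refl], rule nn_integral_cong)
    fix x :: real
    show "ennreal ((0 + H * x)^k * exp (-(0 + H * x))) * indicator {0 <..} (0 + H * x)
      = ennreal (H ^ k) * (indicator {0<..} x * ennreal (x ^ k * exp (- (x * H))))"
      using H by (cases "x > 0")
        (simp_all add: power_mult_distrib zero_less_mult_iff mult.assoc mult.commute[of H x] flip: ennreal_mult')
  qed
  also have "\<dots> = ennreal (H ^ Suc k) * (\<integral>\<^sup>+v. indicator {0<..} v * ennreal (v ^ k * exp (- (v * H))) \<partial>lborel)"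
    using H by (subst nn_integral_cmult) (auto simp: ennreal_mult mult.assoc)
  finally have *: "ennreal (H ^ Suc k) * (\<integral>\<^sup>+v. indicator {0<..} v * ennreal (v ^ k * exp (- (v * H))) \<partial>lborel) = ennreal (fact k)" ..
  have "ennreal (fact k / H ^ Suc k) = ennreal (1 / H ^ Suc k) * ennreal (fact k)"
    using H by (simp flip: ennreal_mult')
  also have "\<dots> = ennreal (1 / H ^ Suc k * H ^ Suc k) * (\<integral>\<^sup>+v. indicator {0<..} v * ennreal (v ^ k * exp (- (v * H))) \<partial>lborel)"
    unfolding *[symmetric] using H by (simp only: ennreal_mult zero_le_power zero_le_divide_1_iff less_imp_le mult.assoc)
  finally show ?thesis using H by simp
qed

lemma nn_integral_PiM_scale:
  fixes f :: "('i \<Rightarrow> real) \<Rightarrow> ennreal" and c :: real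
  assumes "finite I" and "f \<in> borel_measurable (Pi\<^sub>M I (\<lambda>_. lborel))" and c: "c > 0"
  shows "(\<integral>\<^sup>+x. f x \<partial>Pi\<^sub>M I (\<lambda>_. lborel)) =
    ennreal (c ^ card I) * (\<integral>\<^sup>+x. f (\<lambda>i\<in>I. c * x i) \<partial>Pi\<^sub>M I (\<lambda>_. lborel))"
  using assms(1,2)
proof (induction I arbitrary: f rule: finite_induct)
  case empty
  have "(\<lambda>i\<in>{}. c * x i) = (\<lambda>_. undefined)" for x :: "'i \<Rightarrow> real"
    by (simp add: fun_eq_iff)
  then show ?case by (simp add: lborelP.nn_integral_empty space_PiM_empty)
next
  case (insert i I)
  note [measurable] = insert.prems
  have [measurable]: "(\<lambda>t. w(i := t)) \<in> lborel \<rightarrow>\<^sub>M Pi\<^sub>M (insert i I) (\<lambda>_. lborel)"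
    if "w \<in> extensional I" for w :: "'i \<Rightarrow> real"
    using that insert.hyps(2) by (intro measurable_component_update) (auto simp: space_PiM PiE_def)
  have upd: "(\<lambda>j\<in>I. c * x j)(i := c * t) = (\<lambda>j\<in>insert i I. c * (x(i := t)) j)" for x t
    using insert.hyps(2) by (auto simp: fun_eq_iff)
  have "(\<integral>\<^sup>+x. f x \<partial>Pi\<^sub>M (insert i I) (\<lambda>_. lborel)) =
      (\<integral>\<^sup>+x. (\<integral>\<^sup>+t. f (x(i := t)) \<partial>lborel) \<partial>Pi\<^sub>M I (\<lambda>_. lborel))"
    by (rule lborelP.product_nn_integral_insert[OF insert.hyps insert.prems])
  also have "\<dots> = ennreal (c ^ card I) *
      (\<integral>\<^sup>+x. (\<integral>\<^sup>+t. f ((\<lambda>j\<in>I. c * x j)(i := t)) \<partial>lborel) \<partial>Pi\<^sub>M I (\<lambda>_. lborel))"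
    by (rule insert.IH) measurable
  also have "(\<integral>\<^sup>+x. (\<integral>\<^sup>+t. f ((\<lambda>j\<in>I. c * x j)(i := t)) \<partial>lborel) \<partial>Pi\<^sub>M I (\<lambda>_. lborel)) =
      (\<integral>\<^sup>+x. ennreal c * (\<integral>\<^sup>+t. f (\<lambda>j\<in>insert i I. c * (x(i := t)) j) \<partial>lborel) \<partial>Pi\<^sub>M I (\<lambda>_. lborel))"
  proof (rule nn_integral_cong)
    fix x
    have "(\<lambda>t. f ((\<lambda>j\<in>I. c * x j)(i := t))) \<in> borel_measurable borel" by measurable (simp_all add: space_PiM PiE_def extensional_def)
    from nn_integral_real_affine[OF this, of c 0] c
    show "(\<integral>\<^sup>+t. f ((\<lambda>j\<in>I. c * x j)(i := t)) \<partial>lborel)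
      = ennreal c * (\<integral>\<^sup>+t. f (\<lambda>j\<in>insert i I. c * (x(i := t)) j) \<partial>lborel)"
      by (simp add: upd[symmetric] del: fun_upd_apply)
  qed
  also have "\<dots> = ennreal c * (\<integral>\<^sup>+x. (\<integral>\<^sup>+t. f (\<lambda>j\<in>insert i I. c * (x(i := t)) j) \<partial>lborel) \<partial>Pi\<^sub>M I (\<lambda>_. lborel))"
    by (rule nn_integral_cmult) measurable
  also have "(\<integral>\<^sup>+x. (\<integral>\<^sup>+t. f (\<lambda>j\<in>insert i I. c * (x(i := t)) j) \<partial>lborel) \<partial>Pi\<^sub>M I (\<lambda>_. lborel)) =
      (\<integral>\<^sup>+x. f (\<lambda>j\<in>insert i I. c * x j) \<partial>Pi\<^sub>M (insert i I) (\<lambda>_. lborel))"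
    by (rule lborelP.product_nn_integral_insert[OF insert.hyps, symmetric]) measurable
  moreover have "ennreal (c ^ card (insert i I)) = ennreal c * ennreal (c ^ card I)"
    using insert.hyps c by (simp add: ennreal_mult)
  ultimately show ?case by (simp only: mult.assoc mult.left_commute)
qed

text \<open>Vectors of the half-space are written as \<open>v *\<^sub>R (b + y)\<close> with height
  \<open>v > 0\<close> and \<open>y\<close> orthogonal to \<open>b\<close>. The Jacobian is
  \<open>v ^ (n - 1)\<close>, homogeneity turns \<open>G\<close> into \<open>v * G (b + y)\<close>,
  and the integral over \<open>v\<close> is a Gamma integral with value
  \<open>(n - 1)! / G (b + y) ^ n\<close>.\<close>

lemma nn_integral_halfspace_Basis:
  fixes G :: "'a::euclidean_space \<Rightarrow> real"
  assumes b: "b \<in> Basis" and [measurable]: "G \<in> borel_measurable borel"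
    and hom: "\<And>c w. c > 0 \<Longrightarrow> G (c *\<^sub>R w) = c * G w"
    and pos: "\<And>w. w \<bullet> b > 0 \<Longrightarrow> G w > 0"
  shows "(\<integral>\<^sup>+w. indicator {w. w \<bullet> b > 0} w * ennreal (exp (- G w)) \<partial>lborel) =
    (\<integral>\<^sup>+x. ennreal (fact (DIM('a) - 1) / G (b + (\<Sum>j\<in>Basis - {b}. x j *\<^sub>R j)) ^ DIM('a))
        \<partial>Pi\<^sub>M (Basis - {b}) (\<lambda>_. lborel))"
proof -
  let ?B = "Basis - {b}" and ?n = "DIM('a)"
  let ?P = "Pi\<^sub>M ?B (\<lambda>_. lborel :: real measure)"
  have fin: "finite ?B" by simp
  have card: "card ?B = ?n - 1" using b by simp
  have Suc: "Suc (?n - 1) = ?n" by simp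
  have ins: "insert b ?B = Basis" using b by auto
  interpret pair_sigma_finite ?P "lborel :: real measure"
    by (intro pair_sigma_finite.intro lborelP.sigma_finite fin sigma_finite_lborel)
  have inner: "(v *\<^sub>R b + (\<Sum>j\<in>?B. x j *\<^sub>R j)) \<bullet> b = v" for v and x :: "'a \<Rightarrow> real"
    using b by (auto simp: inner_simps inner_sum_left inner_Basis intro!: sum.neutral)
  have "(\<integral>\<^sup>+w. indicator {w. w \<bullet> b > 0} w * ennreal (exp (- G w)) \<partial>lborel)
    = (\<integral>\<^sup>+x. indicator {w. w \<bullet> b > 0} (\<Sum>j\<in>Basis. x j *\<^sub>R j) * ennreal (exp (- G (\<Sum>j\<in>Basis. x j *\<^sub>R j)))
        \<partial>Pi\<^sub>M Basis (\<lambda>_. lborel))"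
    unfolding lborel_eq[where 'a='a] by (subst nn_integral_distr) auto
  also have "\<dots> = (\<integral>\<^sup>+x. indicator {w. w \<bullet> b > 0} (\<Sum>j\<in>Basis. x j *\<^sub>R j) * ennreal (exp (- G (\<Sum>j\<in>Basis. x j *\<^sub>R j)))
        \<partial>Pi\<^sub>M (insert b ?B) (\<lambda>_. lborel))"
    unfolding ins ..
  also have "\<dots> = (\<integral>\<^sup>+v. (\<integral>\<^sup>+x. indicator {w. w \<bullet> b > 0} (\<Sum>j\<in>Basis. (x(b := v)) j *\<^sub>R j)
      * ennreal (exp (- G (\<Sum>j\<in>Basis. (x(b := v)) j *\<^sub>R j))) \<partial>?P) \<partial>lborel)"
    by (rule lborelP.product_nn_integral_insert_rev) (simp_all add: ins)
  also have "\<dots> = (\<integral>\<^sup>+v. (\<integral>\<^sup>+x. indicator {0<..} v *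
      ennreal (exp (- G (v *\<^sub>R b + (\<Sum>j\<in>?B. x j *\<^sub>R j)))) \<partial>?P) \<partial>lborel)"
  proof (intro nn_integral_cong)
    fix v :: real and x :: "'a \<Rightarrow> real"
    have "(\<Sum>j\<in>Basis. (x(b := v)) j *\<^sub>R j) = v *\<^sub>R b + (\<Sum>j\<in>?B. x j *\<^sub>R j)"
      using b by (subst sum.remove[of _ b]) (auto intro!: sum.cong)
    then show "indicator {w. w \<bullet> b > 0} (\<Sum>j\<in>Basis. (x(b := v)) j *\<^sub>R j)
      * ennreal (exp (- G (\<Sum>j\<in>Basis. (x(b := v)) j *\<^sub>R j))) = indicator {0<..} v *
      ennreal (exp (- G (v *\<^sub>R b + (\<Sum>j\<in>?B. x j *\<^sub>R j))))"
      by (simp add: indicator_def inner del: fun_upd_apply)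
  qed
  also have "\<dots> = (\<integral>\<^sup>+v. (\<integral>\<^sup>+x. indicator {0<..} v *
      ennreal (v ^ (?n - 1) * exp (- (v * G (b + (\<Sum>j\<in>?B. x j *\<^sub>R j))))) \<partial>?P) \<partial>lborel)"
  proof (rule nn_integral_cong)
    fix v :: real
    show "(\<integral>\<^sup>+x. indicator {0<..} v * ennreal (exp (- G (v *\<^sub>R b + (\<Sum>j\<in>?B. x j *\<^sub>R j)))) \<partial>?P)
      = (\<integral>\<^sup>+x. indicator {0<..} v * ennreal (v ^ (?n - 1) * exp (- (v * G (b + (\<Sum>j\<in>?B. x j *\<^sub>R j))))) \<partial>?P)"
    proof (cases "v > 0")
      case True
      have eq: "G (v *\<^sub>R b + (\<Sum>j\<in>?B. (\<lambda>j\<in>?B. v * x j) j *\<^sub>R j)) = v * G (b + (\<Sum>j\<in>?B. x j *\<^sub>R j))" for x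
        using hom[OF True, of "b + (\<Sum>j\<in>?B. x j *\<^sub>R j)"] by (simp add: scaleR_sum_right scaleR_add_right)
      have "(\<integral>\<^sup>+x. ennreal (exp (- G (v *\<^sub>R b + (\<Sum>j\<in>?B. x j *\<^sub>R j)))) \<partial>?P)
        = ennreal (v ^ (?n - 1)) * (\<integral>\<^sup>+x. ennreal (exp (- G (v *\<^sub>R b + (\<Sum>j\<in>?B. (\<lambda>j\<in>?B. v * x j) j *\<^sub>R j)))) \<partial>?P)"
        unfolding card[symmetric] by (rule nn_integral_PiM_scale) (use True in auto)
      also have "\<dots> = (\<integral>\<^sup>+x. ennreal (v ^ (?n - 1) * exp (- (v * G (b + (\<Sum>j\<in>?B. x j *\<^sub>R j))))) \<partial>?P)"
        unfolding eq using True by (simp add: nn_integral_cmult ennreal_mult)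
      finally show ?thesis using True by simp
    qed simp
  qed
  also have "\<dots> = (\<integral>\<^sup>+x. (\<integral>\<^sup>+v. indicator {0<..} v *
      ennreal (v ^ (?n - 1) * exp (- (v * G (b + (\<Sum>j\<in>?B. x j *\<^sub>R j))))) \<partial>lborel) \<partial>?P)"
    by (rule Fubini') (simp add: indicator_def)
  also have "\<dots> = (\<integral>\<^sup>+x. ennreal (fact (?n - 1) / G (b + (\<Sum>j\<in>?B. x j *\<^sub>R j)) ^ ?n) \<partial>?P)"
  proof (rule nn_integral_cong)
    fix x :: "'a \<Rightarrow> real"
    have "G (b + (\<Sum>j\<in>?B. x j *\<^sub>R j)) > 0" using inner[of 1 x] by (intro pos) simp
    from nn_integral_gamma_scaled[OF this, of "?n - 1"]
    show "(\<integral>\<^sup>+v. indicator {0<..} v * ennreal (v ^ (?n - 1) * exp (- (v * G (b + (\<Sum>j\<in>?B. x j *\<^sub>R j))))) \<partial>lborel)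
      = ennreal (fact (?n - 1) / G (b + (\<Sum>j\<in>?B. x j *\<^sub>R j)) ^ ?n)"
      unfolding Suc .
  qed
  finally show ?thesis .
qed

text \<open>The number \<open>q\<close> is the largest factor with \<open>q * G0 \<le> a\<close> and
  \<open>q * G1 \<le> b\<close>; then the bound on \<open>G\<close> gives
  \<open>q * G \<le> (1 - u) * a + u * b\<close>. The minimum on the left of \<open>bbl\<close> is
  exactly \<open>k * q ^ n\<close>.\<close>

lemma bbl_inverse_power:
  assumes "0 < G0" "0 < G1" "0 < G" "0 < u" "u < 1" "G \<le> (1 - u) * G0 + u * G1" "0 \<le> k"
  shows "bbl u n (ennreal (k / G0 ^ n)) (ennreal (k / G1 ^ n)) (ennreal (k / G ^ n))"
  unfolding bbl_def
proof (intro allI impI)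
  fix a b :: real assume ab: "0 < a" "0 < b"
  define q where "q = min (a / G0) (b / G1)"
  have q: "q > 0" using assms ab by (simp add: q_def)
  have "q * G0 \<le> a" "q * G1 \<le> b"
    using assms by (simp_all add: q_def min_le_iff_disj flip: pos_le_divide_eq)
  then have "(1 - u) * (q * G0) + u * (q * G1) \<le> (1 - u) * a + u * b"
    using assms by (intro add_mono mult_left_mono) auto
  moreover have "q * G \<le> q * ((1 - u) * G0 + u * G1)" using q assms by (intro mult_left_mono) auto
  ultimately have "q \<le> ((1 - u) * a + u * b) / G"
    using assms by (simp add: pos_le_divide_eq algebra_simps)
  then have "k * q ^ n \<le> k * (((1 - u) * a + u * b) / G) ^ n"
    using q assms by (intro mult_left_mono power_mono) auto
  moreover have "k * q ^ n = min (a ^ n * (k / G0 ^ n)) (b ^ n * (k / G1 ^ n))"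
  proof -
    have "min (a ^ n * (k / G0 ^ n)) (b ^ n * (k / G1 ^ n)) = min (k * (a / G0) ^ n) (k * (b / G1) ^ n)"
      by (simp add: power_divide mult.commute)
    also have "\<dots> = k * q ^ n"
    proof (cases "a / G0 \<le> b / G1")
      case True
      then have "k * (a / G0) ^ n \<le> k * (b / G1) ^ n" using assms ab by (intro mult_left_mono power_mono) auto
      with True show ?thesis by (simp add: q_def)
    next
      case False
      then have "k * (b / G1) ^ n \<le> k * (a / G0) ^ n" using assms ab by (intro mult_left_mono power_mono) auto
      with False show ?thesis by (simp add: q_def min_absorb2)
    qed
    finally show ?thesis by simp
  qed
  ultimately have "min (a ^ n * (k / G0 ^ n)) (b ^ n * (k / G1 ^ n)) \<le> ((1 - u) * a + u * b) ^ n * (k / G ^ n)"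
    by (simp add: power_divide mult.commute)
  then have "ennreal (min (a ^ n * (k / G0 ^ n)) (b ^ n * (k / G1 ^ n))) \<le> ennreal (((1 - u) * a + u * b) ^ n * (k / G ^ n))"
    by (rule ennreal_leI)
  then show "min (ennreal (a ^ n) * ennreal (k / G0 ^ n)) (ennreal (b ^ n) * ennreal (k / G1 ^ n))
    \<le> ennreal (((1 - u) * a + u * b) ^ n) * ennreal (k / G ^ n)"
    using assms ab by (simp add: min_def ennreal_mult'' ennreal_le_iff split: if_splits flip: ennreal_mult)
qed

text \<open>On the slice at height 1 the integrand is a constant times the power \<open>-n\<close>
  of \<open>G\<close>, and the slice has \<open>n - 1\<close> coordinates:
  \<open>1 + card (Basis - {b}) = n\<close> leaves the exponent 1. Convexity is asked for on this
  slice alone, the form in which support functions of a shadow system provide it.\<close>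

lemma bbl_halfspace_Basis:
  fixes G0 G1 G :: "'a::euclidean_space \<Rightarrow> real"
  assumes b: "b \<in> Basis" and u: "0 < u" "u < 1"
    and [measurable]: "G0 \<in> borel_measurable borel" "G1 \<in> borel_measurable borel" "G \<in> borel_measurable borel"
    and hom: "\<And>c w. c > 0 \<Longrightarrow> G0 (c *\<^sub>R w) = c * G0 w" "\<And>c w. c > 0 \<Longrightarrow> G1 (c *\<^sub>R w) = c * G1 w"
      "\<And>c w. c > 0 \<Longrightarrow> G (c *\<^sub>R w) = c * G w"
    and pos: "\<And>w. w \<bullet> b > 0 \<Longrightarrow> G0 w > 0" "\<And>w. w \<bullet> b > 0 \<Longrightarrow> G1 w > 0" "\<And>w. w \<bullet> b > 0 \<Longrightarrow> G w > 0"
    and conv: "\<And>w w'. w \<bullet> b = 1 \<Longrightarrow> w' \<bullet> b = 1 \<Longrightarrow> G ((1 - u) *\<^sub>R w + u *\<^sub>R w') \<le> (1 - u) * G0 w + u * G1 w'"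
  defines "A \<equiv> \<lambda>G :: 'a \<Rightarrow> real. \<integral>\<^sup>+w. indicator {w. w \<bullet> b > 0} w * ennreal (exp (- G w)) \<partial>lborel"
  shows "bbl u 1 (A G0) (A G1) (A G)"
proof -
  let ?B = "Basis - {b}"
  have card: "1 + card ?B = DIM('a)" using b by simp
  have inner: "(b + (\<Sum>j\<in>?B. x j *\<^sub>R j)) \<bullet> b = 1" for x :: "'a \<Rightarrow> real"
    using b by (auto simp: inner_simps inner_sum_left inner_Basis intro!: sum.neutral)
  have comb: "b + (\<Sum>j\<in>?B. ((1 - u) * x j + u * y j) *\<^sub>R j) =
      (1 - u) *\<^sub>R (b + (\<Sum>j\<in>?B. x j *\<^sub>R j)) + u *\<^sub>R (b + (\<Sum>j\<in>?B. y j *\<^sub>R j))" for x y :: "'a \<Rightarrow> real"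
    by (simp add: scaleR_add_left scaleR_add_right sum.distrib scaleR_sum_right scaleR_diff_left)
  define J where "J F x = ennreal (fact (DIM('a) - 1) / F (b + (\<Sum>j\<in>?B. x j *\<^sub>R j)) ^ DIM('a))"
    for F :: "'a \<Rightarrow> real" and x
  have J: "J F \<in> borel_measurable (Pi\<^sub>M ?B (\<lambda>_. lborel))" if [measurable]: "F \<in> borel_measurable borel" for F
    unfolding J_def by measurable
  have A: "A F = (\<integral>\<^sup>+x. J F x \<partial>Pi\<^sub>M ?B (\<lambda>_. lborel))"
    if "F \<in> borel_measurable borel" "\<And>c w. c > 0 \<Longrightarrow> F (c *\<^sub>R w) = c * F w" "\<And>w. w \<bullet> b > 0 \<Longrightarrow> F w > 0" for F
    unfolding A_def J_def by (rule nn_integral_halfspace_Basis[OF b that])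
  have bbl: "bbl u (1 + card ?B) (J G0 x) (J G1 y) (J G (\<lambda>i. (1 - u) * x i + u * y i))" for x y
    unfolding card J_def comb using u
    by (intro bbl_inverse_power pos conv)
      (simp_all add: inner inner_add_left[of "(1 - u) *\<^sub>R _"])
  have "A G0 = (\<integral>\<^sup>+x. J G0 x \<partial>Pi\<^sub>M ?B (\<lambda>_. lborel))" "A G1 = (\<integral>\<^sup>+x. J G1 x \<partial>Pi\<^sub>M ?B (\<lambda>_. lborel))"
      "A G = (\<integral>\<^sup>+x. J G x \<partial>Pi\<^sub>M ?B (\<lambda>_. lborel))"
    by (auto intro!: A hom pos)
  then show ?thesis
    by (simp only:, intro bbl_integral_PiM) (rule bbl J u assms(4-6) finite_Diff finite_Basis)+
qed


section \<open>From coordinate directions to arbitrary directions\<close>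

lemma nn_integral_lborel_translate:
  fixes f :: "'a::euclidean_space \<Rightarrow> ennreal"
  assumes [measurable]: "f \<in> borel_measurable borel"
  shows "(\<integral>\<^sup>+x. f (c + x) \<partial>lborel) = (\<integral>\<^sup>+x. f x \<partial>lborel)"
  by (subst (2) lborel_distr_plus[of c, symmetric]) (simp add: nn_integral_distr)

text \<open>A further translation by \<open>s *\<^sub>R e\<close>, averaged over \<open>s \<in> [0,1]\<close>, turns the shear into a
  translation of the interval of averaging; no coordinates adapted to \<open>e\<close> are needed.\<close>

lemma nn_integral_shear:
  fixes f :: "'a::euclidean_space \<Rightarrow> ennreal" and \<phi> :: "'a \<Rightarrow> real"
  assumes [measurable]: "f \<in> borel_measurable borel" "\<phi> \<in> borel_measurable borel"
    and inv: "\<And>x s. \<phi> (x + s *\<^sub>R e) = \<phi> x"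
  shows "(\<integral>\<^sup>+x. f (x + \<phi> x *\<^sub>R e) \<partial>lborel) = (\<integral>\<^sup>+x. f x \<partial>lborel)"
proof -
  let ?i = "indicator {0..1} :: real \<Rightarrow> ennreal"
  have inv': "\<phi> (s *\<^sub>R e + x) = \<phi> x" for x s using inv[of x s] by (simp add: add.commute)
  have avg: "(\<integral>\<^sup>+x. h x \<partial>lborel) = (\<integral>\<^sup>+s. ?i s * (\<integral>\<^sup>+x. h x \<partial>lborel) \<partial>lborel)"
    for h :: "'a \<Rightarrow> ennreal"
    by (subst nn_integral_multc) auto
  have "(\<integral>\<^sup>+x. f (x + \<phi> x *\<^sub>R e) \<partial>lborel) =
      (\<integral>\<^sup>+s. ?i s * (\<integral>\<^sup>+x. f (s *\<^sub>R e + x + \<phi> (s *\<^sub>R e + x) *\<^sub>R e) \<partial>lborel) \<partial>lborel)"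
    by (subst nn_integral_lborel_translate[of "\<lambda>x. f (x + \<phi> x *\<^sub>R e)"]) (auto simp: nn_integral_multc)
  also have "\<dots> = (\<integral>\<^sup>+s. (\<integral>\<^sup>+x. ?i s * f (x + (s + \<phi> x) *\<^sub>R e) \<partial>lborel) \<partial>lborel)"
    by (simp only: inv') (simp add: nn_integral_cmult algebra_simps)
  also have "\<dots> = (\<integral>\<^sup>+x. (\<integral>\<^sup>+s. ?i s * f (x + (s + \<phi> x) *\<^sub>R e) \<partial>lborel) \<partial>lborel)"
    by (rule lborel_pair.Fubini') measurable
  also have "\<dots> = (\<integral>\<^sup>+x. (\<integral>\<^sup>+s. ?i (s - \<phi> x) * f (x + s *\<^sub>R e) \<partial>lborel) \<partial>lborel)"
  proof (rule nn_integral_cong)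
    fix x
    show "(\<integral>\<^sup>+s. ?i s * f (x + (s + \<phi> x) *\<^sub>R e) \<partial>lborel) = (\<integral>\<^sup>+s. ?i (s - \<phi> x) * f (x + s *\<^sub>R e) \<partial>lborel)"
      by (subst nn_integral_lborel_translate[of "\<lambda>s. ?i (s - \<phi> x) * f (x + s *\<^sub>R e)" "\<phi> x", symmetric])
        (simp_all add: add.commute)
  qed
  \<comment> \<open>The order is exchanged because for fixed \<open>s\<close> the factor
    \<open>?i (s - \<phi> x)\<close> does not change when \<open>x\<close> moves along
    \<open>e\<close>; the inner integral is then translation invariant.\<close>
  also have "\<dots> = (\<integral>\<^sup>+s. (\<integral>\<^sup>+x. ?i (s - \<phi> x) * f (x + s *\<^sub>R e) \<partial>lborel) \<partial>lborel)"
    by (rule lborel_pair.Fubini'[symmetric]) measurable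
  also have "\<dots> = (\<integral>\<^sup>+s. (\<integral>\<^sup>+x. ?i (s - \<phi> x) * f x \<partial>lborel) \<partial>lborel)"
  proof (rule nn_integral_cong)
    fix s
    show "(\<integral>\<^sup>+x. ?i (s - \<phi> x) * f (x + s *\<^sub>R e) \<partial>lborel) = (\<integral>\<^sup>+x. ?i (s - \<phi> x) * f x \<partial>lborel)"
      by (subst nn_integral_lborel_translate[of "\<lambda>x. ?i (s - \<phi> x) * f x" "s *\<^sub>R e", symmetric])
        (simp_all add: inv inv' add.commute[of "s *\<^sub>R e"])
  qed
  also have "\<dots> = (\<integral>\<^sup>+x. (\<integral>\<^sup>+s. ?i (s - \<phi> x) * f x \<partial>lborel) \<partial>lborel)"
    by (rule lborel_pair.Fubini') measurable
  also have "\<dots> = (\<integral>\<^sup>+x. f x \<partial>lborel)"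
  proof (rule nn_integral_cong)
    fix x
    have "(\<integral>\<^sup>+s. ?i (s - \<phi> x) \<partial>lborel) = (\<integral>\<^sup>+s. ?i s \<partial>lborel)"
      using nn_integral_lborel_translate[of ?i "- \<phi> x"] by simp
    then show "(\<integral>\<^sup>+s. ?i (s - \<phi> x) * f x \<partial>lborel) = f x"
      by (simp add: nn_integral_multc)
  qed
  finally show ?thesis .
qed

lemma bbl_cmult: "bbl u p F G M \<Longrightarrow> bbl u p (c * F) (c * G) (c * M)"
  unfolding bbl_def min_le_iff_disj mult.left_commute[of _ c] by (meson mult_left_mono zero_le)

text \<open>A linear map \<open>T\<close> with \<open>T w \<bullet> \<theta> = w \<bullet> b\<close>
  carries the coordinate half-space to the one of \<open>\<theta>\<close> and preserves homogeneity
  and convexity on slices. Its constant Jacobian \<open>d\<close> multiplies all three integrals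
  alike.\<close>

lemma bbl_halfspace:
  fixes G0 G1 G :: "'a::euclidean_space \<Rightarrow> real"
  assumes \<theta>: "\<theta> \<noteq> 0" and u: "0 < u" "u < 1"
    and [measurable]: "G0 \<in> borel_measurable borel" "G1 \<in> borel_measurable borel" "G \<in> borel_measurable borel"
    and hom: "\<And>c w. c > 0 \<Longrightarrow> G0 (c *\<^sub>R w) = c * G0 w" "\<And>c w. c > 0 \<Longrightarrow> G1 (c *\<^sub>R w) = c * G1 w"
      "\<And>c w. c > 0 \<Longrightarrow> G (c *\<^sub>R w) = c * G w"
    and pos: "\<And>w. w \<bullet> \<theta> > 0 \<Longrightarrow> G0 w > 0" "\<And>w. w \<bullet> \<theta> > 0 \<Longrightarrow> G1 w > 0" "\<And>w. w \<bullet> \<theta> > 0 \<Longrightarrow> G w > 0"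
    and conv: "\<And>w w'. w \<bullet> \<theta> = 1 \<Longrightarrow> w' \<bullet> \<theta> = 1 \<Longrightarrow> G ((1 - u) *\<^sub>R w + u *\<^sub>R w') \<le> (1 - u) * G0 w + u * G1 w'"
  defines "A \<equiv> \<lambda>G. \<integral>\<^sup>+w. indicator {w. w \<bullet> \<theta> > 0} w * ennreal (exp (- G w)) \<partial>lborel"
  shows "bbl u 1 (A G0) (A G1) (A G)"
proof -
  obtain b where b: "b \<in> Basis" "\<theta> \<bullet> b \<noteq> 0" using \<theta> euclidean_all_zero_iff by blast
  define k where "k = \<theta> \<bullet> b"
  have k: "k \<noteq> 0" using b by (simp add: k_def)
  define D where "D x = x + ((1 / k - 1) * (x \<bullet> b)) *\<^sub>R b" for x
  \<comment> \<open>Since \<open>b \<bullet> \<theta> = k\<close>, the functional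
    \<open>\<phi>\<close> vanishes at \<open>b\<close>, so \<open>w + \<phi> w *\<^sub>R b\<close>
    is a shear and preserves volume. The diagonal map \<open>D\<close> divides the coordinate along
    \<open>b\<close> by \<open>k\<close> and carries the whole Jacobian.\<close>
  define \<phi> where "\<phi> w = k * (w \<bullet> b) - w \<bullet> \<theta>" for w
  define T where "T w = D (w + \<phi> w *\<^sub>R b)" for w
  have [measurable]: "D \<in> borel_measurable borel" "\<phi> \<in> borel_measurable borel"
    unfolding D_def[abs_def] \<phi>_def[abs_def] by measurable
  have [measurable]: "T \<in> borel_measurable borel"
    unfolding T_def[abs_def] by measurable
  have bb: "b \<bullet> b = 1" "b \<bullet> \<theta> = k" using b by (simp_all add: k_def inner_commute)
  have lin: "linear T"
    unfolding T_def D_def \<phi>_def by (intro linearI) (simp_all add: inner_simps algebra_simps)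
  have inner: "T w \<bullet> \<theta> = w \<bullet> b" for w
    unfolding T_def D_def \<phi>_def using k by (simp add: inner_simps bb field_simps)
  define c where "c j = (if j = b then 1 / k else 1)" for j
  have D: "D x = 0 + (\<Sum>j\<in>Basis. (c j * (x \<bullet> j)) *\<^sub>R j)" for x
  proof -
    have "(\<Sum>j\<in>Basis. (c j * (x \<bullet> j)) *\<^sub>R j) = (\<Sum>j\<in>Basis. (x \<bullet> j) *\<^sub>R j + (if j = b then ((1 / k - 1) * (x \<bullet> b)) *\<^sub>R b else 0))"
      by (intro sum.cong) (auto simp: c_def algebra_simps)
    also have "\<dots> = D x" using b by (simp add: sum.distrib D_def euclidean_representation)
    finally show ?thesis by simp
  qed
  define d where "d = (\<Prod>j\<in>Basis. \<bar>c j\<bar>)"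
  have A: "A F = ennreal d * (\<integral>\<^sup>+w. indicator {w. w \<bullet> b > 0} w * ennreal (exp (- F (T w))) \<partial>lborel)"
    if [measurable]: "F \<in> borel_measurable borel" for F
  proof -
    let ?f = "\<lambda>w. indicator {w. w \<bullet> \<theta> > 0} w * ennreal (exp (- F w))"
    have "A F = integral\<^sup>N (density (distr lborel borel D) (\<lambda>_. ennreal d)) ?f"
      unfolding A_def d_def D
      by (subst lborel_affine_euclidean[of c 0, symmetric]) (use k in \<open>auto simp: c_def\<close>)
    also have "\<dots> = ennreal d * (\<integral>\<^sup>+w. ?f (D w) \<partial>lborel)"
      by (simp add: nn_integral_density nn_integral_distr nn_integral_cmult)
    also have "(\<integral>\<^sup>+w. ?f (D w) \<partial>lborel) = (\<integral>\<^sup>+w. ?f (D (w + \<phi> w *\<^sub>R b)) \<partial>lborel)"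
      by (rule nn_integral_shear[symmetric]) (simp_all add: \<phi>_def inner_simps bb algebra_simps)
    finally show ?thesis unfolding T_def[symmetric] by (simp add: inner indicator_def)
  qed
  have "bbl u 1 (\<integral>\<^sup>+w. indicator {w. w \<bullet> b > 0} w * ennreal (exp (- G0 (T w))) \<partial>lborel)
      (\<integral>\<^sup>+w. indicator {w. w \<bullet> b > 0} w * ennreal (exp (- G1 (T w))) \<partial>lborel)
      (\<integral>\<^sup>+w. indicator {w. w \<bullet> b > 0} w * ennreal (exp (- G (T w))) \<partial>lborel)"
    by (rule bbl_halfspace_Basis[OF b(1) u])
      (use lin in \<open>simp_all add: hom pos inner conv linear_add linear_scale\<close>)
  then show ?thesis
    unfolding A[OF assms(4)] A[OF assms(5)] A[OF assms(6)] by (rule bbl_cmult)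
qed

subsection \<open>Exponential integrals of support functions\<close>

text \<open>The support function of the hull of \<open>range X\<close>, taken as a maximum over the
  finitely many points; measurability in \<open>w\<close> and in \<open>X\<close> can be read off
  from this form.\<close>

definition supp_fun :: "('m::finite \<Rightarrow> 'a::euclidean_space) \<Rightarrow> 'a \<Rightarrow> real" where
  "supp_fun X w = Max (range (\<lambda>i. w \<bullet> X i))"

lemma supp_fun_ge: "w \<bullet> X i \<le> supp_fun X w"
  by (simp add: supp_fun_def)

lemma supp_fun_le_iff: "supp_fun X w \<le> c \<longleftrightarrow> (\<forall>i. w \<bullet> X i \<le> c)"
  by (simp add: supp_fun_def)

lemma supp_fun_attained: "\<exists>i. supp_fun X w = w \<bullet> X i"
proof -
  have "supp_fun X w \<in> range (\<lambda>i. w \<bullet> X i)"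
    unfolding supp_fun_def by (rule Max_in) auto
  then show ?thesis by auto
qed

lemma supp_fun_scale:
  assumes "c > 0"
  shows "supp_fun X (c *\<^sub>R w) = c * supp_fun X w"
proof (rule antisym)
  show "supp_fun X (c *\<^sub>R w) \<le> c * supp_fun X w"
    using assms by (auto simp: supp_fun_le_iff supp_fun_ge)
  obtain i where i: "supp_fun X w = w \<bullet> X i" using supp_fun_attained by blast
  show "c * supp_fun X w \<le> supp_fun X (c *\<^sub>R w)"
    using supp_fun_ge[of "c *\<^sub>R w" X i] by (simp add: i)
qed

lemma supp_fun_add: "supp_fun X (w + w') \<le> supp_fun X w + supp_fun X w'"
  by (auto simp: supp_fun_le_iff inner_add_left intro!: add_mono supp_fun_ge)

lemma borel_measurable_supp_fun[measurable]: "supp_fun X \<in> borel_measurable borel"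
  unfolding supp_fun_def[abs_def] by measurable

lemma convex_hull_le_supp_fun_iff:
  "(\<forall>y\<in>convex hull range X. w \<bullet> y \<le> c) \<longleftrightarrow> supp_fun X w \<le> c"
proof
  assume "supp_fun X w \<le> c"
  then have "range X \<subseteq> {y. w \<bullet> y \<le> c}" by (auto simp: supp_fun_le_iff)
  then have "convex hull range X \<subseteq> {y. w \<bullet> y \<le> c}"
    by (intro hull_minimal convex_halfspace_le)
  then show "\<forall>y\<in>convex hull range X. w \<bullet> y \<le> c" by auto
qed (auto simp: supp_fun_le_iff intro: hull_inc)

lemma interior_supp_fun_bound:
  assumes "s \<in> interior (convex hull range X)"
  obtains e where "e > 0" "\<And>w. w \<bullet> s + e * norm w \<le> supp_fun X w"
proof -
  obtain e where e: "e > 0" "cball s e \<subseteq> convex hull range X"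
    using assms by (auto simp: mem_interior_cball)
  have "w \<bullet> s + e * norm w \<le> supp_fun X w" for w
  proof (cases "w = 0")
    case True
    then show ?thesis using supp_fun_ge[of 0 X] by simp
  next
    case False
    have "s + (e / norm w) *\<^sub>R w \<in> cball s e" using e by (simp add: dist_norm)
    then have "w \<bullet> (s + (e / norm w) *\<^sub>R w) \<le> supp_fun X w"
      using e(2) convex_hull_le_supp_fun_iff[of X w "supp_fun X w"] by blast
    then show ?thesis using False
      by (simp add: inner_add_right dot_square_norm power2_eq_square)
  qed
  with e(1) that show thesis by blast
qed

text \<open>A point outside the interior has a supporting direction: a normal of a hyperplane
  containing the hull if the interior is empty, otherwise a separating functional, whose inequality
  extends from the interior to the hull by density.\<close>

lemma interior_convex_hull_range_iff:
  "s \<in> interior (convex hull range X) \<longleftrightarrow> (\<forall>w. w \<noteq> 0 \<longrightarrow> w \<bullet> s < supp_fun X w)"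
proof
  assume "s \<in> interior (convex hull range X)"
  then obtain e where e: "e > 0" "\<And>w. w \<bullet> s + e * norm w \<le> supp_fun X w"
    by (rule interior_supp_fun_bound) blast
  show "\<forall>w. w \<noteq> 0 \<longrightarrow> w \<bullet> s < supp_fun X w"
  proof (intro allI impI)
    fix w :: 'a assume "w \<noteq> 0"
    then have "e * norm w > 0" using e by simp
    with e(2)[of w] show "w \<bullet> s < supp_fun X w" by simp
  qed
next
  let ?C = "convex hull range X"
  assume pos: "\<forall>w. w \<noteq> 0 \<longrightarrow> w \<bullet> s < supp_fun X w"
  show "s \<in> interior ?C"
  proof (rule ccontr)
    assume nin: "s \<notin> interior ?C"
    have "\<exists>w. w \<noteq> 0 \<and> (\<forall>y\<in>?C. w \<bullet> y \<le> w \<bullet> s)"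
    proof (cases "interior ?C = {}")
      case True
      then obtain a b where ab: "a \<noteq> 0" "?C \<subseteq> {x. a \<bullet> x = b}"
        using empty_interior_subset_hyperplane[of ?C] by auto
      \<comment> \<open>On the hyperplane both \<open>a\<close> and \<open>- a\<close> are constant;
        the sign is chosen such that \<open>s\<close> lies on the upper side.\<close>
      show ?thesis
        using ab by (intro exI[of _ "if b \<le> a \<bullet> s then a else - a"]) auto
    next
      case False
      obtain a b where ab: "a \<noteq> 0" "\<forall>x\<in>interior ?C. a \<bullet> x \<le> b" "\<forall>x\<in>{s}. a \<bullet> x \<ge> b"
        using separating_hyperplane_sets[of "interior ?C" "{s}"] nin False
        by (auto simp: convex_interior)
      then have "interior ?C \<subseteq> {x. a \<bullet> x \<le> b}" by auto
      then have "closure (interior ?C) \<subseteq> {x. a \<bullet> x \<le> b}"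
        by (intro closure_minimal closed_halfspace_le)
      moreover have "?C \<subseteq> closure (interior ?C)"
        using convex_closure_interior[of ?C] False closure_subset by auto
      ultimately show ?thesis using ab by force
    qed
    then obtain w where "w \<noteq> 0" "supp_fun X w \<le> w \<bullet> s"
      unfolding convex_hull_le_supp_fun_iff by blast
    with pos show False by force
  qed
qed

text \<open>The set \<open>S\<close> selects the whole space or a half-space, so that one notion
  covers the polar volume and its two halves. With values in \<open>ennreal\<close> it makes sense
  for every \<open>s\<close>; over the whole space it is infinite when \<open>s\<close> is not
  interior to the hull, and minimization can run over all \<open>s\<close> without a
  constraint.\<close>

definition exp_int :: "'a set \<Rightarrow> ('m::finite \<Rightarrow> 'a::euclidean_space) \<Rightarrow> 'a \<Rightarrow> ennreal" where
  "exp_int S X s = (\<integral>\<^sup>+w. indicator S w * ennreal (exp (w \<bullet> s - supp_fun X w)) \<partial>lborel)"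

lemma exp_int_le_UNIV: "exp_int S X s \<le> exp_int UNIV X s"
  unfolding exp_int_def by (intro nn_integral_mono) (auto split: split_indicator)

lemma open_AE_notin_imp_empty:
  fixes S :: "'a::euclidean_space set"
  assumes "open S" "AE w in lborel. w \<notin> S"
  shows "S = {}"
proof -
  have "S \<in> null_sets lborel" using assms by (subst AE_iff_null_sets) auto
  then have "negligible S" by (simp add: negligible_iff_null_sets null_sets_completionI)
  with assms(1) show ?thesis using open_not_negligible by blast
qed

text \<open>Translation by \<open>w0\<close> does not decrease the integrand, because
  \<open>supp_fun\<close> is subadditive and \<open>w0\<close> violates the strict inequality. The
  slabs \<open>S j\<close> are successive translates by \<open>w0\<close> and disjoint, so
  infinitely many of them contribute at least the positive amount \<open>I 0\<close> each.\<close>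

lemma exp_int_UNIV_eq_top:
  assumes w0: "w0 \<noteq> 0" "supp_fun X w0 \<le> w0 \<bullet> s"
  shows "exp_int UNIV X s = \<infinity>"
proof -
  define f where "f w = ennreal (exp (w \<bullet> s - supp_fun X w))" for w
  have [measurable]: "f \<in> borel_measurable borel" unfolding f_def[abs_def] by measurable
  define l where "l w = w \<bullet> w0 / (w0 \<bullet> w0)" for w
  have [measurable]: "l \<in> borel_measurable borel" unfolding l_def[abs_def] by measurable
  define S where "S j = {w. real j \<le> l w \<and> l w < real j + 1}" for j
  have [measurable]: "S j \<in> sets borel" for j unfolding S_def by measurable
  define I where "I j = (\<integral>\<^sup>+w. indicator (S j) w * f w \<partial>lborel)" for j
  have l: "l (w0 + w) = l w + 1" for w
    using w0(1) by (simp add: l_def inner_add_left add_divide_distrib)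
  have "I j \<le> I (Suc j)" for j
  proof -
    have "I (Suc j) = (\<integral>\<^sup>+w. indicator (S (Suc j)) (w0 + w) * f (w0 + w) \<partial>lborel)"
      unfolding I_def by (rule nn_integral_lborel_translate[symmetric]) measurable
    also have "\<dots> \<ge> I j" unfolding I_def
    proof (rule nn_integral_mono)
      fix w
      have "indicator (S (Suc j)) (w0 + w) = (indicator (S j) w :: ennreal)"
        by (auto simp: S_def l split: split_indicator)
      moreover have "f w \<le> f (w0 + w)"
        using supp_fun_add[of X w0 w] w0(2) by (auto simp: f_def inner_add_left intro!: ennreal_leI)
      ultimately show "indicator (S j) w * f w \<le> indicator (S (Suc j)) (w0 + w) * f (w0 + w)"
        by (auto split: split_indicator)
    qed
    finally show ?thesis .
  qed
  then have mono: "I 0 \<le> I j" for j by (induction j) (auto intro: order_trans)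
  have le: "of_nat n * I 0 \<le> exp_int UNIV X s" for n
  proof -
    have "of_nat n * I 0 = (\<Sum>j<n. I 0)" by simp
    also have "\<dots> \<le> (\<Sum>j<n. I j)" by (intro sum_mono mono)
    also have "\<dots> = (\<integral>\<^sup>+w. (\<Sum>j<n. indicator (S j) w * f w) \<partial>lborel)"
      unfolding I_def by (rule nn_integral_sum[symmetric]) measurable
    also have "\<dots> \<le> (\<integral>\<^sup>+w. f w \<partial>lborel)"
    proof (rule nn_integral_mono)
      fix w
      have "(\<Sum>j<n. indicator (S j) w * f w) = (\<Sum>j\<in>{j. j < n \<and> w \<in> S j}. f w)"
        by (rule sum.mono_neutral_cong_right) (auto split: split_indicator)
      also have "\<dots> \<le> (\<Sum>j\<in>{nat \<lfloor>l w\<rfloor>}. f w)"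
      proof (rule sum_mono2)
        show "{j. j < n \<and> w \<in> S j} \<subseteq> {nat \<lfloor>l w\<rfloor>}"
        proof clarify
          fix j assume "w \<in> S j"
          then have "\<lfloor>l w\<rfloor> = int j" by (intro floor_unique) (auto simp: S_def)
          then show "j = nat \<lfloor>l w\<rfloor>" by simp
        qed
      qed auto
      finally show "(\<Sum>j<n. indicator (S j) w * f w) \<le> f w" by simp
    qed
    finally show ?thesis by (simp add: exp_int_def f_def)
  qed
  have "I 0 \<noteq> 0"
  proof
    assume "I 0 = 0"
    then have "AE w in lborel. indicator (S 0) w * f w = 0"
      unfolding I_def by (subst (asm) nn_integral_0_iff_AE) auto
    then have "AE w in lborel. w \<notin> S 0"
      by eventually_elim (auto simp: f_def split: split_indicator_asm)
    then have "AE w in lborel. w \<notin> {w. 0 < l w \<and> l w < 1}"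
      by eventually_elim (auto simp: S_def)
    moreover have "open {w. 0 < l w \<and> l w < 1}"
      unfolding l_def using w0(1) by (intro open_Collect_conj open_Collect_less continuous_intros) auto
    moreover have "(1/2) *\<^sub>R w0 \<in> {w. 0 < l w \<and> l w < 1}" using w0(1) by (simp add: l_def)
    ultimately show False
      using open_AE_notin_imp_empty by blast
  qed
  have "(SUP n. of_nat n) * I 0 \<le> exp_int UNIV X s"
    by (subst SUP_mult_right_ennreal) (auto intro!: SUP_least le)
  then show ?thesis
    using \<open>I 0 \<noteq> 0\<close> by (simp add: ennreal_SUP_of_nat_eq_top ennreal_top_mult top_unique)
qed

lemma exp_int_finite_imp_interior:
  assumes "exp_int UNIV X s < \<infinity>"
  shows "s \<in> interior (convex hull range X)"
proof (rule ccontr)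
  assume "\<not> ?thesis"
  then obtain w where "w \<noteq> 0" "supp_fun X w \<le> w \<bullet> s"
    unfolding interior_convex_hull_range_iff by (auto simp: not_less)
  from exp_int_UNIV_eq_top[OF this] assms show False by simp
qed

lemma nn_integral_exp_atLeast:
  "(\<integral>\<^sup>+t. indicator {a..} t * ennreal (exp (- t)) \<partial>lborel) = ennreal (exp (- a))"
proof -
  have "(\<integral>\<^sup>+t. indicator {a..} t * ennreal (exp (- t)) \<partial>lborel) =
      (\<integral>\<^sup>+t. indicator {a..} (a + t) * ennreal (exp (- (a + t))) \<partial>lborel)"
    by (rule nn_integral_lborel_translate[symmetric]) measurable
  also have "\<dots> = (\<integral>\<^sup>+t. ennreal (exp (- a)) * (ennreal (t ^ 0 * exp (- t)) * indicator {0..} t) \<partial>lborel)"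
  proof (rule nn_integral_cong)
    fix t
    have "exp (- (a + t)) = exp (- a) * exp (- t)" by (simp flip: exp_add)
    then show "indicator {a..} (a + t) * ennreal (exp (- (a + t))) = ennreal (exp (- a)) * (ennreal (t ^ 0 * exp (- t)) * indicator {0..} t)"
      by (cases "t \<ge> 0") (simp_all add: ennreal_mult)
  qed
  also have "\<dots> = ennreal (exp (- a))"
    by (subst nn_integral_cmult) (auto simp: nn_intergal_power_times_exp_Ici simp del: power_0)
  finally show ?thesis .
qed

text \<open>Writing \<open>exp (- g w)\<close> as the integral of \<open>exp (- t)\<close> over
  \<open>t \<ge> g w\<close> and exchanging the order leaves the volumes of the sublevel sets of
  \<open>g\<close>. These are dilates of the set at level 1, and the remaining integral of
  \<open>t ^ n * exp (- t)\<close> is \<open>n!\<close>.\<close>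

lemma exp_int_UNIV_eq_fact_emeasure:
  fixes X :: "'m::finite \<Rightarrow> 'a::euclidean_space"
  assumes s: "s \<in> interior (convex hull range X)"
  shows "exp_int UNIV X s = ennreal (fact DIM('a)) * emeasure lborel {w. supp_fun X w - w \<bullet> s \<le> 1}"
proof -
  define g where "g w = supp_fun X w - w \<bullet> s" for w
  have [measurable]: "g \<in> borel_measurable borel" unfolding g_def[abs_def] by measurable
  have g0: "g w \<ge> 0" for w
    using s supp_fun_ge[of 0 X] unfolding interior_convex_hull_range_iff g_def
    by (cases "w = 0") (auto intro: less_imp_le)
  have gs: "g (c *\<^sub>R w) = c * g w" if "c > 0" for c w
    using that by (simp add: g_def supp_fun_scale algebra_simps)
  have lev: "emeasure lborel {w. g w \<le> t} = ennreal (t ^ DIM('a)) * emeasure lborel {w. g w \<le> 1}" if t: "t > 0" for t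
  proof -
    have "emeasure lborel {w. g w \<le> t}
      = emeasure (density (distr lborel borel (\<lambda>x. 0 + t *\<^sub>R x)) (\<lambda>_. \<bar>t\<bar> ^ DIM('a))) {w. g w \<le> t}"
      by (subst lborel_affine[of t 0]) (use t in auto)
    also have "\<dots> = ennreal (t ^ DIM('a)) * emeasure lborel ((\<lambda>x. t *\<^sub>R x) -` {w. g w \<le> t})"
      using t by (subst emeasure_density_const) (auto simp: emeasure_distr)
    also have "(\<lambda>x. t *\<^sub>R x) -` {w. g w \<le> t} = {w. g w \<le> 1}"
      using t by (auto simp: gs)
    finally show ?thesis .
  qed
  have "exp_int UNIV X s = (\<integral>\<^sup>+w. ennreal (exp (- g w)) \<partial>lborel)"
    by (simp add: exp_int_def g_def)
  also have "\<dots> = (\<integral>\<^sup>+w. (\<integral>\<^sup>+t. indicator {g w..} t * ennreal (exp (- t)) \<partial>lborel) \<partial>lborel)"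
    by (simp add: nn_integral_exp_atLeast)
  also have "\<dots> = (\<integral>\<^sup>+t. (\<integral>\<^sup>+w. indicator {g w..} t * ennreal (exp (- t)) \<partial>lborel) \<partial>lborel)"
    by (rule lborel_pair.Fubini'[symmetric]) (simp add: indicator_def)
  also have "\<dots> = (\<integral>\<^sup>+t. ennreal (t ^ DIM('a) * exp (- t)) * indicator {0..} t * emeasure lborel {w. g w \<le> 1} \<partial>lborel)"
  proof (rule nn_integral_cong_AE)
    \<comment> \<open>The scaling of sublevel sets holds for positive levels, and for negative ones
      the sets are empty; the level 0 between them is a null set.\<close>
    have "AE t in lborel. t \<noteq> (0::real)" by (rule AE_lborel_singleton)
    then show "AE t in lborel. (\<integral>\<^sup>+w. indicator {g w..} t * ennreal (exp (- t)) \<partial>lborel)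
      = ennreal (t ^ DIM('a) * exp (- t)) * indicator {0..} t * emeasure lborel {w. g w \<le> 1}"
    proof eventually_elim
      case (elim t)
      have "(\<integral>\<^sup>+w. indicator {g w..} t * ennreal (exp (- t)) \<partial>lborel)
        = (\<integral>\<^sup>+w. indicator {w. g w \<le> t} w * ennreal (exp (- t)) \<partial>lborel)"
        by (intro nn_integral_cong) (auto split: split_indicator)
      also have "\<dots> = emeasure lborel {w. g w \<le> t} * ennreal (exp (- t))"
        by (simp add: nn_integral_multc)
      also have "\<dots> = ennreal (t ^ DIM('a) * exp (- t)) * indicator {0..} t * emeasure lborel {w. g w \<le> 1}"
      proof (cases "t > 0")
        case True
        then show ?thesis by (simp add: lev[OF True] ennreal_mult ac_simps)
      next
        case False
        with elim have "t < 0" by simp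
        then have "\<not> g w \<le> t" for w using g0[of w] by linarith
        then have "{w. g w \<le> t} = {}" by simp
        then show ?thesis using False elim by simp
      qed
      finally show ?case .
    qed
  qed
  also have "\<dots> = ennreal (fact DIM('a)) * emeasure lborel {w. g w \<le> 1}"
    by (subst nn_integral_multc) (auto simp: nn_intergal_power_times_exp_Ici)
  finally show ?thesis by (simp add: g_def)
qed

lemma exp_int_finite:
  fixes X :: "'m::finite \<Rightarrow> 'a::euclidean_space"
  assumes s: "s \<in> interior (convex hull range X)"
  shows "exp_int S X s < \<infinity>"
proof -
  obtain e where e: "e > 0" "\<And>w. w \<bullet> s + e * norm w \<le> supp_fun X w"
    by (rule interior_supp_fun_bound[OF s]) blast
  have "{w. supp_fun X w - w \<bullet> s \<le> 1} \<subseteq> cball 0 (1 / e)"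
  proof
    fix w assume "w \<in> {w. supp_fun X w - w \<bullet> s \<le> 1}"
    with e(2)[of w] have "e * norm w \<le> 1" by simp
    with e(1) show "w \<in> cball 0 (1 / e)" by (simp add: pos_le_divide_eq mult.commute)
  qed
  then have "emeasure lborel {w. supp_fun X w - w \<bullet> s \<le> 1} \<le> emeasure lborel (cball (0::'a) (1 / e))"
    by (intro emeasure_mono) auto
  also have "\<dots> < \<infinity>" using emeasure_bounded_finite[of "cball (0::'a) (1 / e)"] by simp
  finally have "exp_int UNIV X s < \<infinity>"
    unfolding exp_int_UNIV_eq_fact_emeasure[OF s] by (simp add: ennreal_mult_less_top)
  with exp_int_le_UNIV show ?thesis by (rule order.strict_trans1)
qed

lemma exp_int_pos:
  assumes S: "open S" "S \<noteq> {}"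
  shows "exp_int S X s > 0"
proof (rule ccontr)
  have [measurable]: "S \<in> sets borel" using S by simp
  assume "\<not> ?thesis"
  then have "AE w in lborel. indicator S w * ennreal (exp (w \<bullet> s - supp_fun X w)) = 0"
    unfolding exp_int_def by (subst (asm) not_gr_zero, subst (asm) nn_integral_0_iff_AE) auto
  then have "AE w in lborel. w \<notin> S"
    by eventually_elim (auto split: split_indicator_asm)
  with S show False using open_AE_notin_imp_empty by blast
qed

text \<open>Fatou's lemma, as the integrand depends continuously on the point. The bounds
  \<open>B k\<close> spare any statement about convergence of the integrals themselves.\<close>

lemma exp_int_lsc:
  assumes [measurable]: "S \<in> sets borel" and lim: "x \<longlonglongrightarrow> s"
    and le: "\<And>k. exp_int S X (x k) \<le> B k" and B: "B \<longlonglongrightarrow> c"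
  shows "exp_int S X s \<le> c"
proof -
  have "indicator S w * ennreal (exp (w \<bullet> s - supp_fun X w)) =
      liminf (\<lambda>k. indicator S w * ennreal (exp (w \<bullet> x k - supp_fun X w)))" for w
  proof (rule lim_imp_Liminf[symmetric])
    show "(\<lambda>k. indicator S w * ennreal (exp (w \<bullet> x k - supp_fun X w))) \<longlonglongrightarrow>
        indicator S w * ennreal (exp (w \<bullet> s - supp_fun X w))"
      by (cases "w \<in> S") (auto intro!: tendsto_intros lim)
  qed simp
  then have "exp_int S X s = (\<integral>\<^sup>+w. liminf (\<lambda>k. indicator S w * ennreal (exp (w \<bullet> x k - supp_fun X w))) \<partial>lborel)"
    unfolding exp_int_def by simp
  also have "\<dots> \<le> liminf (\<lambda>k. exp_int S X (x k))"
    unfolding exp_int_def by (rule nn_integral_liminf) measurable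
  also have "\<dots> \<le> liminf B"
    by (intro Liminf_mono always_eventually allI le)
  also have "\<dots> = c" by (rule lim_imp_Liminf[OF _ B]) simp
  finally show ?thesis .
qed

lemma exp_int_convex:
  assumes [measurable]: "S \<in> sets borel" and t: "0 \<le> t" "t \<le> 1"
  shows "exp_int S X ((1 - t) *\<^sub>R x + t *\<^sub>R y) \<le> ennreal (1 - t) * exp_int S X x + ennreal t * exp_int S X y"
proof -
  have "exp_int S X ((1 - t) *\<^sub>R x + t *\<^sub>R y) \<le>
      (\<integral>\<^sup>+w. ennreal (1 - t) * (indicator S w * ennreal (exp (w \<bullet> x - supp_fun X w)))
        + ennreal t * (indicator S w * ennreal (exp (w \<bullet> y - supp_fun X w))) \<partial>lborel)"
    unfolding exp_int_def
  proof (rule nn_integral_mono)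
    fix w
    have "exp ((1 - t) * (w \<bullet> x - supp_fun X w) + t * (w \<bullet> y - supp_fun X w))
      \<le> (1 - t) * exp (w \<bullet> x - supp_fun X w) + t * exp (w \<bullet> y - supp_fun X w)"
      using convex_onD[OF exp_convex, of t "w \<bullet> x - supp_fun X w" "w \<bullet> y - supp_fun X w"] t by simp
    also have "(1 - t) * (w \<bullet> x - supp_fun X w) + t * (w \<bullet> y - supp_fun X w)
      = w \<bullet> ((1 - t) *\<^sub>R x + t *\<^sub>R y) - supp_fun X w"
      by (simp add: inner_add_right algebra_simps)
    finally have "ennreal (exp (w \<bullet> ((1 - t) *\<^sub>R x + t *\<^sub>R y) - supp_fun X w)) \<le>
        ennreal ((1 - t) * exp (w \<bullet> x - supp_fun X w) + t * exp (w \<bullet> y - supp_fun X w))"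
      by (rule ennreal_leI)
    also have "\<dots> = ennreal (1 - t) * ennreal (exp (w \<bullet> x - supp_fun X w)) + ennreal t * ennreal (exp (w \<bullet> y - supp_fun X w))"
      using t by (simp add: ennreal_plus ennreal_mult)
    finally show "indicator S w * ennreal (exp (w \<bullet> ((1 - t) *\<^sub>R x + t *\<^sub>R y) - supp_fun X w))
      \<le> ennreal (1 - t) * (indicator S w * ennreal (exp (w \<bullet> x - supp_fun X w)))
        + ennreal t * (indicator S w * ennreal (exp (w \<bullet> y - supp_fun X w)))"
      by (auto split: split_indicator)
  qed
  also have "\<dots> = ennreal (1 - t) * exp_int S X x + ennreal t * exp_int S X y"
    unfolding exp_int_def by (simp add: nn_integral_add nn_integral_cmult)
  finally show ?thesis .
qed

text \<open>A finite convex function on an open subset of a finite-dimensional space is continuous,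
  so no dominating function has to be found.\<close>

lemma continuous_on_exp_int:
  fixes X :: "'m::finite \<Rightarrow> 'a::euclidean_space"
  assumes S: "S \<in> sets borel"
  shows "continuous_on (interior (convex hull range X)) (\<lambda>s. enn2real (exp_int S X s))"
proof (rule convex_on_continuous)
  show "convex_on (interior (convex hull range X)) (\<lambda>s. enn2real (exp_int S X s))"
  proof (intro convex_onI convex_interior convex_convex_hull)
    fix t :: real and x y :: 'a
    assume t: "0 < t" "t < 1" and xy: "x \<in> interior (convex hull range X)" "y \<in> interior (convex hull range X)"
    note fin = xy[THEN exp_int_finite, of S]
    have "enn2real (exp_int S X ((1 - t) *\<^sub>R x + t *\<^sub>R y)) \<le> enn2real (ennreal (1 - t) * exp_int S X x + ennreal t * exp_int S X y)"
      using fin t by (intro enn2real_mono exp_int_convex S) (auto simp: ennreal_mult_less_top)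
    also have "\<dots> = (1 - t) * enn2real (exp_int S X x) + t * enn2real (exp_int S X y)"
      using fin t by (subst enn2real_plus) (auto simp: ennreal_mult_less_top enn2real_mult)
    finally show "enn2real (exp_int S X ((1 - t) *\<^sub>R x + t *\<^sub>R y)) \<le> (1 - t) * enn2real (exp_int S X x) + t * enn2real (exp_int S X y)" .
  qed
qed simp

section \<open>Positive barycentric coordinates of interior points\<close>

lemma convex_hull_range_finite:
  fixes X :: "'m::finite \<Rightarrow> 'a::real_vector"
  assumes "y \<in> convex hull range X"
  obtains \<nu> where "\<And>i. \<nu> i \<ge> 0" "(\<Sum>i\<in>UNIV. \<nu> i) = 1" "y = (\<Sum>i\<in>UNIV. \<nu> i *\<^sub>R X i)"
proof -
  let ?S = "{\<Sum>i\<in>UNIV. \<nu> i *\<^sub>R X i |\<nu>. (\<forall>i. \<nu> i \<ge> 0) \<and> (\<Sum>i\<in>UNIV. \<nu> i) = 1}"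
  have "convex hull range X \<subseteq> ?S"
  proof (rule hull_minimal)
    show "range X \<subseteq> ?S"
    proof clarify
      fix i
      show "\<exists>\<nu>. X i = (\<Sum>j\<in>UNIV. \<nu> j *\<^sub>R X j) \<and> (\<forall>j. \<nu> j \<ge> 0) \<and> (\<Sum>j\<in>UNIV. \<nu> j) = (1::real)"
        by (intro exI[of _ "\<lambda>j. if j = i then 1 else 0"]) (auto simp: if_distrib[of "\<lambda>c. c *\<^sub>R _"] cong: if_cong)
    qed
    show "convex ?S"
    proof (rule convexI)
      fix x y and u v :: real
      assume "x \<in> ?S" "y \<in> ?S" and uv: "0 \<le> u" "0 \<le> v" "u + v = 1"
      then obtain \<nu> \<mu> where *: "\<And>i. \<nu> i \<ge> 0" "(\<Sum>i\<in>UNIV. \<nu> i) = 1" "x = (\<Sum>i\<in>UNIV. \<nu> i *\<^sub>R X i)"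
         "\<And>i. \<mu> i \<ge> 0" "(\<Sum>i\<in>UNIV. \<mu> i) = 1" "y = (\<Sum>i\<in>UNIV. \<mu> i *\<^sub>R X i)" by blast
      show "u *\<^sub>R x + v *\<^sub>R y \<in> ?S"
        using * uv
        by (intro CollectI exI[of _ "\<lambda>i. u * \<nu> i + v * \<mu> i"])
          (auto simp: scaleR_sum_right scaleR_add_left sum.distrib simp flip: sum_distrib_left)
    qed
  qed
  with assms that show thesis by blast
qed

text \<open>An interior point can be pushed slightly away from the centroid \<open>m\<close> without
  leaving the hull. It is then a proper mixture of the pushed point and \<open>m\<close>, and the
  equal weights of \<open>m\<close> make every weight positive. Such weights can be transferred to
  the tuples at other times.\<close>

lemma interior_convex_hull_range_positive:
  fixes X :: "'m::finite \<Rightarrow> 'a::euclidean_space"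
  assumes s: "s \<in> interior (convex hull range X)"
  obtains \<mu> where "\<And>i. \<mu> i > 0" "(\<Sum>i\<in>UNIV. \<mu> i) = 1" "s = (\<Sum>i\<in>UNIV. \<mu> i *\<^sub>R X i)"
proof -
  define N where "N = real CARD('m)"
  have N: "N > 0" by (simp add: N_def)
  define m where "m = (\<Sum>i\<in>UNIV. (1 / N) *\<^sub>R X i)"
  obtain e where e: "e > 0" "cball s e \<subseteq> convex hull range X"
    using s by (auto simp: mem_interior_cball)
  \<comment> \<open>The push has length at most \<open>e\<close>; the summand 1 keeps the
    denominator positive when \<open>s = m\<close>.\<close>
  define d where "d = e / (norm (s - m) + 1)"
  have d: "d > 0" using e by (simp add: d_def add_nonneg_pos)
  have "d * norm (s - m) \<le> e"
    using e by (simp add: d_def divide_le_eq add_nonneg_pos mult_left_mono)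
  then have "s + d *\<^sub>R (s - m) \<in> cball s e" using d by (simp add: dist_norm)
  with e(2) have "s + d *\<^sub>R (s - m) \<in> convex hull range X" by blast
  then obtain \<nu> where \<nu>: "\<And>i. \<nu> i \<ge> 0" "(\<Sum>i\<in>UNIV. \<nu> i) = 1"
      "s + d *\<^sub>R (s - m) = (\<Sum>i\<in>UNIV. \<nu> i *\<^sub>R X i)"
    by (rule convex_hull_range_finite) blast
  define \<mu> where "\<mu> i = (\<nu> i + d / N) / (1 + d)" for i
  have pos: "\<mu> i > 0" for i
    using \<nu>(1)[of i] d N by (auto simp: \<mu>_def intro!: divide_pos_pos add_nonneg_pos)
  have one: "(\<Sum>i\<in>UNIV. \<mu> i) = 1"
    using d N unfolding \<mu>_def by (simp add: sum.distrib \<nu> flip: sum_divide_distrib) (simp add: N_def)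
  have "(1 + d) *\<^sub>R s = (\<Sum>i\<in>UNIV. \<nu> i *\<^sub>R X i) + d *\<^sub>R m"
    using \<nu>(3) by (simp add: algebra_simps)
  also have "\<dots> = (1 + d) *\<^sub>R (\<Sum>i\<in>UNIV. \<mu> i *\<^sub>R X i)"
    using d by (simp add: \<mu>_def m_def scaleR_sum_right sum.distrib scaleR_add_left)
  finally have "s = (\<Sum>i\<in>UNIV. \<mu> i *\<^sub>R X i)" using d by simp
  with pos one that show thesis by blast
qed

text \<open>If the combination attained the support value in direction \<open>w\<close>, positivity
  of all weights would force every point of the tuple to attain it. The hull would lie in a
  hyperplane, against the existence of the interior point \<open>q\<close>.\<close>

lemma positive_combination_in_interior:
  fixes X :: "'m::finite \<Rightarrow> 'a::euclidean_space"
  assumes ne: "interior (convex hull range X) \<noteq> {}"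
    and \<mu>: "\<And>i. \<mu> i > 0" "(\<Sum>i\<in>UNIV. \<mu> i) = 1"
  shows "(\<Sum>i\<in>UNIV. \<mu> i *\<^sub>R X i) \<in> interior (convex hull range X)"
  unfolding interior_convex_hull_range_iff
proof (intro allI impI)
  fix w :: 'a assume w: "w \<noteq> 0"
  obtain q where q: "\<And>w. w \<noteq> 0 \<Longrightarrow> w \<bullet> q < supp_fun X w"
    using ne interior_convex_hull_range_iff[of _ X] by blast
  let ?s = "\<Sum>i\<in>UNIV. \<mu> i *\<^sub>R X i"
  show "w \<bullet> ?s < supp_fun X w"
  proof (rule ccontr)
    assume "\<not> ?thesis"
    then have "(\<Sum>i\<in>UNIV. \<mu> i * (supp_fun X w - w \<bullet> X i)) \<le> 0"
      by (simp add: inner_sum_right right_diff_distrib sum_subtractf \<mu>(2) flip: sum_distrib_right)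
    then have "(\<Sum>i\<in>UNIV. \<mu> i * (supp_fun X w - w \<bullet> X i)) = 0"
      using \<mu>(1) by (intro antisym sum_nonneg mult_nonneg_nonneg) (auto simp: supp_fun_ge less_imp_le)
    then have "\<mu> i * (supp_fun X w - w \<bullet> X i) = 0" for i
      using \<mu>(1) by (subst (asm) sum_nonneg_eq_0_iff) (auto simp: supp_fun_ge less_imp_le)
    then have eq: "w \<bullet> X i = supp_fun X w" for i
      using \<mu>(1)[of i] by (metis less_irrefl mult_eq_0_iff right_minus_eq)
    then have "supp_fun X (- w) \<le> - supp_fun X w"
      by (simp add: supp_fun_le_iff)
    with q[of w] q[of "- w"] w show False by simp
  qed
qed

section \<open>Existence and uniqueness of the Santalo point\<close>

definition min_exp_int :: "('m::finite \<Rightarrow> 'a::euclidean_space) \<Rightarrow> ennreal" where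
  "min_exp_int X = (INF s. exp_int UNIV X s)"

lemma min_exp_int_le: "min_exp_int X \<le> exp_int UNIV X s"
  unfolding min_exp_int_def by (rule INF_lower) simp

text \<open>The direct method: a minimizing sequence has finite values, hence stays in the compact
  hull, and lower semicontinuity passes to a limit point. That point might lie on the boundary, but
  its value is finite, which makes it interior.\<close>

lemma min_exp_int_attained:
  fixes X :: "'m::finite \<Rightarrow> 'a::euclidean_space"
  assumes ne: "interior (convex hull range X) \<noteq> {}"
  obtains s where "s \<in> interior (convex hull range X)" "exp_int UNIV X s = min_exp_int X"
    "exp_int UNIV X s < \<infinity>"
proof -
  let ?C = "convex hull range X"
  obtain q where "q \<in> interior ?C" using ne by blast
  from exp_int_finite[OF this, of UNIV] have fin: "min_exp_int X < \<infinity>"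
    using min_exp_int_le[of X q] by (rule order.strict_trans1[rotated])
  define B where "B k = min_exp_int X + ennreal (1 / real (Suc k))" for k
  have lt: "min_exp_int X < B k" for k
    using fin unfolding B_def by (cases "min_exp_int X") (auto simp: ennreal_less_iff simp flip: ennreal_plus)
  then have "\<exists>x. exp_int UNIV X x < B k" for k
    unfolding min_exp_int_def by (auto simp: INF_less_iff)
  then obtain x where x: "\<And>k. exp_int UNIV X (x k) < B k" by metis
  have xi: "x k \<in> interior ?C" for k
  proof (rule exp_int_finite_imp_interior)
    have "B k < \<infinity>" using fin by (simp add: B_def)
    with x[of k] show "exp_int UNIV X (x k) < \<infinity>" by (rule order.strict_trans)
  qed
  have "compact ?C" by (simp add: finite_imp_compact_convex_hull)
  moreover have "\<forall>k. x k \<in> ?C" using xi interior_subset by blast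
  ultimately obtain s r where sr: "s \<in> ?C" "strict_mono r" "(x \<circ> r) \<longlonglongrightarrow> s"
    unfolding compact_def by metis
  have "B \<longlonglongrightarrow> min_exp_int X + ennreal 0"
    unfolding B_def using LIMSEQ_Suc[OF lim_inverse_n'] by (intro tendsto_intros tendsto_ennrealI) auto
  then have B: "(B \<circ> r) \<longlonglongrightarrow> min_exp_int X"
    using sr(2) by (simp add: LIMSEQ_subseq_LIMSEQ)
  have "exp_int UNIV X s \<le> min_exp_int X"
    by (rule exp_int_lsc[OF _ sr(3) _ B]) (auto intro: less_imp_le x)
  with min_exp_int_le[of X s] have eq: "exp_int UNIV X s = min_exp_int X" by simp
  with fin have "exp_int UNIV X s < \<infinity>" by simp
  with eq that exp_int_finite_imp_interior show thesis by blast
qed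

text \<open>Strict convexity: \<open>(\<surd>a - \<surd>b)\<^sup>2 = a + b - 2 \<surd>(a b)\<close> for the two integrands \<open>a\<close>, \<open>b\<close>, and
  \<open>\<surd>(a b)\<close> is the integrand at the midpoint.\<close>

lemma min_exp_int_unique:
  fixes X :: "'m::finite \<Rightarrow> 'a::euclidean_space"
  assumes s: "exp_int UNIV X s = min_exp_int X" and s': "exp_int UNIV X s' = min_exp_int X"
    and fin: "min_exp_int X < \<infinity>"
  shows "s = s'"
proof (rule ccontr)
  assume ne: "s \<noteq> s'"
  define a where "a w = exp ((w \<bullet> s - supp_fun X w) / 2)" for w
  define b where "b w = exp ((w \<bullet> s' - supp_fun X w) / 2)" for w
  have [measurable]: "a \<in> borel_measurable borel" "b \<in> borel_measurable borel"
    unfolding a_def[abs_def] b_def[abs_def] by measurable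
  have J: "exp_int UNIV X s = (\<integral>\<^sup>+w. ennreal (a w * a w) \<partial>lborel)"
      "exp_int UNIV X s' = (\<integral>\<^sup>+w. ennreal (b w * b w) \<partial>lborel)"
      "exp_int UNIV X ((1/2) *\<^sub>R (s + s')) = (\<integral>\<^sup>+w. ennreal (a w * b w) \<partial>lborel)"
    unfolding exp_int_def a_def b_def
    by (auto intro!: nn_integral_cong arg_cong[of _ _ ennreal] simp: inner_add_right field_simps simp flip: exp_add)
  have pos: "a w > 0" "b w > 0" for w by (simp_all add: a_def b_def)
  have "2 * exp_int UNIV X ((1/2) *\<^sub>R (s + s')) + (\<integral>\<^sup>+w. ennreal ((a w - b w)\<^sup>2) \<partial>lborel)
    = (\<integral>\<^sup>+w. 2 * ennreal (a w * b w) + ennreal ((a w - b w)\<^sup>2) \<partial>lborel)"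
    unfolding J by (simp add: nn_integral_add nn_integral_cmult)
  also have "\<dots> = (\<integral>\<^sup>+w. ennreal (a w * a w) + ennreal (b w * b w) \<partial>lborel)"
  proof (rule nn_integral_cong)
    fix w
    have "2 * ennreal (a w * b w) + ennreal ((a w - b w)\<^sup>2) = ennreal (2 * (a w * b w) + (a w - b w)\<^sup>2)"
      using pos[of w] by (subst ennreal_plus) (auto simp: ennreal_mult)
    also have "2 * (a w * b w) + (a w - b w)\<^sup>2 = a w * a w + b w * b w"
      by (simp add: power2_eq_square algebra_simps)
    finally show "2 * ennreal (a w * b w) + ennreal ((a w - b w)\<^sup>2) = ennreal (a w * a w) + ennreal (b w * b w)"
      using pos[of w] by simp
  qed
  also have "\<dots> = 2 * min_exp_int X"
    using s s' unfolding J by (simp add: nn_integral_add mult_2)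
  also have "\<dots> \<le> 2 * exp_int UNIV X ((1/2) *\<^sub>R (s + s'))"
    by (intro mult_left_mono min_exp_int_le) auto
  finally have le: "2 * exp_int UNIV X ((1/2) *\<^sub>R (s + s')) + (\<integral>\<^sup>+w. ennreal ((a w - b w)\<^sup>2) \<partial>lborel)
    \<le> 2 * exp_int UNIV X ((1/2) *\<^sub>R (s + s'))" .
  have "exp_int UNIV X ((1/2) *\<^sub>R (s + s')) < \<infinity>"
  proof -
    obtain h :: real where h: "h = 1/2" by blast
    have h01: "0 \<le> h" "h \<le> 1" by (simp_all add: h)
    have "(1/2) *\<^sub>R (s + s') = (1 - h) *\<^sub>R s + h *\<^sub>R s'" by (simp add: scaleR_add_right h)
    then have "exp_int UNIV X ((1/2) *\<^sub>R (s + s')) \<le> ennreal (1 - h) * exp_int UNIV X s + ennreal h * exp_int UNIV X s'"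
      using exp_int_convex[OF _ h01, of UNIV X s s'] by (simp only: sets.top space_borel sets_lborel) simp
    also have "\<dots> < \<infinity>" using fin s s' by (simp add: ennreal_mult_less_top)
    finally show ?thesis .
  qed
  \<comment> \<open>The midpoint value is finite, so it can be cancelled from both sides of
    \<open>le\<close>.\<close>
  then have "(\<integral>\<^sup>+w. ennreal ((a w - b w)\<^sup>2) \<partial>lborel) = 0"
    using le by (cases "exp_int UNIV X ((1/2) *\<^sub>R (s + s'))"; cases "\<integral>\<^sup>+w. ennreal ((a w - b w)\<^sup>2) \<partial>lborel")
       (auto simp: top_unique ennreal_mult_top simp flip: ennreal_plus ennreal_mult'' ennreal_numeral)
  then have "AE w in lborel. ennreal ((a w - b w)\<^sup>2) = 0"
    by (subst (asm) nn_integral_0_iff_AE) auto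
  then have "AE w in lborel. w \<notin> {w. w \<bullet> s \<noteq> w \<bullet> s'}"
    by eventually_elim (auto simp: a_def b_def)
  moreover have "open {w. w \<bullet> s \<noteq> w \<bullet> s'}" by (intro open_Collect_neq continuous_intros)
  ultimately have "{w. w \<bullet> s \<noteq> w \<bullet> s'} = {}" by (intro open_AE_notin_imp_empty)
  then have "(s - s') \<bullet> s = (s - s') \<bullet> s'" by blast
  then have "(s - s') \<bullet> (s - s') = 0" by (simp add: inner_diff_right)
  with ne show False by simp
qed

subsection \<open>Convexity along a shadow system\<close>

abbreviation halfspace :: "'a::real_inner \<Rightarrow> 'a set" where
  "halfspace \<theta> \<equiv> {w. w \<bullet> \<theta> > 0}"

lemma open_halfspace: "open (halfspace \<theta>)"
  by (intro open_Collect_less continuous_intros)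

lemma exp_int_halfspaces:
  fixes X :: "'m::finite \<Rightarrow> 'a::euclidean_space"
  assumes "\<theta> \<noteq> 0"
  shows "exp_int UNIV X s = exp_int (halfspace \<theta>) X s + exp_int (halfspace (- \<theta>)) X s"
proof -
  have "{w. \<theta> \<bullet> w = 0} \<in> null_sets lborel"
    using negligible_hyperplane[of \<theta> 0] assms
    by (simp add: negligible_iff_null_sets null_sets_completion_iff)
  then have ae: "AE w in lborel. w \<bullet> \<theta> \<noteq> 0"
    by (auto dest!: AE_not_in simp: inner_commute)
  have [measurable]: "halfspace \<theta> \<in> sets borel" "halfspace (- \<theta>) \<in> sets borel"
    using open_halfspace by auto
  have "exp_int UNIV X s = (\<integral>\<^sup>+w. indicator (halfspace \<theta>) w * ennreal (exp (w \<bullet> s - supp_fun X w))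
      + indicator (halfspace (- \<theta>)) w * ennreal (exp (w \<bullet> s - supp_fun X w)) \<partial>lborel)"
    unfolding exp_int_def
    by (rule nn_integral_cong_AE) (use ae in eventually_elim, auto split: split_indicator)
  then show ?thesis unfolding exp_int_def by (simp add: nn_integral_add)
qed

section \<open>Balancing the two half-space integrals by a shift\<close>

lemma exp_int_halfspace_mono:
  assumes "c \<le> d"
  shows "exp_int (halfspace \<theta>) X (s + c *\<^sub>R \<theta>) \<le> exp_int (halfspace \<theta>) X (s + d *\<^sub>R \<theta>)"
    and "exp_int (halfspace (- \<theta>)) X (s + d *\<^sub>R \<theta>) \<le> exp_int (halfspace (- \<theta>)) X (s + c *\<^sub>R \<theta>)"
  unfolding exp_int_def using assms
  by (auto intro!: nn_integral_mono ennreal_leI mult_right_mono mult_right_mono_neg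
      split: split_indicator simp: inner_add_right)

lemma nonempty_halfspace: "\<theta> \<noteq> 0 \<Longrightarrow> halfspace \<theta> \<noteq> {}"
  by (auto intro!: exI[of _ \<theta>])

text \<open>Used with \<open>a = u\<close> and \<open>b = 1 - u\<close>: the two shifted points then
  have \<open>s\<close> as their mixture with weights \<open>1 - u\<close> and \<open>u\<close>,
  whatever \<open>c\<close> is.\<close>

definition shift_set :: "'a::euclidean_space \<Rightarrow> ('m \<Rightarrow> 'a) \<Rightarrow> ('m \<Rightarrow> 'a) \<Rightarrow> 'a \<Rightarrow> real \<Rightarrow> real \<Rightarrow> real set" where
  "shift_set \<theta> X0 X1 s a b =
    {c. s - (a * c) *\<^sub>R \<theta> \<in> interior (convex hull range X0) \<and> s + (b * c) *\<^sub>R \<theta> \<in> interior (convex hull range X1)}"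

lemma convex_shift_set:
  fixes s :: "'a::euclidean_space"
  shows "convex (shift_set \<theta> X0 X1 s a b)"
proof -
  have eq: "shift_set \<theta> X0 X1 s a b = (\<lambda>c. s + c *\<^sub>R (- (a *\<^sub>R \<theta>))) -` interior (convex hull range X0)
      \<inter> (\<lambda>c. s + c *\<^sub>R (b *\<^sub>R \<theta>)) -` interior (convex hull range X1)"
    by (auto simp: shift_set_def mult.commute)
  have pre: "convex ((\<lambda>c. x + c *\<^sub>R y) -` A)" if A: "convex A" for x y :: 'a and A
  proof (rule convexI)
    fix c d u v :: real
    assume cd: "c \<in> (\<lambda>c. x + c *\<^sub>R y) -` A" "d \<in> (\<lambda>c. x + c *\<^sub>R y) -` A" and uv: "0 \<le> u" "0 \<le> v" "u + v = 1"
    have "u *\<^sub>R (x + c *\<^sub>R y) + v *\<^sub>R (x + d *\<^sub>R y) \<in> A"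
      using cd uv by (intro convexD[OF A]) auto
    also have "u *\<^sub>R (x + c *\<^sub>R y) + v *\<^sub>R (x + d *\<^sub>R y) = (u + v) *\<^sub>R x + (u * c + v * d) *\<^sub>R y"
      by (simp add: algebra_simps)
    finally show "u *\<^sub>R c + v *\<^sub>R d \<in> (\<lambda>c. x + c *\<^sub>R y) -` A" using uv by simp
  qed
  show ?thesis unfolding eq by (intro convex_Int pre convex_interior convex_convex_hull)
qed

text \<open>At the upper end of the interval of admissible shifts one of the two points reaches the boundary,
  so one factor on the right blows up: the factors on the right increase with the shift, those on the
  left decrease.\<close>

lemma shift_blow_up:
  fixes X0 X1 :: "'m::finite \<Rightarrow> 'a::euclidean_space"
  assumes \<theta>: "\<theta> \<noteq> 0" and ab: "a > 0" "b > 0" and ne: "shift_set \<theta> X0 X1 s a b \<noteq> {}"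
  shows "\<exists>c\<in>shift_set \<theta> X0 X1 s a b.
    exp_int (halfspace (- \<theta>)) X1 (s + (b * c) *\<^sub>R \<theta>) * exp_int (halfspace \<theta>) X0 (s - (a * c) *\<^sub>R \<theta>)
    < exp_int (halfspace \<theta>) X1 (s + (b * c) *\<^sub>R \<theta>) * exp_int (halfspace (- \<theta>)) X0 (s - (a * c) *\<^sub>R \<theta>)"
proof (rule ccontr)
  let ?I = "shift_set \<theta> X0 X1 s a b"
  assume "\<not> ?thesis"
  then have H: "exp_int (halfspace \<theta>) X1 (s + (b * c) *\<^sub>R \<theta>) * exp_int (halfspace (- \<theta>)) X0 (s - (a * c) *\<^sub>R \<theta>)
    \<le> exp_int (halfspace (- \<theta>)) X1 (s + (b * c) *\<^sub>R \<theta>) * exp_int (halfspace \<theta>) X0 (s - (a * c) *\<^sub>R \<theta>)"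
    if "c \<in> ?I" for c using that by (auto simp: not_less)
  define p where "p c = exp_int (halfspace \<theta>) X1 (s + (b * c) *\<^sub>R \<theta>)" for c
  define p' where "p' c = exp_int (halfspace (- \<theta>)) X1 (s + (b * c) *\<^sub>R \<theta>)" for c
  define q where "q c = exp_int (halfspace \<theta>) X0 (s - (a * c) *\<^sub>R \<theta>)" for c
  define q' where "q' c = exp_int (halfspace (- \<theta>)) X0 (s - (a * c) *\<^sub>R \<theta>)" for c
  have mono: "p c \<le> p d" "p' d \<le> p' c" "q d \<le> q c" "q' c \<le> q' d" if "c \<le> d" for c d
    using ab that exp_int_halfspace_mono(1)[of "b * c" "b * d" \<theta> X1 s] exp_int_halfspace_mono(2)[of "b * c" "b * d" \<theta> X1 s]
      exp_int_halfspace_mono(1)[of "- (a * d)" "- (a * c)" \<theta> X0 s] exp_int_halfspace_mono(2)[of "- (a * d)" "- (a * c)" \<theta> X0 s]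
    by (simp_all add: p_def p'_def q_def q'_def)
  have pos: "p c > 0" "q' c > 0" for c
    using \<theta> by (auto simp: p_def q'_def intro!: exp_int_pos open_halfspace nonempty_halfspace simp del: inner_minus_right)
  have fin: "p' c < \<infinity>" "q c < \<infinity>" "p c < \<infinity>" "q' c < \<infinity>" if "c \<in> ?I" for c
    using that by (auto simp: p_def p'_def q_def q'_def shift_set_def intro!: exp_int_finite[unfolded infinity_ennreal_def])
  obtain c0 where c0: "c0 \<in> ?I" using ne by blast
  have "convex ?I" by (rule convex_shift_set)
  have opn: "open ?I"
  proof -
    have "?I = (\<lambda>c. s - (a * c) *\<^sub>R \<theta>) -` interior (convex hull range X0) \<inter> (\<lambda>c. s + (b * c) *\<^sub>R \<theta>) -` interior (convex hull range X1)"
      by (auto simp: shift_set_def)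
    then show ?thesis by (auto intro!: open_Int open_vimage continuous_intros)
  qed
  have bdd: "bdd_above ?I"
  proof -
    have "bounded (convex hull range X1)"
      by (intro bounded_convex_hull finite_imp_bounded) auto
    then obtain R where R: "\<And>x. x \<in> convex hull range X1 \<Longrightarrow> norm x \<le> R" by (auto simp: bounded_iff)
    have "c \<le> (R + norm s) / (b * norm \<theta>)" if "c \<in> ?I" for c
    proof -
      have "s + (b * c) *\<^sub>R \<theta> \<in> convex hull range X1"
        using that interior_subset by (auto simp: shift_set_def)
      from R[OF this] have "norm ((b * c) *\<^sub>R \<theta>) \<le> R + norm s"
        using norm_triangle_ineq4[of "s + (b * c) *\<^sub>R \<theta>" s] by simp
      then have "b * norm \<theta> * \<bar>c\<bar> \<le> R + norm s" using ab by (simp add: abs_mult ac_simps)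
      moreover have "b * norm \<theta> * c \<le> b * norm \<theta> * \<bar>c\<bar>" using ab by (intro mult_left_mono) auto
      ultimately have "b * norm \<theta> * c \<le> R + norm s" by linarith
      then show ?thesis using ab \<theta> by (simp add: pos_le_divide_eq mult.commute)
    qed
    then show ?thesis by (auto simp: bdd_above_def)
  qed
  define z where "z = Sup ?I"
  have z: "c \<le> z" if "c \<in> ?I" for c using that bdd by (simp add: z_def cSup_upper)
  have in_I: "c \<in> ?I" if "c0 \<le> c" "c < z" for c
  proof -
    obtain d where "d \<in> ?I" "c < d" using \<open>c < z\<close> ne bdd by (auto simp: z_def less_cSup_iff)
    with \<open>convex ?I\<close> c0 that show ?thesis
      by (meson is_interval_convex_1 is_interval_1 less_imp_le)
  qed
  have "c0 < z"
  proof -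
    obtain e where "e > 0" "ball c0 e \<subseteq> ?I" using opn c0 by (auto simp: open_contains_ball)
    then have "c0 + e / 2 \<in> ?I" by (auto simp: dist_real_def)
    with z[OF this] \<open>e > 0\<close> show ?thesis by simp
  qed
  define x where "x k = z - (z - c0) / real (Suc k)" for k
  have x: "x k \<in> ?I" "c0 \<le> x k" for k
  proof -
    have "(z - c0) / real (Suc k) \<le> z - c0" "0 < (z - c0) / real (Suc k)"
      using \<open>c0 < z\<close> by (auto simp: divide_le_eq mult_le_cancel_left1)
    then show "c0 \<le> x k" by (simp add: x_def)
    then show "x k \<in> ?I" using in_I[of "x k"] \<open>0 < (z - c0) / real (Suc k)\<close> by (simp add: x_def)
  qed
  have "x \<longlonglongrightarrow> z - 0"
    unfolding x_def by (intro tendsto_intros LIMSEQ_Suc[OF lim_const_over_n])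
  then have xz: "x \<longlonglongrightarrow> z" by simp
  \<comment> \<open>The assumed inequality bounds the increasing product by the decreasing one,
    hence by the value of the latter at \<open>c0\<close>, where the sequence starts.\<close>
  have K: "p (x k) * q' (x k) \<le> p' c0 * q c0" for k
  proof -
    have "p (x k) * q' (x k) \<le> p' (x k) * q (x k)"
      unfolding p_def q_def p'_def q'_def by (rule H[OF x(1)])
    also have "\<dots> \<le> p' c0 * q c0" using x(2) by (intro mult_mono mono) auto
    finally show ?thesis .
  qed
  \<comment> \<open>A bound on the product bounds each factor, since the other one never falls below
    its positive value at \<open>c0\<close>.\<close>
  have "p (x k) * q' c0 \<le> p (x k) * q' (x k)" for k
    by (intro mult_left_mono mono x zero_le)
  from order_trans[OF this K] have K1: "p (x k) * q' c0 \<le> p' c0 * q c0" for k .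
  have "q' (x k) * p c0 \<le> p (x k) * q' (x k)" for k
    unfolding mult.commute[of "p (x k)"] by (intro mult_left_mono mono x zero_le)
  from order_trans[OF this K] have K2: "q' (x k) * p c0 \<le> p' c0 * q c0" for k .
  have fK: "p' c0 * q c0 < \<infinity>" using fin[OF c0] by (simp add: ennreal_mult_less_top)
  have lsc: "exp_int S Y y < \<infinity>"
    if S: "S \<in> sets borel" and lim: "y' \<longlonglongrightarrow> y" and le: "\<And>k. exp_int S Y (y' k) * B \<le> K" and "B > 0" "K < \<infinity>" "B < \<infinity>"
    for S :: "'a set" and Y :: "'m \<Rightarrow> 'a" and y' y and B K :: ennreal
  proof -
    have "exp_int S Y (y' k) \<le> K / B" for k
      using le[of k] \<open>B > 0\<close> \<open>B < \<infinity>\<close> by (metis divide_less_ennreal infinity_ennreal_def not_less not_gr_zero)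
    then have "exp_int S Y y \<le> K / B" by (rule exp_int_lsc[OF S lim _ tendsto_const])
    also have "\<dots> < \<infinity>" using \<open>B > 0\<close> \<open>K < \<infinity>\<close> by (cases "K / B = top") (auto simp: ennreal_divide_eq_top_iff less_top[symmetric])
    finally show ?thesis .
  qed
  have "p z < \<infinity>" unfolding p_def
  proof (rule lsc)
    show "(\<lambda>k. s + (b * x k) *\<^sub>R \<theta>) \<longlonglongrightarrow> s + (b * z) *\<^sub>R \<theta>" by (intro tendsto_intros xz)
    show "exp_int (halfspace \<theta>) X1 (s + (b * x k) *\<^sub>R \<theta>) * q' c0 \<le> p' c0 * q c0" for k
      using K1[of k] unfolding p_def[of "x k"] .
  qed (use pos fin[OF c0] fK open_halfspace in auto)
  moreover have "q' z < \<infinity>" unfolding q'_def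
  proof (rule lsc)
    show "(\<lambda>k. s - (a * x k) *\<^sub>R \<theta>) \<longlonglongrightarrow> s - (a * z) *\<^sub>R \<theta>" by (intro tendsto_intros xz)
    show "exp_int (halfspace (- \<theta>)) X0 (s - (a * x k) *\<^sub>R \<theta>) * p c0 \<le> p' c0 * q c0" for k
      using K2[of k] unfolding q'_def[of "x k"] .
  qed (use pos fin[OF c0] fK open_halfspace in \<open>auto simp del: inner_minus_right\<close>)
  moreover have "p' z < \<infinity>" "q z < \<infinity>"
    using mono(2,3)[of c0 z] \<open>c0 < z\<close> fin(1,2)[OF c0] by (auto intro: order.strict_trans1)
  \<comment> \<open>All four halves are finite at the supremum \<open>z\<close>, so both points are
    still interior and \<open>z\<close> is admissible. The set of admissible shifts is open and
    cannot contain its supremum.\<close>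
  ultimately have "exp_int UNIV X1 (s + (b * z) *\<^sub>R \<theta>) < \<infinity>" "exp_int UNIV X0 (s - (a * z) *\<^sub>R \<theta>) < \<infinity>"
    unfolding exp_int_halfspaces[OF \<theta>] p_def p'_def q_def q'_def by (simp_all del: inner_minus_right)
  then have "z \<in> ?I"
    by (auto simp: shift_set_def intro!: exp_int_finite_imp_interior)
  then obtain e where "e > 0" "ball z e \<subseteq> ?I" using opn by (auto simp: open_contains_ball)
  then have "z + e / 2 \<in> ?I" by (auto simp: dist_real_def)
  with z[OF this] \<open>e > 0\<close> show False by simp
qed

lemma shift_set_uminus: "c \<in> shift_set (- \<theta>) X0 X1 s a b \<longleftrightarrow> - c \<in> shift_set \<theta> X0 X1 s a b"
  by (simp add: shift_set_def)

text \<open>Equality of the ratios is stated by cross-multiplication, which keeps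
  \<open>F - G\<close> continuous and free of quotients. The admissible shifts form an interval, and
  \<open>F - G\<close> takes a negative and a positive value on it.\<close>

lemma balanced_shift:
  fixes X0 X1 :: "'m::finite \<Rightarrow> 'a::euclidean_space"
  assumes \<theta>: "\<theta> \<noteq> 0" and ab: "a > 0" "b > 0" and ne: "shift_set \<theta> X0 X1 s a b \<noteq> {}"
  obtains c where "c \<in> shift_set \<theta> X0 X1 s a b"
    "exp_int (halfspace (- \<theta>)) X1 (s + (b * c) *\<^sub>R \<theta>) * exp_int (halfspace \<theta>) X0 (s - (a * c) *\<^sub>R \<theta>)
    = exp_int (halfspace \<theta>) X1 (s + (b * c) *\<^sub>R \<theta>) * exp_int (halfspace (- \<theta>)) X0 (s - (a * c) *\<^sub>R \<theta>)"
proof -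
  let ?I = "shift_set \<theta> X0 X1 s a b"
  define F where "F c = enn2real (exp_int (halfspace (- \<theta>)) X1 (s + (b * c) *\<^sub>R \<theta>))
    * enn2real (exp_int (halfspace \<theta>) X0 (s - (a * c) *\<^sub>R \<theta>))" for c
  define G where "G c = enn2real (exp_int (halfspace \<theta>) X1 (s + (b * c) *\<^sub>R \<theta>))
    * enn2real (exp_int (halfspace (- \<theta>)) X0 (s - (a * c) *\<^sub>R \<theta>))" for c
  have fin: "exp_int S X1 (s + (b * c) *\<^sub>R \<theta>) < \<infinity>" "exp_int S X0 (s - (a * c) *\<^sub>R \<theta>) < \<infinity>" if "c \<in> ?I" for c S
    using that by (auto simp: shift_set_def intro!: exp_int_finite[unfolded infinity_ennreal_def])
  have eF: "exp_int (halfspace (- \<theta>)) X1 (s + (b * c) *\<^sub>R \<theta>) * exp_int (halfspace \<theta>) X0 (s - (a * c) *\<^sub>R \<theta>) = ennreal (F c)"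
    and eG: "exp_int (halfspace \<theta>) X1 (s + (b * c) *\<^sub>R \<theta>) * exp_int (halfspace (- \<theta>)) X0 (s - (a * c) *\<^sub>R \<theta>) = ennreal (G c)"
    if "c \<in> ?I" for c
    using fin[OF that] by (simp_all add: F_def G_def ennreal_mult less_top del: inner_minus_right)
  have nonneg: "F c \<ge> 0" "G c \<ge> 0" for c by (simp_all add: F_def G_def)
  obtain c1 where c1: "c1 \<in> ?I" "F c1 < G c1"
    using shift_blow_up[OF \<theta> ab ne] nonneg by (auto simp: eF eG ennreal_less_iff simp del: inner_minus_right)
  have "shift_set (- \<theta>) X0 X1 s a b \<noteq> {}"
    using ne by (metis ex_in_conv minus_minus shift_set_uminus)
  \<comment> \<open>Reversing \<open>\<theta>\<close> exchanges the half-spaces and the two ends of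
    the interval, which gives the opposite strict inequality.\<close>
  from shift_blow_up[OF _ ab this] \<theta> obtain c where c: "- c \<in> ?I"
      "exp_int (halfspace \<theta>) X1 (s + (b * (- c)) *\<^sub>R \<theta>) * exp_int (halfspace (- \<theta>)) X0 (s - (a * (- c)) *\<^sub>R \<theta>)
      < exp_int (halfspace (- \<theta>)) X1 (s + (b * (- c)) *\<^sub>R \<theta>) * exp_int (halfspace \<theta>) X0 (s - (a * (- c)) *\<^sub>R \<theta>)"
    by (auto simp: shift_set_uminus simp del: inner_minus_right)
  define c2 where "c2 = - c"
  have c2: "c2 \<in> ?I" "G c2 < F c2"
    using c nonneg unfolding c2_def[symmetric] by (auto simp: eF eG ennreal_less_iff simp del: inner_minus_right)
  have contX: "continuous_on ?I (\<lambda>c. enn2real (exp_int (halfspace \<tau>) X1 (s + (b * c) *\<^sub>R \<theta>)))"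
      "continuous_on ?I (\<lambda>c. enn2real (exp_int (halfspace \<tau>) X0 (s - (a * c) *\<^sub>R \<theta>)))" for \<tau>
    by (rule continuous_on_compose2[OF continuous_on_exp_int],
        auto intro!: borel_open open_halfspace continuous_intros simp: shift_set_def simp del: inner_minus_right)+
  have cont: "continuous_on ?I (\<lambda>c. F c - G c)"
    unfolding F_def G_def by (intro continuous_intros contX)
  have con: "connected ((\<lambda>c. F c - G c) ` ?I)"
    by (rule connected_continuous_image[OF cont convex_connected[OF convex_shift_set]])
  have "F c1 - G c1 \<in> (\<lambda>c. F c - G c) ` ?I" "F c2 - G c2 \<in> (\<lambda>c. F c - G c) ` ?I"
    using c1 c2 by auto
  from connectedD_interval[OF con this, of 0] have "0 \<in> (\<lambda>c. F c - G c) ` ?I"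
    using c1(2) c2(2) by simp
  then obtain c where "c \<in> ?I" "F c = G c" by auto
  with that[of c] show thesis by (simp add: eF eG del: inner_minus_right)
qed

text \<open>For each point of the tuple the two sides differ by \<open>u * (1 - u) * \<gamma> i * (w
  \<bullet> \<theta> - w' \<bullet> \<theta>)\<close>, a term of either sign that vanishes at equal
  heights. The maximum over the points does the rest.\<close>

lemma supp_fun_shear_le:
  fixes X0 X1 X :: "'m::finite \<Rightarrow> 'a::euclidean_space"
  assumes u: "0 \<le> u" "u \<le> 1" and X1: "\<And>i. X1 i = X0 i + \<gamma> i *\<^sub>R \<theta>" and X: "\<And>i. X i = X0 i + (u * \<gamma> i) *\<^sub>R \<theta>"
    and eq: "w \<bullet> \<theta> = w' \<bullet> \<theta>"
  shows "supp_fun X ((1 - u) *\<^sub>R w + u *\<^sub>R w') \<le> (1 - u) * supp_fun X0 w + u * supp_fun X1 w'"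
  unfolding supp_fun_le_iff
proof
  fix i
  have "((1 - u) *\<^sub>R w + u *\<^sub>R w') \<bullet> X i = (1 - u) * (w \<bullet> X0 i) + u * (w' \<bullet> X1 i)"
    unfolding X X1 using eq by (simp add: inner_simps algebra_simps)
  also have "\<dots> \<le> (1 - u) * supp_fun X0 w + u * supp_fun X1 w'"
    using u by (intro add_mono mult_left_mono supp_fun_ge) auto
  finally show "((1 - u) *\<^sub>R w + u *\<^sub>R w') \<bullet> X i \<le> (1 - u) * supp_fun X0 w + u * supp_fun X1 w'" .
qed

text \<open>Moving the end points does not disturb the convexity on the slice: at height 1 the
  shifts contribute \<open>(1 - u) * u * c\<close> and \<open>- u * (1 - u) * c\<close>, which
  cancel. Interior points are required to make \<open>g\<close> positive.\<close>

lemma bbl_exp_int_halfspace: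
  fixes X0 X1 X :: "'m::finite \<Rightarrow> 'a::euclidean_space"
  assumes \<theta>: "\<theta> \<noteq> 0" and u: "0 < u" "u < 1"
    and X1: "\<And>i. X1 i = X0 i + \<gamma> i *\<^sub>R \<theta>" and X: "\<And>i. X i = X0 i + (u * \<gamma> i) *\<^sub>R \<theta>"
    and s: "s \<in> interior (convex hull range X)" and s0: "s - (u * c) *\<^sub>R \<theta> \<in> interior (convex hull range X0)"
    and s1: "s + ((1 - u) * c) *\<^sub>R \<theta> \<in> interior (convex hull range X1)"
  shows "bbl u 1 (exp_int (halfspace \<theta>) X0 (s - (u * c) *\<^sub>R \<theta>)) (exp_int (halfspace \<theta>) X1 (s + ((1 - u) * c) *\<^sub>R \<theta>))
     (exp_int (halfspace \<theta>) X s)"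
proof -
  define g where "g Y y w = supp_fun Y w - w \<bullet> y" for Y :: "'m \<Rightarrow> 'a" and y w
  have e: "exp_int S Y y = (\<integral>\<^sup>+w. indicator S w * ennreal (exp (- g Y y w)) \<partial>lborel)" for S Y y
    by (simp add: exp_int_def g_def)
  have meas: "g Y y \<in> borel_measurable borel" for Y y unfolding g_def[abs_def] by measurable
  have hom: "g Y y (k *\<^sub>R w) = k * g Y y w" if "k > 0" for Y y k w
    using that by (simp add: g_def supp_fun_scale algebra_simps)
  have pos: "g Y y w > 0" if "y \<in> interior (convex hull range Y)" "w \<bullet> \<theta> > 0" for Y y w
  proof -
    have "w \<noteq> 0" using that(2) by auto
    with that(1) show ?thesis unfolding interior_convex_hull_range_iff g_def by simp
  qed
  show ?thesis
    unfolding e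
  proof (rule bbl_halfspace[OF \<theta> u meas meas meas hom hom hom pos[OF s0] pos[OF s1] pos[OF s]])
    fix w w' assume w: "w \<bullet> \<theta> = 1" "w' \<bullet> \<theta> = 1"
    show "g X s ((1 - u) *\<^sub>R w + u *\<^sub>R w') \<le> (1 - u) * g X0 (s - (u * c) *\<^sub>R \<theta>) w + u * g X1 (s + ((1 - u) * c) *\<^sub>R \<theta>) w'"
      using supp_fun_shear_le[of u X1 X0 \<gamma> \<theta> X w w'] u X1 X w
      by (simp add: g_def inner_simps algebra_simps)
  qed auto
qed

lemma bbl_min_exp_int:
  fixes X0 X1 X :: "'m::finite \<Rightarrow> 'a::euclidean_space"
  assumes \<theta>: "\<theta> \<noteq> 0" and u: "0 < u" "u < 1"
    and X1: "\<And>i. X1 i = X0 i + \<gamma> i *\<^sub>R \<theta>" and X: "\<And>i. X i = X0 i + (u * \<gamma> i) *\<^sub>R \<theta>"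
    and ne: "interior (convex hull range X) \<noteq> {}" and ne0: "interior (convex hull range X0) \<noteq> {}"
    and ne1: "interior (convex hull range X1) \<noteq> {}"
  shows "bbl u 1 (min_exp_int X0) (min_exp_int X1) (min_exp_int X)"
proof -
  obtain s where s: "s \<in> interior (convex hull range X)" "exp_int UNIV X s = min_exp_int X"
    using min_exp_int_attained[OF ne] by blast
  obtain \<mu> where \<mu>: "\<And>i. \<mu> i > 0" "(\<Sum>i\<in>UNIV. \<mu> i) = 1" "s = (\<Sum>i\<in>UNIV. \<mu> i *\<^sub>R X i)"
    by (rule interior_convex_hull_range_positive[OF s(1)]) blast
  \<comment> \<open>The weights \<open>\<mu>\<close> applied to the end tuples give interior points
    again. These differ by \<open>c0 *\<^sub>R \<theta>\<close> and have \<open>s\<close> between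
    them in the right proportion, so \<open>c0\<close> is an admissible shift.\<close>
  define c0 where "c0 = (\<Sum>i\<in>UNIV. \<mu> i * \<gamma> i)"
  have sX: "s = (\<Sum>i\<in>UNIV. \<mu> i *\<^sub>R X0 i) + (u * c0) *\<^sub>R \<theta>"
    unfolding \<mu>(3) X c0_def
    by (simp add: scaleR_add_right sum.distrib sum_distrib_left scaleR_sum_left ac_simps)
  have "s - (u * c0) *\<^sub>R \<theta> = (\<Sum>i\<in>UNIV. \<mu> i *\<^sub>R X0 i)" by (simp add: sX)
  moreover have "s + ((1 - u) * c0) *\<^sub>R \<theta> = (\<Sum>i\<in>UNIV. \<mu> i *\<^sub>R X1 i)"
  proof -
    have "(\<Sum>i\<in>UNIV. \<mu> i *\<^sub>R X1 i) = (\<Sum>i\<in>UNIV. \<mu> i *\<^sub>R X0 i) + c0 *\<^sub>R \<theta>"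
      unfolding X1 c0_def by (simp add: scaleR_add_right sum.distrib scaleR_sum_left)
    then show ?thesis by (simp add: sX algebra_simps)
  qed
  ultimately have "c0 \<in> shift_set \<theta> X0 X1 s u (1 - u)"
    using positive_combination_in_interior[OF ne0 \<mu>(1,2)] positive_combination_in_interior[OF ne1 \<mu>(1,2)]
    by (simp add: shift_set_def)
  then have "shift_set \<theta> X0 X1 s u (1 - u) \<noteq> {}" by blast
  moreover have "1 - u > 0" using u by simp
  ultimately obtain c where c: "c \<in> shift_set \<theta> X0 X1 s u (1 - u)"
    and bal: "exp_int (halfspace (- \<theta>)) X1 (s + ((1 - u) * c) *\<^sub>R \<theta>) * exp_int (halfspace \<theta>) X0 (s - (u * c) *\<^sub>R \<theta>)
    = exp_int (halfspace \<theta>) X1 (s + ((1 - u) * c) *\<^sub>R \<theta>) * exp_int (halfspace (- \<theta>)) X0 (s - (u * c) *\<^sub>R \<theta>)"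
    using balanced_shift[OF \<theta> u(1)] by metis
  define s0 where "s0 = s - (u * c) *\<^sub>R \<theta>"
  define s1 where "s1 = s + ((1 - u) * c) *\<^sub>R \<theta>"
  have s01: "s0 \<in> interior (convex hull range X0)" "s1 \<in> interior (convex hull range X1)"
    using c by (simp_all add: shift_set_def s0_def s1_def)
  have bbl: "bbl u 1 (exp_int (halfspace \<theta>) X0 s0) (exp_int (halfspace \<theta>) X1 s1) (exp_int (halfspace \<theta>) X s)"
    unfolding s0_def s1_def
    by (rule bbl_exp_int_halfspace[OF \<theta> u X1 X s(1)]) (use s01 in \<open>simp_all add: s0_def s1_def\<close>)
  \<comment> \<open>Changing the signs of \<open>\<theta>\<close>, \<open>\<gamma>\<close> and
    \<open>c\<close> together leaves the tuples and the points \<open>s0\<close>, \<open>s1\<close>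
    unchanged and selects the other half-space.\<close>
  have bbl': "bbl u 1 (exp_int (halfspace (- \<theta>)) X0 s0) (exp_int (halfspace (- \<theta>)) X1 s1) (exp_int (halfspace (- \<theta>)) X s)"
    using bbl_exp_int_halfspace[of "- \<theta>" u X1 X0 "\<lambda>i. - \<gamma> i" X s "- c"] \<theta> u X1 X s(1) s01
    by (simp add: s0_def s1_def del: inner_minus_right)
  have pos: "exp_int (halfspace \<tau>) Y y > 0" if "\<tau> \<noteq> 0" for \<tau> y :: 'a and Y :: "'m \<Rightarrow> 'a"
    using that by (intro exp_int_pos open_halfspace nonempty_halfspace)
  obtain p0 where p0: "exp_int (halfspace \<theta>) X0 s0 = ennreal p0" "p0 > 0"
    using exp_int_finite[OF s01(1), of "halfspace \<theta>"] pos[OF \<theta>, of X0 s0]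
    by (cases "exp_int (halfspace \<theta>) X0 s0") auto
  obtain p1 where p1: "exp_int (halfspace \<theta>) X1 s1 = ennreal p1" "p1 > 0"
    using exp_int_finite[OF s01(2), of "halfspace \<theta>"] pos[OF \<theta>, of X1 s1]
    by (cases "exp_int (halfspace \<theta>) X1 s1") auto
  have \<theta>': "- \<theta> \<noteq> 0" using \<theta> by simp
  obtain q0 where q0: "exp_int (halfspace (- \<theta>)) X0 s0 = ennreal q0" "q0 > 0"
    using exp_int_finite[OF s01(1), of "halfspace (- \<theta>)"] pos[OF \<theta>', of X0 s0]
    by (cases "exp_int (halfspace (- \<theta>)) X0 s0") auto
  obtain q1 where q1: "exp_int (halfspace (- \<theta>)) X1 s1 = ennreal q1" "q1 > 0"
    using exp_int_finite[OF s01(2), of "halfspace (- \<theta>)"] pos[OF \<theta>', of X1 s1]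
    by (cases "exp_int (halfspace (- \<theta>)) X1 s1") auto
  have bal': "q1 * p0 = p1 * q0"
    using bal unfolding s0_def[symmetric] s1_def[symmetric] p0 p1 q0 q1
    using p0(2) p1(2) q0(2) q1(2) by (simp flip: ennreal_mult')
  show ?thesis
    unfolding bbl_def
  proof (intro allI impI)
    fix a b :: real assume ab: "0 < a" "0 < b"
    define d where "d = (1 - u) * a + u * b"
    have "min (ennreal a * min_exp_int X0) (ennreal b * min_exp_int X1)
      \<le> min (ennreal a * exp_int UNIV X0 s0) (ennreal b * exp_int UNIV X1 s1)"
      by (intro min.mono mult_left_mono min_exp_int_le) auto
    also have "\<dots> = ennreal (min (a * (p0 + q0)) (b * (p1 + q1)))"
      unfolding exp_int_halfspaces[OF \<theta>] p0 p1 q0 q1 using p0(2) p1(2) q0(2) q1(2) ab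
      by (simp add: min_def ennreal_le_iff flip: ennreal_plus ennreal_mult')
    also have "min (a * (p0 + q0)) (b * (p1 + q1)) = min (a * p0) (b * p1) + min (a * q0) (b * q1)"
    proof -
      \<comment> \<open>By the balance \<open>(p1, q1)\<close> is \<open>k\<close> times
        \<open>(p0, q0)\<close>, so the same side attains the minimum in both halves and the minima
        add.\<close>
      define k where "k = p1 / p0"
      have k: "k > 0" "p1 = k * p0" "q1 = k * q0"
        using p0(2) p1(2) bal' by (simp_all add: k_def field_simps)
      have m: "min (a * x) (b * (k * x)) = min a (b * k) * x" if "x > 0" for x
        using that by (simp add: min_def mult.assoc[symmetric])
      show ?thesis
        using m[of "p0 + q0"] m[of p0] m[of q0] p0(2) q0(2) k by (simp add: algebra_simps)
    qed
    also have "ennreal \<dots> = min (ennreal a * ennreal p0) (ennreal b * ennreal p1) + min (ennreal a * ennreal q0) (ennreal b * ennreal q1)"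
      using p0(2) p1(2) q0(2) q1(2) ab
      by (simp add: min_def ennreal_le_iff flip: ennreal_plus ennreal_mult')
    also have "\<dots> \<le> ennreal d * exp_int (halfspace \<theta>) X s + ennreal d * exp_int (halfspace (- \<theta>)) X s"
      using bbl bbl' ab unfolding p0 p1 q0 q1 bbl_def d_def by (intro add_mono) auto
    also have "\<dots> = ennreal d * min_exp_int X"
      unfolding s(2)[symmetric] exp_int_halfspaces[OF \<theta>] by (simp add: distrib_left)
    finally show "min (ennreal (a ^ 1) * min_exp_int X0) (ennreal (b ^ 1) * min_exp_int X1)
      \<le> ennreal (((1 - u) * a + u * b) ^ 1) * min_exp_int X"
      by (simp add: d_def)
  qed
qed

lemma min_exp_int_pos:
  fixes X :: "'m::finite \<Rightarrow> 'a::euclidean_space"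
  assumes ne: "interior (convex hull range X) \<noteq> {}"
  obtains c where "c > 0" "min_exp_int X = ennreal c"
proof -
  obtain s where "s \<in> interior (convex hull range X)" "exp_int UNIV X s = min_exp_int X" "exp_int UNIV X s < \<infinity>"
    by (rule min_exp_int_attained[OF ne])
  moreover have "exp_int UNIV X s > 0" by (rule exp_int_pos) auto
  ultimately show thesis using that by (cases "min_exp_int X") auto
qed

text \<open>The theorem of Meyer and Reisner, for polytopes.\<close>

lemma min_exp_int_inverse_convex:
  fixes X0 X1 X :: "'m::finite \<Rightarrow> 'a::euclidean_space"
  assumes \<theta>: "\<theta> \<noteq> 0" and u: "0 < u" "u < 1"
    and X1: "\<And>i. X1 i = X0 i + \<gamma> i *\<^sub>R \<theta>" and X: "\<And>i. X i = X0 i + (u * \<gamma> i) *\<^sub>R \<theta>"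
    and ne: "interior (convex hull range X) \<noteq> {}" and ne0: "interior (convex hull range X0) \<noteq> {}"
    and ne1: "interior (convex hull range X1) \<noteq> {}"
  shows "1 / enn2real (min_exp_int X) \<le> (1 - u) * (1 / enn2real (min_exp_int X0)) + u * (1 / enn2real (min_exp_int X1))"
proof -
  obtain c where c: "c > 0" "min_exp_int X = ennreal c" by (rule min_exp_int_pos[OF ne])
  obtain c0 where c0: "c0 > 0" "min_exp_int X0 = ennreal c0" by (rule min_exp_int_pos[OF ne0])
  obtain c1 where c1: "c1 > 0" "min_exp_int X1 = ennreal c1" by (rule min_exp_int_pos[OF ne1])
  define d where "d = (1 - u) * (1 / c0) + u * (1 / c1)"
  \<comment> \<open>The choice \<open>a = 1 / c0\<close>, \<open>b = 1 / c1\<close> makes both terms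
    of the minimum equal to 1.\<close>
  have "min (ennreal ((1 / c0) ^ 1) * ennreal c0) (ennreal ((1 / c1) ^ 1) * ennreal c1) \<le> ennreal (d ^ 1) * ennreal c"
    using bbl_min_exp_int[OF assms] c0(1) c1(1) unfolding bbl_def c c0 c1 d_def
    by (metis zero_less_divide_1_iff)
  moreover have "ennreal (1 / c0) * ennreal c0 = 1" "ennreal (1 / c1) * ennreal c1 = 1"
    using c0 c1 by (simp_all flip: ennreal_mult')
  ultimately have "1 \<le> ennreal d * ennreal c" by simp
  then have "1 \<le> ennreal (d * c)" using c(1) by (simp add: ennreal_mult'')
  then have "1 / c \<le> d" using c by (simp add: divide_le_eq)
  then show ?thesis using c c0 c1 by (simp add: d_def)
qed

subsection \<open>Volumes of Santalo polars\<close>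

text \<open>With the value infinity, \<open>enn2real\<close> gives 0 and
  \<open>0 powr (- r) = 0\<close>, so degenerate tuples drop out of the integrals by
  themselves.\<close>

lemma min_exp_int_degenerate:
  assumes "interior (convex hull range X) = {}"
  shows "min_exp_int X = \<infinity>"
proof -
  have "exp_int UNIV X s = \<infinity>" for s
    using exp_int_finite_imp_interior[of X s] assms by (auto simp: less_top[symmetric])
  then show ?thesis by (simp add: min_exp_int_def)
qed

text \<open>Prepares measurability in the tuple, for which the infimum has to be countable. The
  minimizer is interior and the integral is continuous there, so nearby points of \<open>D\<close>
  come arbitrarily close to the minimum.\<close>

lemma min_exp_int_dense:
  fixes X :: "'m::finite \<Rightarrow> 'a::euclidean_space" and D :: "'a set"
  assumes D: "\<And>U. open U \<Longrightarrow> U \<noteq> {} \<Longrightarrow> \<exists>d\<in>D. d \<in> U"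
  shows "min_exp_int X = (INF s\<in>D. exp_int UNIV X s)"
proof (rule antisym)
  show "min_exp_int X \<le> (INF s\<in>D. exp_int UNIV X s)"
    by (intro INF_greatest min_exp_int_le)
  show "(INF s\<in>D. exp_int UNIV X s) \<le> min_exp_int X"
  proof (cases "interior (convex hull range X) = {}")
    case False
    let ?I = "interior (convex hull range X)"
    obtain s where s: "s \<in> ?I" "exp_int UNIV X s = min_exp_int X" "exp_int UNIV X s < \<infinity>"
      by (rule min_exp_int_attained[OF False])
    show ?thesis
    proof (rule ccontr)
      assume "\<not> ?thesis"
      then have lt: "exp_int UNIV X s < (INF s\<in>D. exp_int UNIV X s)" using s(2) by simp
      then obtain c where c: "exp_int UNIV X s < c" "c < (INF s\<in>D. exp_int UNIV X s)" using dense by blast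
      then obtain r where r: "c = ennreal r" "r \<ge> 0" by (cases c) auto
      define U where "U = ?I \<inter> (\<lambda>s. enn2real (exp_int UNIV X s)) -` {..<r}"
      have e: "exp_int UNIV X y = ennreal (enn2real (exp_int UNIV X y))" if "y \<in> ?I" for y
        using exp_int_finite[OF that, of UNIV] by simp
      have "enn2real (exp_int UNIV X s) < r"
        using c(1) r e[OF s(1)] by (metis enn2real_nonneg ennreal_less_iff)
      then have "s \<in> U" using s(1) by (simp add: U_def)
      moreover have "open U" unfolding U_def
        by (intro continuous_open_preimage continuous_on_exp_int) auto
      ultimately obtain d where d: "d \<in> D" "d \<in> U" using D by blast
      have "exp_int UNIV X d < ennreal r"
        using d(2) e[of d] by (metis IntD1 IntD2 U_def enn2real_nonneg ennreal_less_iff lessThan_iff vimage_eq)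
      moreover have "(INF s\<in>D. exp_int UNIV X s) \<le> exp_int UNIV X d" using d(1) by (rule INF_lower)
      ultimately show False using c(2) r by auto
    qed
  qed (simp add: min_exp_int_degenerate)
qed

lemma borel_measurable_min_exp_int:
  "(min_exp_int :: ('m::finite \<Rightarrow> 'a::euclidean_space) \<Rightarrow> ennreal)
    \<in> borel_measurable (Pi\<^sub>M UNIV (\<lambda>_. lborel))"
proof -
  obtain D :: "'a set" where D: "countable D" "\<And>U. open U \<Longrightarrow> U \<noteq> {} \<Longrightarrow> \<exists>d\<in>D. d \<in> U"
    by (rule countable_dense_setE) blast
  have "(\<lambda>X :: 'm \<Rightarrow> 'a. exp_int UNIV X s) \<in> borel_measurable (Pi\<^sub>M UNIV (\<lambda>_. lborel))" for s
    unfolding exp_int_def supp_fun_def by measurable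
  then have "(\<lambda>X :: 'm \<Rightarrow> 'a. INF s\<in>D. exp_int UNIV X s) \<in> borel_measurable (Pi\<^sub>M UNIV (\<lambda>_. lborel))"
    by (intro borel_measurable_INF D(1))
  moreover have "min_exp_int = (\<lambda>X :: 'm \<Rightarrow> 'a. INF s\<in>D. exp_int UNIV X s)"
    by (intro ext min_exp_int_dense D(2))
  ultimately show ?thesis by simp
qed

text \<open>Keeps the negative power in the integrand bounded. The minimizer lies in the ball of
  radius \<open>R\<close> like the points of the tuple, so for \<open>norm w < 1\<close> the
  exponent is at least \<open>- 2 * R\<close>, uniformly in the tuple.\<close>

lemma min_exp_int_lower_bound:
  fixes R :: real
  assumes "R \<ge> 0"
  obtains c where "c > 0" "\<And>X :: 'm::finite \<Rightarrow> 'a::euclidean_space. (\<And>i. norm (X i) \<le> R) \<Longrightarrow> ennreal c \<le> min_exp_int X"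
proof -
  define c where "c = exp (- 2 * R) * measure lborel (ball (0::'a) 1)"
  have "c > 0" by (simp add: c_def content_ball_pos)
  moreover have "ennreal c \<le> min_exp_int X" if X: "\<And>i. norm (X i) \<le> R" for X :: "'m \<Rightarrow> 'a"
  proof (cases "interior (convex hull range X) = {}")
    case False
    obtain s where s: "s \<in> interior (convex hull range X)" "exp_int UNIV X s = min_exp_int X" "exp_int UNIV X s < \<infinity>"
      by (rule min_exp_int_attained[OF False])
    have "convex hull range X \<subseteq> cball 0 R" using X by (intro hull_minimal convex_cball) auto
    with s(1) have sR: "norm s \<le> R" using interior_subset by force
    have "ennreal c = ennreal (exp (- 2 * R)) * emeasure lborel (ball (0::'a) 1)"
      using emeasure_bounded_finite[of "ball (0::'a) 1"]
      by (simp add: c_def ennreal_mult emeasure_eq_ennreal_measure less_top[symmetric])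
    also have "\<dots> = (\<integral>\<^sup>+w. ennreal (exp (- 2 * R)) * indicator (ball (0::'a) 1) w \<partial>lborel)"
      by (subst nn_integral_cmult) (auto intro!: borel_measurable_indicator borel_open)
    also have "\<dots> \<le> exp_int UNIV X s"
      unfolding exp_int_def
    proof (rule nn_integral_mono)
      fix w :: 'a
      have "- 2 * R \<le> w \<bullet> s - supp_fun X w" if "norm w < 1"
      proof -
        have *: "\<bar>w \<bullet> y\<bar> \<le> R" if "norm y \<le> R" for y
        proof -
          have "\<bar>w \<bullet> y\<bar> \<le> norm w * norm y" by (rule Cauchy_Schwarz_ineq2)
          also have "\<dots> \<le> 1 * R" using that \<open>norm w < 1\<close> assms by (intro mult_mono) auto
          finally show ?thesis by simp
        qed
        obtain i where "supp_fun X w = w \<bullet> X i" using supp_fun_attained by blast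
        with *[OF sR] *[OF X[of i]] show ?thesis by linarith
      qed
      then show "ennreal (exp (- 2 * R)) * indicator (ball 0 1) w \<le> indicator UNIV w * ennreal (exp (w \<bullet> s - supp_fun X w))"
        by (auto split: split_indicator intro!: ennreal_leI)
    qed
    finally show ?thesis using s(2) by simp
  qed (simp add: min_exp_int_degenerate)
  ultimately show thesis using that by blast
qed

lemma lin_image_simplex:
  fixes X :: "'m::finite \<Rightarrow> real^'n"
  shows "lin_image X simplex_C = convex hull range X"
proof -
  have lin: "linear (\<lambda>c :: real^'m. \<Sum>i\<in>UNIV. (c $ i) *\<^sub>R X i)"
    by (intro linearI) (simp_all add: scaleR_add_left sum.distrib scaleR_sum_right)
  have "(\<Sum>i\<in>UNIV. (axis j 1 $ i) *\<^sub>R X i) = X j" for j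
    by (simp add: axis_def if_distrib[of "\<lambda>c. c *\<^sub>R _"] cong: if_cong)
  then show ?thesis
    unfolding lin_image_def simplex_C_def convex_hull_linear_image[OF lin] image_image by simp
qed

lemma measure_polar_translate:
  fixes X :: "'m::finite \<Rightarrow> real^'n"
  assumes "s \<in> interior (convex hull range X)"
  shows "measure lborel (polar ((\<lambda>y. y - s) ` (convex hull range X))) = enn2real (exp_int UNIV X s) / fact CARD('n)"
proof -
  have "polar ((\<lambda>y. y - s) ` (convex hull range X)) = {w. \<forall>y\<in>convex hull range X. w \<bullet> y \<le> 1 + w \<bullet> s}"
    by (auto simp: polar_def inner_diff_right algebra_simps)
  also have "\<dots> = {w. supp_fun X w - w \<bullet> s \<le> 1}"
    unfolding convex_hull_le_supp_fun_iff by (auto simp: algebra_simps)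
  finally show ?thesis
    unfolding exp_int_UNIV_eq_fact_emeasure[OF assms] by (simp add: enn2real_mult measure_def)
qed

text \<open>The definite description in \<open>santalo_point\<close> is resolved by uniqueness of
  the minimizer. On the interior, comparing polar volumes is the same as comparing the integrals, by
  the common factor \<open>n!\<close>.\<close>

lemma measure_santalo_polar:
  fixes X :: "'m::finite \<Rightarrow> real^'n"
  assumes ne: "interior (convex hull range X) \<noteq> {}"
  shows "measure lborel (santalo_polar (lin_image X simplex_C)) = enn2real (min_exp_int X) / fact CARD('n)"
proof -
  let ?C = "convex hull range X"
  let ?f = "\<lambda>x. measure lborel (polar ((\<lambda>y. y - x) ` ?C))"
  obtain s where s: "s \<in> interior ?C" "exp_int UNIV X s = min_exp_int X" "exp_int UNIV X s < \<infinity>"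
    by (rule min_exp_int_attained[OF ne])
  have f: "?f x \<le> ?f y \<longleftrightarrow> exp_int UNIV X x \<le> exp_int UNIV X y" if "x \<in> interior ?C" "y \<in> interior ?C" for x y
    using exp_int_finite[OF that(1), of UNIV] exp_int_finite[OF that(2), of UNIV]
    by (cases "exp_int UNIV X x"; cases "exp_int UNIV X y")
       (auto simp: measure_polar_translate that divide_le_cancel ennreal_le_iff)
  have "santalo_point ?C = s" unfolding santalo_point_def
  proof (rule the_equality)
    show "is_arg_min ?f (\<lambda>x. x \<in> interior ?C) s"
      using s f min_exp_int_le[of X] unfolding is_arg_min_linorder by auto
    fix x assume "is_arg_min ?f (\<lambda>x. x \<in> interior ?C) x"
    then have x: "x \<in> interior ?C" "?f x \<le> ?f s" unfolding is_arg_min_linorder using s(1) by auto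
    then have "exp_int UNIV X x = min_exp_int X" using f[OF x(1) s(1)] s(2) min_exp_int_le[of X x] by simp
    then show "x = s" using s(2,3) by (intro min_exp_int_unique) auto
  qed
  then show ?thesis
    unfolding santalo_polar_def lin_image_simplex using measure_polar_translate[OF s(1)] s(2) by simp
qed

subsection \<open>Almost sure nondegeneracy and measure-preserving shears\<close>

lemma null_set_linear_zero:
  fixes f :: "'a::euclidean_space \<Rightarrow> real"
  assumes f: "linear f" and z: "f z \<noteq> 0"
  shows "{y. f (y - x) = 0} \<in> null_sets lborel"
proof -
  define v where "v = (\<Sum>b\<in>Basis. f b *\<^sub>R b)"
  have v: "f y = v \<bullet> y" for y
  proof -
    have "f y = f (\<Sum>b\<in>Basis. (y \<bullet> b) *\<^sub>R b)" by (simp add: euclidean_representation)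
    also have "\<dots> = v \<bullet> y"
      using f by (simp add: linear_sum linear_scale v_def inner_sum_left inner_commute[of y] mult.commute)
    finally show ?thesis .
  qed
  have "v \<noteq> 0" using z v by auto
  then have "negligible {y. v \<bullet> y = v \<bullet> x}" by (intro negligible_hyperplane) auto
  moreover have "{y. f (y - x) = 0} = {y. v \<bullet> y = v \<bullet> x}" by (simp add: v inner_diff_right)
  ultimately show ?thesis by (simp add: negligible_iff_null_sets null_sets_completion_iff)
qed

lemma linear_det_row: "linear (\<lambda>z. det (\<chi> j. if j = i then z else c j) :: real)"
  for c :: "'n::finite \<Rightarrow> real^'n"
proof (rule linearI)
  fix x y :: "real^'n" and r :: real
  show "det (\<chi> j. if j = i then x + y else c j) = det (\<chi> j. if j = i then x else c j) + det (\<chi> j. if j = i then y else c j)"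
    by (rule det_row_add)
  show "det (\<chi> j. if j = i then r *\<^sub>R x else c j) = r *\<^sub>R det (\<chi> j. if j = i then x else c j)"
  proof -
    have "r *s x = r *\<^sub>R x" by (simp add: vec_eq_iff)
    show ?thesis using det_row_mul[of i r "\<lambda>_. x" c] unfolding \<open>r *s x = r *\<^sub>R x\<close> by simp
  qed
qed

text \<open>Replacing the rows of the identity matrix one at a time by \<open>X (\<sigma> j) - X i0\<close> keeps the
  determinant nonzero almost surely.\<close>

lemma AE_det_nonzero:
  fixes \<sigma> :: "'n::finite \<Rightarrow> 'm::finite" and S :: "'n set"
  assumes \<sigma>: "inj \<sigma>" "i0 \<notin> range \<sigma>"
  shows "AE X in Pi\<^sub>M UNIV (\<lambda>_::'m. lborel :: (real^'n) measure).
    det (\<chi> j. if j \<in> S then X (\<sigma> j) - X i0 else axis j 1) \<noteq> 0"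
proof -
  let ?P = "Pi\<^sub>M UNIV (\<lambda>_::'m. lborel :: (real^'n) measure)"
  define d where "d S X = det (\<chi> j. if j \<in> S then X (\<sigma> j) - X i0 else axis j 1)" for S and X :: "'m \<Rightarrow> real^'n"
  have [measurable]: "(\<lambda>X. (if j \<in> S then X (\<sigma> j) - X i0 else axis j 1) $ k) \<in> borel_measurable ?P" for j k S
  proof -
    have "(\<lambda>X. if j \<in> S then X (\<sigma> j) - X i0 else axis j 1) \<in> borel_measurable ?P"
      by (cases "j \<in> S") simp_all
    from measurable_compose[OF this borel_measurable_nth] show ?thesis .
  qed
  have [measurable]: "d S \<in> borel_measurable ?P" for S
    unfolding d_def[abs_def] det_def vec_lambda_beta by measurable
  have "finite S" by simp
  then have "AE X in ?P. d S X \<noteq> 0"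
  proof (induction S rule: finite_induct)
    case empty
    have "d {} X = 1" for X
    proof -
      have "(\<chi> j. axis j 1) = (mat 1 :: real^'n^'n)" by (vector mat_def axis_def)
      then show ?thesis by (simp add: d_def det_I)
    qed
    then show ?case by simp
  next
    case (insert i S)
    \<comment> \<open>These are the tuples that lose a nonzero determinant when row \<open>i\<close>
      is replaced. With the other points fixed, the new determinant is linear in
      \<open>y - X i0\<close>, and the linear form is nonzero because its value at
      \<open>axis i 1\<close> is the old determinant; its zero set is a hyperplane.\<close>
    define Z where "Z = {X \<in> space ?P. d S X \<noteq> 0 \<and> d (insert i S) X = 0}"
    have Z[measurable]: "Z \<in> sets ?P" unfolding Z_def by measurable
    let ?I = "UNIV - {\<sigma> i}"
    have ins: "insert (\<sigma> i) ?I = UNIV" by auto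
    have "emeasure ?P Z = (\<integral>\<^sup>+X. indicator Z X \<partial>Pi\<^sub>M (insert (\<sigma> i) ?I) (\<lambda>_::'m. lborel))"
      by (simp add: ins)
    also have "\<dots> = (\<integral>\<^sup>+X. (\<integral>\<^sup>+y. indicator Z (X(\<sigma> i := y)) \<partial>lborel) \<partial>Pi\<^sub>M ?I (\<lambda>_::'m. lborel))"
      by (rule lborelP.product_nn_integral_insert) (simp_all add: ins)
    also have "\<dots> = (\<integral>\<^sup>+X. 0 \<partial>Pi\<^sub>M ?I (\<lambda>_::'m. lborel :: (real^'n) measure))"
    proof (rule nn_integral_cong)
      fix X :: "'m \<Rightarrow> real^'n"
      define c where "c j = (if j \<in> S then X (\<sigma> j) - X i0 else axis j 1)" for j
      define f where "f z = det (\<chi> j. if j = i then z else c j)" for z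
      have ne: "\<sigma> j \<noteq> \<sigma> i" if "j \<in> S" for j using that insert.hyps \<sigma>(1) by (auto dest: injD)
      have ne0: "i0 \<noteq> \<sigma> i" using \<sigma>(2) by auto
      have 1: "d S (X(\<sigma> i := y)) = f (axis i 1)" for y
        unfolding d_def f_def c_def using insert.hyps ne ne0
        by (intro arg_cong[of _ _ det]) (auto simp: vec_eq_iff)
      have 2: "d (insert i S) (X(\<sigma> i := y)) = f (y - X i0)" for y
        unfolding d_def f_def c_def using insert.hyps ne ne0
        by (intro arg_cong[of _ _ det]) (auto simp: vec_eq_iff)
      show "(\<integral>\<^sup>+y. indicator Z (X(\<sigma> i := y)) \<partial>lborel) = 0"
      proof (cases "f (axis i 1) = 0")
        case True
        then show ?thesis by (simp add: Z_def 1)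
      next
        case False
        have "{y. f (y - X i0) = 0} \<in> null_sets lborel"
          using linear_det_row False unfolding f_def by (rule null_set_linear_zero)
        then have "AE y in lborel. f (y - X i0) \<noteq> 0" by (auto dest!: AE_not_in)
        then have "AE y in lborel. indicator Z (X(\<sigma> i := y)) = (0::ennreal)"
          by eventually_elim (simp add: Z_def 2)
        then have "(\<integral>\<^sup>+y. indicator Z (X(\<sigma> i := y)) \<partial>lborel) = (\<integral>\<^sup>+(y::real^'n). 0 \<partial>lborel)"
          by (rule nn_integral_cong_AE)
        then show ?thesis by simp
      qed
    qed
    finally have "Z \<in> null_sets ?P" by (simp add: null_sets_def Z)
    then have "AE X in ?P. X \<notin> Z" by (rule AE_not_in)
    with insert.IH show ?case
      by eventually_elim (simp add: Z_def space_PiM)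
  qed
  then show ?thesis by (simp add: d_def)
qed

text \<open>One point serves as origin and \<open>n\<close> others, picked by an injection, give
  edge vectors; this needs \<open>n + 1\<close> points. If the hull lay in a hyperplane, its normal
  would be in the kernel of the edge matrix, which is almost surely invertible.\<close>

lemma AE_interior_convex_hull_range:
  assumes card: "CARD('m::finite) \<ge> CARD('n) + 1"
  shows "AE X in Pi\<^sub>M UNIV (\<lambda>_::'m. lborel :: (real^'n) measure). interior (convex hull range X) \<noteq> {}"
proof -
  obtain i0 :: 'm where True by simp
  have "card (UNIV :: 'n set) \<le> card (UNIV - {i0})" using card by simp
  then obtain \<sigma> :: "'n \<Rightarrow> 'm" where \<sigma>: "\<sigma> ` UNIV \<subseteq> UNIV - {i0}" "inj \<sigma>"
    using card_le_inj[of "UNIV :: 'n set" "UNIV - {i0}"] by auto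
  then have i0: "i0 \<notin> range \<sigma>" by auto
  show ?thesis
    using AE_det_nonzero[OF \<sigma>(2) i0, of UNIV]
  proof eventually_elim
    case (elim X)
    show ?case
    proof
      assume "interior (convex hull range X) = {}"
      then obtain a b where ab: "a \<noteq> 0" "convex hull range X \<subseteq> {x. a \<bullet> x = b}"
        using empty_interior_subset_hyperplane[of "convex hull range X"] by auto
      then have X: "a \<bullet> X i = b" for i by (meson hull_inc mem_Collect_eq rangeI subsetD)
      let ?A = "\<chi> j. X (\<sigma> j) - X i0"
      have "?A *v a = 0"
        by (simp add: vec_eq_iff matrix_vector_mul_component inner_commute[of _ a] inner_diff_right X)
      moreover have "invertible ?A" using elim by (simp add: invertible_det_nz)
      ultimately have "a = 0"
        by (metis invertible_def matrix_vector_mul_assoc matrix_vector_mul_lid matrix_vector_mult_0_right)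
      with ab show False by simp
    qed
  qed
qed

lemma distr_lborel_shear:
  fixes \<phi> :: "'a::euclidean_space \<Rightarrow> real"
  assumes [measurable]: "\<phi> \<in> borel_measurable borel" and "\<And>x s. \<phi> (x + s *\<^sub>R e) = \<phi> x"
  shows "distr lborel lborel (\<lambda>x. x + \<phi> x *\<^sub>R e) = lborel"
proof (rule measure_eqI)
  fix A :: "'a set" assume "A \<in> sets (distr lborel lborel (\<lambda>x. x + \<phi> x *\<^sub>R e))"
  then have A[measurable]: "A \<in> sets borel" by simp
  have "emeasure (distr lborel lborel (\<lambda>x. x + \<phi> x *\<^sub>R e)) A = (\<integral>\<^sup>+x. indicator A x \<partial>distr lborel lborel (\<lambda>x. x + \<phi> x *\<^sub>R e))"
    by (rule nn_integral_indicator[symmetric]) simp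
  also have "\<dots> = (\<integral>\<^sup>+x. indicator A (x + \<phi> x *\<^sub>R e) \<partial>lborel)" by (rule nn_integral_distr) measurable
  also have "\<dots> = (\<integral>\<^sup>+x. indicator A x \<partial>lborel)" by (rule nn_integral_shear) (use assms in measurable)
  finally show "emeasure (distr lborel lborel (\<lambda>x. x + \<phi> x *\<^sub>R e)) A = emeasure lborel A" by simp
qed simp

lemma distr_PiM_componentwise:
  fixes T :: "'a::euclidean_space \<Rightarrow> 'a"
  assumes T: "T \<in> borel_measurable borel" "distr lborel lborel T = lborel"
  shows "distr (Pi\<^sub>M UNIV (\<lambda>_::'m::finite. lborel)) (Pi\<^sub>M UNIV (\<lambda>_. lborel)) (\<lambda>X i. T (X i)) = Pi\<^sub>M UNIV (\<lambda>_. lborel)"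
proof (rule lborelP.PiM_eqI)
  note [measurable] = T(1)
  have m: "(\<lambda>X i. T (X i)) \<in> Pi\<^sub>M UNIV (\<lambda>_::'m. lborel) \<rightarrow>\<^sub>M Pi\<^sub>M UNIV (\<lambda>_. lborel)"
    by (rule measurable_PiM_single') (auto simp: space_PiM)
  fix A :: "'m \<Rightarrow> 'a set" assume A: "\<And>i. i \<in> UNIV \<Longrightarrow> A i \<in> sets lborel"
  have A': "T -` A i \<in> sets lborel" for i
    using measurable_sets[OF T(1), of "A i"] A by simp
  have "emeasure (distr (Pi\<^sub>M UNIV (\<lambda>_::'m. lborel)) (Pi\<^sub>M UNIV (\<lambda>_. lborel)) (\<lambda>X i. T (X i))) (Pi\<^sub>E UNIV A)
    = emeasure (Pi\<^sub>M UNIV (\<lambda>_::'m. lborel)) ((\<lambda>X i. T (X i)) -` Pi\<^sub>E UNIV A \<inter> space (Pi\<^sub>M UNIV (\<lambda>_. lborel)))"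
    using A by (intro emeasure_distr m sets_PiM_I_finite) auto
  also have "(\<lambda>X i. T (X i)) -` Pi\<^sub>E UNIV A \<inter> space (Pi\<^sub>M UNIV (\<lambda>_::'m. lborel :: 'a measure)) = Pi\<^sub>E UNIV (\<lambda>i. T -` A i)"
    by (auto simp: space_PiM PiE_def Pi_def)
  also have "emeasure (Pi\<^sub>M UNIV (\<lambda>_::'m. lborel)) (Pi\<^sub>E UNIV (\<lambda>i. T -` A i)) = (\<Prod>i\<in>UNIV. emeasure lborel (T -` A i))"
    by (rule lborelP.emeasure_PiM) (use A' in auto)
  also have "\<dots> = (\<Prod>i\<in>UNIV. emeasure lborel (A i))"
  proof (rule prod.cong)
    fix i
    have "emeasure (distr lborel lborel T) (A i) = emeasure lborel (T -` A i)"
      using A by (subst emeasure_distr) auto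
    then show "emeasure lborel (T -` A i) = emeasure lborel (A i)" by (simp add: T(2))
  qed simp
  finally show "emeasure (distr (Pi\<^sub>M UNIV (\<lambda>_::'m. lborel)) (Pi\<^sub>M UNIV (\<lambda>_. lborel)) (\<lambda>X i. T (X i))) (Pi\<^sub>E UNIV A)
    = (\<Prod>i\<in>UNIV. emeasure lborel (A i))" .
qed simp_all

section \<open>Measurability of the chord speed\<close>

definition chord_min :: "real^'n \<Rightarrow> (real^'n) set \<Rightarrow> real^'n \<Rightarrow> real" where
  "chord_min \<theta> S x = Inf ((\<lambda>y. y \<bullet> \<theta>) ` {y \<in> S. proj_perp \<theta> y = proj_perp \<theta> x})"

lemma continuous_on_proj_perp: "continuous_on A (proj_perp \<theta>)"
  unfolding proj_perp_def[abs_def] by (intro continuous_intros)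

lemma chord_min_attained:
  assumes S: "compact S" and x: "proj_perp \<theta> x \<in> proj_perp \<theta> ` S"
  obtains y where "y \<in> S" "proj_perp \<theta> y = proj_perp \<theta> x" "chord_min \<theta> S x = y \<bullet> \<theta>"
    "\<And>z. z \<in> S \<Longrightarrow> proj_perp \<theta> z = proj_perp \<theta> x \<Longrightarrow> y \<bullet> \<theta> \<le> z \<bullet> \<theta>"
proof -
  let ?C = "{y \<in> S. proj_perp \<theta> y = proj_perp \<theta> x}"
  have "?C = S \<inter> proj_perp \<theta> -` {proj_perp \<theta> x}" by auto
  then have "compact ?C"
    using S by (auto intro!: compact_Int_closed closed_vimage continuous_on_proj_perp)
  moreover have "?C \<noteq> {}" using x by force
  moreover have "continuous_on ?C (\<lambda>y. y \<bullet> \<theta>)" by (intro continuous_intros)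
  ultimately obtain y where y: "y \<in> ?C" "\<forall>z\<in>?C. y \<bullet> \<theta> \<le> z \<bullet> \<theta>"
    using continuous_attains_inf[of ?C "\<lambda>y. y \<bullet> \<theta>"] by blast
  have "chord_min \<theta> S x = y \<bullet> \<theta>"
    unfolding chord_min_def using y by (intro cInf_eq_minimum) auto
  with y that show thesis by auto
qed

text \<open>The minimum over a chord is attained, so its sublevel set is the preimage of the
  projection of a compact set. The default value 0 adds the complement of the cylinder over
  \<open>S\<close> at levels \<open>c \<ge> 0\<close>.\<close>

lemma borel_measurable_chord_min:
  assumes S: "compact S"
  shows "(\<lambda>x. if proj_perp \<theta> x \<in> proj_perp \<theta> ` S then chord_min \<theta> S x else 0) \<in> borel_measurable borel"
proof (rule borel_measurableI_le)
  fix c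
  let ?P = "proj_perp \<theta>"
  let ?f = "\<lambda>x. if ?P x \<in> ?P ` S then chord_min \<theta> S x else 0"
  have cl: "?P -` (?P ` C) \<in> sets borel" if "compact C" for C
    using that
    by (intro borel_closed closed_vimage compact_imp_closed compact_continuous_image continuous_on_proj_perp)
  have "compact (S \<inter> {y. y \<bullet> \<theta> \<le> c})"
    using S by (intro compact_Int_closed closed_Collect_le continuous_intros)
  note cl = cl[OF this] cl[OF S]
  have "{x. ?f x \<le> c} = ?P -` (?P ` (S \<inter> {y. y \<bullet> \<theta> \<le> c})) \<union> (if 0 \<le> c then - (?P -` (?P ` S)) else {})"
  proof -
    have "chord_min \<theta> S x \<le> c \<longleftrightarrow> ?P x \<in> ?P ` (S \<inter> {y. y \<bullet> \<theta> \<le> c})" if x: "?P x \<in> ?P ` S" for x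
    proof -
      obtain y where y: "y \<in> S" "?P y = ?P x" "chord_min \<theta> S x = y \<bullet> \<theta>"
        "\<And>z. z \<in> S \<Longrightarrow> ?P z = ?P x \<Longrightarrow> y \<bullet> \<theta> \<le> z \<bullet> \<theta>"
        using chord_min_attained[OF S x] by blast
      show ?thesis
      proof
        assume "chord_min \<theta> S x \<le> c"
        with y show "?P x \<in> ?P ` (S \<inter> {y. y \<bullet> \<theta> \<le> c})" by (intro image_eqI[of _ _ y]) auto
      next
        assume "?P x \<in> ?P ` (S \<inter> {y. y \<bullet> \<theta> \<le> c})"
        then obtain z where z: "z \<in> S" "z \<bullet> \<theta> \<le> c" "?P z = ?P x" by auto
        with y(4)[OF z(1,3)] y(3) show "chord_min \<theta> S x \<le> c" by simp
      qed
    qed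
    then show ?thesis by (auto split: if_splits)
  qed
  then show "{x \<in> space borel. ?f x \<le> c} \<in> sets borel" using cl by simp
qed

subsection \<open>Convexity of the integrand\<close>

lemma proj_perp_add_direction:
  assumes "norm \<theta> = 1"
  shows "proj_perp \<theta> (x + s *\<^sub>R \<theta>) = proj_perp \<theta> x"
  using assms by (simp add: proj_perp_def inner_add_left dot_square_norm algebra_simps)

lemma chord_min_shift:
  fixes \<beta> :: "real^'n \<Rightarrow> real"
  assumes \<theta>: "norm \<theta> = 1" and K: "compact K" and x: "proj_perp \<theta> x \<in> proj_perp \<theta> ` K"
  shows "chord_min \<theta> ((\<lambda>x. x + \<beta> (proj_perp \<theta> x) *\<^sub>R \<theta>) ` K) x = chord_min \<theta> K x + \<beta> (proj_perp \<theta> x)"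
proof -
  obtain y where y: "y \<in> K" "proj_perp \<theta> y = proj_perp \<theta> x" "chord_min \<theta> K x = y \<bullet> \<theta>"
    "\<And>z. z \<in> K \<Longrightarrow> proj_perp \<theta> z = proj_perp \<theta> x \<Longrightarrow> y \<bullet> \<theta> \<le> z \<bullet> \<theta>"
    using chord_min_attained[OF K x] by blast
  have 1: "\<theta> \<bullet> \<theta> = 1" using \<theta> by (simp add: dot_square_norm)
  show ?thesis
    unfolding chord_min_def[of _ "_ ` _"]
  proof (rule cInf_eq_minimum)
    show "chord_min \<theta> K x + \<beta> (proj_perp \<theta> x) \<in> (\<lambda>y. y \<bullet> \<theta>) `
        {y \<in> (\<lambda>x. x + \<beta> (proj_perp \<theta> x) *\<^sub>R \<theta>) ` K. proj_perp \<theta> y = proj_perp \<theta> x}"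
    proof (rule image_eqI)
      have "y + \<beta> (proj_perp \<theta> x) *\<^sub>R \<theta> \<in> (\<lambda>x. x + \<beta> (proj_perp \<theta> x) *\<^sub>R \<theta>) ` K"
        using y(1,2) by (intro image_eqI[of _ _ y]) simp_all
      with y(2) show "y + \<beta> (proj_perp \<theta> x) *\<^sub>R \<theta> \<in>
          {y \<in> (\<lambda>x. x + \<beta> (proj_perp \<theta> x) *\<^sub>R \<theta>) ` K. proj_perp \<theta> y = proj_perp \<theta> x}"
        by (simp add: proj_perp_add_direction[OF \<theta>])
    qed (simp add: y(3) inner_add_left 1)
  next
    fix v assume "v \<in> (\<lambda>y. y \<bullet> \<theta>) ` {y \<in> (\<lambda>x. x + \<beta> (proj_perp \<theta> x) *\<^sub>R \<theta>) ` K. proj_perp \<theta> y = proj_perp \<theta> x}"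
    then obtain z where "z \<in> K" "proj_perp \<theta> z = proj_perp \<theta> x" "v = z \<bullet> \<theta> + \<beta> (proj_perp \<theta> x)"
      by (auto simp: proj_perp_add_direction[OF \<theta>] inner_add_left 1)
    with y(3,4) show "chord_min \<theta> K x + \<beta> (proj_perp \<theta> x) \<le> v" by simp
  qed
qed

text \<open>The speed \<open>\<beta>\<close> is not assumed to be measurable. On the projection of \<open>K\<close> it is the difference of
  two functions \<open>chord_min\<close>, hence Borel by compactness of \<open>K\<close> and of its image.\<close>

lemma chord_speed_borel:
  fixes \<beta> :: "real^'n \<Rightarrow> real"
  assumes \<theta>: "norm \<theta> = 1" and K: "compact K" "compact ((\<lambda>x. x + \<beta> (proj_perp \<theta> x) *\<^sub>R \<theta>) ` K)"
  shows "(\<lambda>x. if proj_perp \<theta> x \<in> proj_perp \<theta> ` K then \<beta> (proj_perp \<theta> x) else 0) \<in> borel_measurable borel"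
proof -
  let ?L = "(\<lambda>x. x + \<beta> (proj_perp \<theta> x) *\<^sub>R \<theta>) ` K"
  have P: "proj_perp \<theta> ` ?L = proj_perp \<theta> ` K"
    by (auto simp: image_image proj_perp_add_direction[OF \<theta>])
  have "(\<lambda>x. if proj_perp \<theta> x \<in> proj_perp \<theta> ` K then \<beta> (proj_perp \<theta> x) else 0) =
     (\<lambda>x. (if proj_perp \<theta> x \<in> proj_perp \<theta> ` ?L then chord_min \<theta> ?L x else 0)
        - (if proj_perp \<theta> x \<in> proj_perp \<theta> ` K then chord_min \<theta> K x else 0))"
    unfolding P by (auto simp: fun_eq_iff chord_min_shift[OF \<theta> K(1)])
  also have "\<dots> \<in> borel_measurable borel"
    by (intro borel_measurable_diff borel_measurable_chord_min K)
  finally show ?thesis .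
qed

lemma powr_convex_combination_le:
  fixes x y z u r :: real
  assumes "0 < x" "0 < y" "0 < z" "0 < u" "u < 1" "r \<ge> 1" "z \<le> (1 - u) * x + u * y"
  shows "z powr r \<le> (1 - u) * x powr r + u * y powr r"
proof -
  have "z powr r \<le> ((1 - u) * x + u * y) powr r" using assms by (intro powr_mono2) auto
  also have "\<dots> \<le> (1 - u) * x powr r + u * y powr r"
    using convex_onD[OF powr_convex[OF \<open>r \<ge> 1\<close>], of u x y] assms by simp
  finally show ?thesis .
qed

section \<open>Integrability over tuples in a compact set\<close>

lemma emeasure_PiM_Pi_finite:
  fixes L :: "'a::euclidean_space set"
  assumes "compact L"
  shows "{X. \<forall>i. X i \<in> L} \<in> sets (Pi\<^sub>M UNIV (\<lambda>_::'m::finite. lborel))"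
    and "emeasure (Pi\<^sub>M UNIV (\<lambda>_::'m. lborel)) {X. \<forall>i. X i \<in> L} < \<infinity>"
proof -
  have eq: "{X. \<forall>i. X i \<in> L} = Pi\<^sub>E (UNIV :: 'm set) (\<lambda>_. L)" by (auto simp: PiE_def Pi_def)
  have L: "L \<in> sets lborel" using assms by (simp add: borel_compact)
  show "{X. \<forall>i. X i \<in> L} \<in> sets (Pi\<^sub>M UNIV (\<lambda>_::'m. lborel))"
    unfolding eq using L by (intro sets_PiM_I_finite) auto
  show "emeasure (Pi\<^sub>M UNIV (\<lambda>_::'m. lborel)) {X. \<forall>i. X i \<in> L} < \<infinity>"
    unfolding eq using L emeasure_bounded_finite[OF compact_imp_bounded[OF assms]]
    by (subst lborelP.emeasure_PiM) (auto simp: ennreal_prod_eq_top less_top[symmetric] power_eq_top_ennreal)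
qed

text \<open>The indicator records membership alone: on degenerate tuples the power is already 0. The
  constant \<open>n!\<close> is kept outside.\<close>

definition santalo_integrand :: "real \<Rightarrow> (real^'n) set \<Rightarrow> ('m::finite \<Rightarrow> real^'n) \<Rightarrow> real" where
  "santalo_integrand r L X = indicator {X. \<forall>i. X i \<in> L} X * enn2real (min_exp_int X) powr (- r)"

lemma W_santalo_eq_integral:
  fixes L :: "(real^'n) set"
  shows "W_santalo r L (simplex_C :: (real^'m::finite) set) =
    fact CARD('n) powr r / measure lborel L powr (real CARD('m) + r) *
    (LINT X|Pi\<^sub>M UNIV (\<lambda>_::'m. lborel). santalo_integrand r L X)"
proof -
  have "indicator {X :: 'm \<Rightarrow> real^'n. (\<forall>i. X i \<in> L) \<and> interior (convex hull range X) \<noteq> {}} X *\<^sub>R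
      measure lborel (santalo_polar (lin_image X simplex_C)) powr - r =
      fact CARD('n) powr r * santalo_integrand r L X" for X
  proof (cases "interior (convex hull range X) = {}")
    case True
    then show ?thesis by (simp add: santalo_integrand_def min_exp_int_degenerate)
  next
    case False
    have "(enn2real (min_exp_int X) / fact CARD('n)) powr - r = fact CARD('n) powr r * enn2real (min_exp_int X) powr - r"
      by (simp add: powr_divide powr_minus field_simps)
    with False show ?thesis by (simp add: santalo_integrand_def measure_santalo_polar indicator_def)
  qed
  then show ?thesis by (simp add: W_santalo_def set_lebesgue_integral_def)
qed

lemma borel_measurable_santalo_integrand:
  assumes "compact L"
  shows "santalo_integrand r L \<in> borel_measurable (Pi\<^sub>M UNIV (\<lambda>_::'m::finite. lborel))"
proof -
  note [measurable] = borel_measurable_min_exp_int emeasure_PiM_Pi_finite(1)[OF assms]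
  show ?thesis unfolding santalo_integrand_def[abs_def] by measurable
qed

lemma integrable_santalo_integrand:
  fixes L :: "(real^'n) set"
  assumes L: "compact L" and r: "r \<ge> 1"
  shows "integrable (Pi\<^sub>M UNIV (\<lambda>_::'m::finite. lborel)) (santalo_integrand r L)"
proof -
  let ?P = "Pi\<^sub>M UNIV (\<lambda>_::'m. lborel :: (real^'n) measure)"
  let ?A = "{X :: 'm \<Rightarrow> real^'n. \<forall>i. X i \<in> L}"
  obtain R where R: "R \<ge> 0" "\<And>x. x \<in> L \<Longrightarrow> norm x \<le> R"
    using compact_imp_bounded[OF L] by (metis bounded_pos less_imp_le)
  obtain c where c: "c > 0" "\<And>X :: 'm \<Rightarrow> real^'n. (\<And>i. norm (X i) \<le> R) \<Longrightarrow> ennreal c \<le> min_exp_int X"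
    by (rule min_exp_int_lower_bound[OF R(1)]) blast
  have "integrable ?P (\<lambda>X. indicator ?A X * c powr (- r))"
    using emeasure_PiM_Pi_finite[OF L, where 'm='m] by (intro integrable_mult_left integrable_real_indicator)
  then show ?thesis
  proof (rule Bochner_Integration.integrable_bound)
    have "enn2real (min_exp_int X) powr (- r) \<le> c powr (- r)" if "X \<in> ?A" for X
    proof (cases "min_exp_int X")
      case (real m)
      with c(2)[of X] R(2) that have "c \<le> m" by (auto simp: ennreal_le_iff)
      then show ?thesis using c(1) r real by (simp add: powr_mono2')
    qed simp
    then show "AE X in ?P. norm (santalo_integrand r L X) \<le> norm (indicator ?A X * c powr (- r))"
      by (intro AE_I2) (auto simp: santalo_integrand_def split: split_indicator)
  qed (rule borel_measurable_santalo_integrand[OF L])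
qed

lemma santalo_integrand_convex_combination:
  fixes X0 X1 X :: "'m::finite \<Rightarrow> real^'n"
  assumes \<theta>: "\<theta> \<noteq> 0" and u: "0 < u" "u < 1" and r: "r \<ge> 1"
    and X1: "\<And>i. X1 i = X0 i + \<gamma> i *\<^sub>R \<theta>" and X: "\<And>i. X i = X0 i + (u * \<gamma> i) *\<^sub>R \<theta>"
    and ne: "interior (convex hull range X) \<noteq> {}" and ne0: "interior (convex hull range X0) \<noteq> {}"
    and ne1: "interior (convex hull range X1) \<noteq> {}"
    and sets: "(\<forall>i. X0 i \<in> L0) \<longleftrightarrow> (\<forall>i. X i \<in> L)" "(\<forall>i. X1 i \<in> L1) \<longleftrightarrow> (\<forall>i. X i \<in> L)"
  shows "santalo_integrand r L X \<le> (1 - u) * santalo_integrand r L0 X0 + u * santalo_integrand r L1 X1"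
proof -
  obtain c where c: "c > 0" "min_exp_int X = ennreal c" by (rule min_exp_int_pos[OF ne])
  obtain c0 where c0: "c0 > 0" "min_exp_int X0 = ennreal c0" by (rule min_exp_int_pos[OF ne0])
  obtain c1 where c1: "c1 > 0" "min_exp_int X1 = ennreal c1" by (rule min_exp_int_pos[OF ne1])
  have "1 / c \<le> (1 - u) * (1 / c0) + u * (1 / c1)"
    using min_exp_int_inverse_convex[OF \<theta> u X1 X ne ne0 ne1] c c0 c1 by simp
  then have "(1 / c) powr r \<le> (1 - u) * (1 / c0) powr r + u * (1 / c1) powr r"
    using c c0 c1 u r by (intro powr_convex_combination_le) auto
  then show ?thesis
    using c c0 c1 sets by (simp add: santalo_integrand_def powr_minus_divide powr_divide split: split_indicator)
qed

section \<open>Integration over a common domain\<close>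

theorem theorem3p6:
  fixes K :: "(real^'n) set" and \<beta> :: "real^'n \<Rightarrow> real" and \<theta> :: "real^'n"
    and Kt :: "real \<Rightarrow> (real^'n) set" and r :: real
  assumes "CARD('m::finite) \<ge> CARD('n) + 1"
    and "r \<ge> 1"
    and "rs_movement K \<beta> \<theta> (-1) 1 Kt"
    and "\<And>t. t \<in> {-1..1} \<Longrightarrow> convex_body (Kt t)"
  shows "convex_on {-1..1} (\<lambda>t. W_santalo r (Kt t) (simplex_C :: (real^'m) set))"
proof -
  let ?T = "{-1..1} :: real set"
  let ?P = "Pi\<^sub>M UNIV (\<lambda>_::'m. lborel :: (real^'n) measure)"
  have \<theta>: "norm \<theta> = 1"
    and Kt: "\<And>t. t \<in> ?T \<Longrightarrow> Kt t = convex hull ((\<lambda>x. x + (t * \<beta> (proj_perp \<theta> x)) *\<^sub>R \<theta>) ` K)"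
    and cv: "\<And>t. t \<in> ?T \<Longrightarrow> convex ((\<lambda>x. x + (t * \<beta> (proj_perp \<theta> x)) *\<^sub>R \<theta>) ` K)"
    using assms(3) by (auto simp: rs_movement_def shadow_system_def)
  have \<theta>0: "\<theta> \<noteq> 0" using \<theta> by auto
  \<comment> \<open>Convexity of the moved chords in \<open>rs_movement\<close> makes the hull equal
    to the image itself, so that \<open>Kt t\<close> becomes the image of \<open>K\<close> under a
    shear.\<close>
  have Kt': "Kt t = (\<lambda>x. x + (t * \<beta> (proj_perp \<theta> x)) *\<^sub>R \<theta>) ` K" if "t \<in> ?T" for t
    using Kt[OF that] hull_same[of convex, OF cv[OF that]] by simp
  have comp: "compact (Kt t)" if "t \<in> ?T" for t
    using assms(4)[OF that] by (simp add: convex_body_def)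
  have "Kt 0 = K" using Kt'[of 0] by simp
  with comp[of 0] have K: "compact K" by simp
  \<comment> \<open>The default 0 off the projection of \<open>K\<close> discards values of
    \<open>\<beta>\<close> that nothing controls. The result is a Borel function of the projection,
    so \<open>F t\<close> is a shear of the whole space that moves \<open>K\<close> as
    prescribed.\<close>
  define \<phi> where "\<phi> t x = (if proj_perp \<theta> x \<in> proj_perp \<theta> ` K then t * \<beta> (proj_perp \<theta> x) else 0)" for t x
  define F where "F t x = x + \<phi> t x *\<^sub>R \<theta>" for t x
  have inv: "\<phi> t (x + s *\<^sub>R \<theta>) = \<phi> t x" for t x s
    by (simp add: \<phi>_def proj_perp_add_direction[OF \<theta>])
  have \<phi>_meas: "\<phi> t \<in> borel_measurable borel" if "t \<in> ?T" for t
    unfolding \<phi>_def[abs_def] using chord_speed_borel[OF \<theta> K, of "\<lambda>z. t * \<beta> z"] comp[OF that] Kt'[OF that] by simp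
  have F_meas: "F t \<in> borel_measurable borel" if "t \<in> ?T" for t
  proof -
    note [measurable] = \<phi>_meas[OF that]
    show ?thesis unfolding F_def[abs_def] by measurable
  qed
  have F_distr: "distr lborel lborel (F t) = lborel" if "t \<in> ?T" for t
    unfolding F_def[abs_def] by (rule distr_lborel_shear[OF \<phi>_meas[OF that] inv])
  have F_image: "F t ` K = Kt t" if "t \<in> ?T" for t
    unfolding Kt'[OF that] F_def \<phi>_def by (intro image_cong) auto
  \<comment> \<open>\<open>F t\<close> keeps projections, and the displacement depends only on the
    projection. Two points with the same image therefore coincide, and nothing outside
    \<open>K\<close> can enter \<open>Kt t\<close>.\<close>
  have F_in: "F t x \<in> Kt t \<longleftrightarrow> x \<in> K" if t: "t \<in> ?T" for t x
  proof
    assume "F t x \<in> Kt t"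
    then obtain y where y: "y \<in> K" "F t x = F t y" using F_image[OF t] by auto
    have "proj_perp \<theta> (F t x) = proj_perp \<theta> (F t y)" using y by simp
    then have "proj_perp \<theta> x = proj_perp \<theta> y" by (simp add: F_def proj_perp_add_direction[OF \<theta>])
    then have "\<phi> t x = \<phi> t y" by (simp add: \<phi>_def)
    with y show "x \<in> K" by (simp add: F_def)
  qed (use F_image[OF t] in auto)
  have vol: "measure lborel (Kt t) = measure lborel K" if t: "t \<in> ?T" for t
  proof -
    have "measure lborel (Kt t) = measure (distr lborel lborel (F t)) (Kt t)" by (simp add: F_distr[OF t])
    also have "\<dots> = measure lborel (F t -` Kt t \<inter> space lborel)"
      using F_meas[OF t] comp[OF t] by (intro measure_distr) (auto simp: borel_compact)
    also have "F t -` Kt t \<inter> space lborel = K" using F_in[OF t] by auto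
    finally show ?thesis .
  qed
  define H where "H t X = santalo_integrand r (Kt t) (\<lambda>i. F t (X i))" for t and X :: "'m \<Rightarrow> real^'n"
  have FF_meas: "(\<lambda>X i. F t (X i)) \<in> ?P \<rightarrow>\<^sub>M ?P" if "t \<in> ?T" for t
  proof -
    note [measurable] = F_meas[OF that]
    show ?thesis by (rule measurable_PiM_single') (auto simp: space_PiM)
  qed
  have FF_distr: "distr ?P ?P (\<lambda>X i. F t (X i)) = ?P" if "t \<in> ?T" for t
    by (rule distr_PiM_componentwise[OF F_meas[OF that] F_distr[OF that]])
  have int_eq: "(LINT X|?P. santalo_integrand r (Kt t) X) = (LINT X|?P. H t X)"
    and H_int: "integrable ?P (H t)" if t: "t \<in> ?T" for t
  proof -
    have "(LINT X|distr ?P ?P (\<lambda>X i. F t (X i)). santalo_integrand r (Kt t) X) = (LINT X|?P. H t X)"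
      unfolding H_def by (intro integral_distr FF_meas t borel_measurable_santalo_integrand comp)
    then show "(LINT X|?P. santalo_integrand r (Kt t) X) = (LINT X|?P. H t X)" by (simp add: FF_distr[OF t])
    have "integrable (distr ?P ?P (\<lambda>X i. F t (X i))) (santalo_integrand r (Kt t))"
      unfolding FF_distr[OF t] by (intro integrable_santalo_integrand comp t assms(2))
    then show "integrable ?P (H t)" unfolding H_def by (rule integrable_distr[OF FF_meas[OF t]])
  qed
  have AE_ne: "AE X in ?P. interior (convex hull range (\<lambda>i. F t (X i))) \<noteq> {}" if t: "t \<in> ?T" for t
  proof (rule AE_distrD[OF FF_meas[OF t]])
    show "AE X in distr ?P ?P (\<lambda>X i. F t (X i)). interior (convex hull range X) \<noteq> {}"
      unfolding FF_distr[OF t] by (rule AE_interior_convex_hull_range[OF assms(1)])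
  qed
  define C where "C = fact CARD('n) powr r / measure lborel K powr (real CARD('m) + r)"
  have C: "C \<ge> 0" by (simp add: C_def)
  have W: "W_santalo r (Kt t) (simplex_C :: (real^'m) set) = C * (LINT X|?P. H t X)" if "t \<in> ?T" for t
    unfolding W_santalo_eq_integral C_def vol[OF that] int_eq[OF that] ..
  show ?thesis
  proof (rule convex_onI)
    fix u x y :: real assume u: "0 < u" "u < 1" and xy: "x \<in> ?T" "y \<in> ?T"
    define t where "t = (1 - u) * x + u * y"
    have t: "t \<in> ?T"
      using convexD_alt[of ?T x y u] xy u by (simp add: t_def)
    have "AE X in ?P. H t X \<le> (1 - u) * H x X + u * H y X"
      using AE_ne[OF xy(1)] AE_ne[OF xy(2)] AE_ne[OF t]
    proof eventually_elim
      case (elim X)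
      show ?case unfolding H_def
      \<comment> \<open>As \<open>\<phi>\<close> is linear in time, the tuples at times
        \<open>x\<close>, \<open>t\<close>, \<open>y\<close> form a shadow system with speed
        \<open>\<phi> (y - x)\<close>. The difference \<open>y - x\<close> may leave the time
        interval, but it enters only through this algebra.\<close>
      proof (rule santalo_integrand_convex_combination[OF \<theta>0 u assms(2), where \<gamma> = "\<lambda>i. \<phi> (y - x) (X i)"])
        show "F y (X i) = F x (X i) + \<phi> (y - x) (X i) *\<^sub>R \<theta>" "F t (X i) = F x (X i) + (u * \<phi> (y - x) (X i)) *\<^sub>R \<theta>" for i
          by (simp_all add: F_def \<phi>_def t_def algebra_simps)
      qed (use elim in \<open>simp_all add: F_in[OF xy(1)] F_in[OF xy(2)] F_in[OF t]\<close>)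
    qed
    then have "(LINT X|?P. H t X) \<le> (LINT X|?P. (1 - u) * H x X + u * H y X)"
      by (intro integral_mono_AE H_int xy t Bochner_Integration.integrable_add integrable_mult_right)
    also have "\<dots> = (1 - u) * (LINT X|?P. H x X) + u * (LINT X|?P. H y X)"
      using H_int[OF xy(1)] H_int[OF xy(2)] by simp
    finally have "C * (LINT X|?P. H t X) \<le> C * ((1 - u) * (LINT X|?P. H x X) + u * (LINT X|?P. H y X))"
      using C by (intro mult_left_mono)
    moreover have "(1 - u) *\<^sub>R x + u *\<^sub>R y = t" by (simp add: t_def)
    ultimately show "W_santalo r (Kt ((1 - u) *\<^sub>R x + u *\<^sub>R y)) (simplex_C :: (real^'m) set)
      \<le> (1 - u) * W_santalo r (Kt x) (simplex_C :: (real^'m) set) + u * W_santalo r (Kt y) (simplex_C :: (real^'m) set)"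
      by (simp add: W[OF xy(1)] W[OF xy(2)] W[OF t] algebra_simps)
  qed simp
qed

end
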